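(* Let $n=2l$, let $P$ be a standard parabolic subgroup of $\mathrm{SP}_n=\mathrm{SP}_n(\mathbf{C})$, given as the stabilizer of a totally isotropic flag $V_1\subset\dots\subset V_k$, and let $(b_1,\dots,b_k)$ be its block vector. Let $P$ act by conjugation on $\mathcal{N}(2)=\{x\in\mathfrak{sp}_n\mid x^2=0\}$. Then there is a natural bijection between the set of $P$-orbits in $\mathcal{N}(2)$ and the set of enhanced symplectic oriented link patterns of size $k$ and of type $(b_1,\dots,b_k)$.
   Context: The ground field is $K=\mathbf{C}$. Let $J_l$ be the $l\times l$ anti-diagonal matrix with all anti-diagonal entries equal to $1$, and $F=\begin{pmatrix}0&J_l\\-J_l&0\end{pmatrix}$. Then $\mathrm{SP}_{2l}=\{A\in \mathrm{GL}_{2l}(K)\mid A^TFA=F\}$ with Lie algebra $\mathfrak{sp}_{2l}=\{a\mid a^TF+Fa=0\}$; its standard Borel subgroup $B$ consists of its upper-triangular matrices, and a standard parabolic subgroup is a subgroup $P$ containing $B$. A totally isotropic flag is a chain of nonzero subspaces $V_1\subsetneq\dots\subsetneq V_k$ of $K^{n}$ on each of which the bilinear form given by $F$ vanishes identically; a parabolic subgroup is the stabilizer of such a flag. Put $d_i=\dim V_i$; the block vector of $P$ is $(b_1,\dots,b_k)=(d_1,d_2-d_1,\dots,d_k-d_{k-1})$. An enhanced symplectic oriented link pattern (esolp) of size $k$ of type $(b_1,\dots,b_k)$ consists of $k$ vertices $1,\dots,k$ together with a collection of (undotted) oriented arrows between different vertices, a collection of (undotted) unoriented loops, and a collection of oriented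 arrows with dots between arbitrary vertices. Multiple arrows and multiple loops are allowed, and only their multiplicities matter. Loops with dots come in two different orientations (clockwise and counterclockwise), which are regarded as different. For each vertex $i$ let $x_i$ be the number of sources of oriented arrows at $i$ and $y_i$ the number of targets of oriented arrows at $i$ (dotted and undotted; a dotted loop at $i$ contributes $1$ to $x_i$ and $1$ to $y_i$; unoriented loops contribute to neither), let $z_i$ be the number of unoriented loops at $i$ and $l_i$ the number of dotted loops at $i$. The pattern is required to satisfy, for each vertex $i$: $x_i+y_i+2z_i-l_i\leq b_i$.
   Formalization: The flag is additionally assumed to satisfy dim V_k = l; when dim V_k < l the claim fails, e.g. for l = 3, k = 1, dim V_1 = 1 there are 3 patterns of type (1) but at least 4 orbits (ranks 0 to 3). *)

theory Defs
  imports
    "Jordan_Normal_Form.VS_Connect"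
    "HOL-Algebra.Group_Action"
    "HOL-Library.Multiset"
begin

section \<open>The symplectic group and its Lie algebra\<close>

definition J_mat :: "nat \<Rightarrow> complex mat" where
  "J_mat l = mat l l (\<lambda>(i, j). if i + j + 1 = l then 1 else 0)"

definition F_mat :: "nat \<Rightarrow> complex mat" where
  "F_mat l = four_block_mat (0\<^sub>m l l) (J_mat l) (- J_mat l) (0\<^sub>m l l)"

definition SP :: "nat \<Rightarrow> complex mat set" where
  "SP l = {A \<in> carrier_mat (2 * l) (2 * l).
     invertible_mat A \<and> transpose_mat A * F_mat l * A = F_mat l}"

definition SP_group :: "nat \<Rightarrow> complex mat monoid" where
  "SP_group l = \<lparr>carrier = SP l, mult = (*), one = 1\<^sub>m (2 * l)\<rparr>"

definition sp :: "nat \<Rightarrow> complex mat set" where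
  "sp l = {a \<in> carrier_mat (2 * l) (2 * l).
     transpose_mat a * F_mat l + F_mat l * a = 0\<^sub>m (2 * l) (2 * l)}"

definition N2 :: "nat \<Rightarrow> complex mat set" where
  "N2 l = {x \<in> sp l. x * x = 0\<^sub>m (2 * l) (2 * l)}"

definition conj_action :: "nat \<Rightarrow> complex mat \<Rightarrow> complex mat \<Rightarrow> complex mat" where
  "conj_action l g x = g * x * inv\<^bsub>SP_group l\<^esub> g"

section \<open>Standard parabolic subgroups and totally isotropic flags\<close>

definition Borel :: "nat \<Rightarrow> complex mat set" where
  "Borel l = {A \<in> SP l. upper_triangular A}"

definition standard_parabolic :: "nat \<Rightarrow> complex mat set \<Rightarrow> bool" where
  "standard_parabolic l P \<longleftrightarrow> subgroup P (SP_group l) \<and> Borel l \<subseteq> P"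

definition symp_form :: "nat \<Rightarrow> complex vec \<Rightarrow> complex vec \<Rightarrow> complex" where
  "symp_form l v w = v \<bullet> (F_mat l *\<^sub>v w)"

definition subspace_dim :: "nat \<Rightarrow> complex vec set \<Rightarrow> nat" where
  "subspace_dim n V = vectorspace.dim class_ring ((module_vec TYPE(complex) n)\<lparr>carrier := V\<rparr>)"

text \<open>The list \<open>Vs\<close> is \<open>[V\<^sub>1, \<dots>, V\<^sub>k]\<close>, so \<open>V\<^sub>i\<close> is \<open>Vs ! (i - 1)\<close>.\<close>

definition isotropic_flag :: "nat \<Rightarrow> complex vec set list \<Rightarrow> bool" where
  "isotropic_flag l Vs \<longleftrightarrow> Vs \<noteq> [] \<and> sorted_wrt (\<subset>) Vs \<and>
     (\<forall>V \<in> set Vs. subspace class_ring V (module_vec TYPE(complex) (2 * l)) \<and>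
        V \<noteq> {0\<^sub>v (2 * l)} \<and> (\<forall>v \<in> V. \<forall>w \<in> V. symp_form l v w = 0))"

definition flag_stabilizer :: "nat \<Rightarrow> complex vec set list \<Rightarrow> complex mat set" where
  "flag_stabilizer l Vs = {A \<in> SP l. \<forall>V \<in> set Vs. (\<lambda>v. A *\<^sub>v v) ` V = V}"

definition block_vector :: "nat \<Rightarrow> complex vec set list \<Rightarrow> nat list" where
  "block_vector l Vs = map (\<lambda>i. subspace_dim (2 * l) (Vs ! i) -
     (if i = 0 then 0 else subspace_dim (2 * l) (Vs ! (i - 1)))) [0..<length Vs]"

section \<open>Enhanced symplectic oriented link patterns\<close>

datatype orientation = Clockwise | Counterclockwise

datatype esolp_edge =
    Arrow nat nat
  | Loop nat
  | Dotted_Arrow nat nat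
  | Dotted_Loop orientation nat

fun edge_wf :: "nat \<Rightarrow> esolp_edge \<Rightarrow> bool" where
  "edge_wf k (Arrow i j) \<longleftrightarrow> i \<in> {1..k} \<and> j \<in> {1..k} \<and> i \<noteq> j"
| "edge_wf k (Loop i) \<longleftrightarrow> i \<in> {1..k}"
| "edge_wf k (Dotted_Arrow i j) \<longleftrightarrow> i \<in> {1..k} \<and> j \<in> {1..k} \<and> i \<noteq> j"
| "edge_wf k (Dotted_Loop c i) \<longleftrightarrow> i \<in> {1..k}"

fun sources :: "esolp_edge \<Rightarrow> nat multiset" where
  "sources (Arrow i j) = {#i#}"
| "sources (Loop i) = {#}"
| "sources (Dotted_Arrow i j) = {#i#}"
| "sources (Dotted_Loop c i) = {#i#}"

fun targets :: "esolp_edge \<Rightarrow> nat multiset" where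
  "targets (Arrow i j) = {#j#}"
| "targets (Loop i) = {#}"
| "targets (Dotted_Arrow i j) = {#j#}"
| "targets (Dotted_Loop c i) = {#i#}"

text \<open>A pattern is a multiset of edges, since only multiplicities matter.\<close>

definition num_sources :: "esolp_edge multiset \<Rightarrow> nat \<Rightarrow> nat" where
  "num_sources p i = count (\<Sum>e \<in># p. sources e) i"

definition num_targets :: "esolp_edge multiset \<Rightarrow> nat \<Rightarrow> nat" where
  "num_targets p i = count (\<Sum>e \<in># p. targets e) i"

definition num_loops :: "esolp_edge multiset \<Rightarrow> nat \<Rightarrow> nat" where
  "num_loops p i = count p (Loop i)"

definition num_dotted_loops :: "esolp_edge multiset \<Rightarrow> nat \<Rightarrow> nat" where
  "num_dotted_loops p i =
     count p (Dotted_Loop Clockwise i) + count p (Dotted_Loop Counterclockwise i)"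

text \<open>The subtraction below never truncates, because every dotted loop at \<open>i\<close> is also
  counted in \<open>num_sources p i\<close>.\<close>

definition esolps :: "nat list \<Rightarrow> esolp_edge multiset set" where
  "esolps b = {p. (\<forall>e \<in># p. edge_wf (length b) e) \<and>
     (\<forall>i \<in> {1..length b}.
        num_sources p i + num_targets p i + 2 * num_loops p i - num_dotted_loops p i
          \<le> b ! (i - 1))}"

text \<open>
  The vertices and their duals only account for \<open>V\<^sub>k\<close> and \<open>K\<^bsup>2l\<^esup> / V\<^sub>k\<^sup>\<bottom>\<close>, not for
  \<open>V\<^sub>k\<^sup>\<bottom> / V\<^sub>k\<close>, so these patterns can parametrize the orbits only if \<open>V\<^sub>k\<close> is Lagrangian,
  \<open>dim V\<^sub>k = l\<close>.  For instance \<open>esolps [1]\<close> has three elements, whereas \<open>N2 l\<close> contains matrices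
  of every rank \<open>0, \<dots>, l\<close> and hence at least \<open>l + 1\<close> orbits under any group of conjugations.
\<close>

section \<open>The orbit attached to a pattern\<close>

text \<open>
  Rows and columns are numbered from \<open>0\<close> and \<open>a\<^sup>* = 2 * l - 1 - a\<close>, so that the form pairs
  the standard basis vectors \<open>e\<^sub>a\<close> and \<open>e\<^bsub>a*\<^esub>\<close> for \<open>a < l\<close>.  The positions in \<open>vertex_block b i\<close>
  index the basis vectors of \<open>V\<^sub>i\<close> that do not lie in \<open>V\<^bsub>i-1\<^esub>\<close>.  An edge of a pattern is placed at
  a source position \<open>s\<close> and a target position \<open>t\<close> and describes the action of the matrix on
  \<open>e\<^sub>s, e\<^sub>t, e\<^bsub>s*\<^esub>, e\<^bsub>t*\<^esub>\<close>:

  \<^item> an undotted arrow or loop: \<open>e\<^sub>s \<mapsto> e\<^sub>t\<close> and \<open>e\<^bsub>t*\<^esub> \<mapsto> - e\<^bsub>s*\<^esub>\<close>;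
  \<^item> a dotted arrow from a smaller to a larger vertex: \<open>e\<^sub>s \<mapsto> e\<^bsub>t*\<^esub>\<close> and \<open>e\<^sub>t \<mapsto> e\<^bsub>s*\<^esub>\<close>;
  \<^item> a dotted arrow from a larger to a smaller vertex: \<open>e\<^bsub>s*\<^esub> \<mapsto> e\<^sub>t\<close> and \<open>e\<^bsub>t*\<^esub> \<mapsto> e\<^sub>s\<close>;
  \<^item> a clockwise dotted loop (\<open>s = t\<close>): \<open>e\<^sub>s \<mapsto> e\<^bsub>s*\<^esub>\<close>, a counterclockwise one: \<open>e\<^bsub>s*\<^esub> \<mapsto> e\<^sub>s\<close>.

  The two matrix units of an edge are exchanged (up to sign) by the duality that the symplectic
  form induces, which is why one edge on the vertices \<open>1, \<dots>, k\<close> stands for both.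
  Which of the two mutually dual kinds of dotted arrows or loops gets which orientation is a
  convention.
\<close>

definition dual :: "nat \<Rightarrow> nat \<Rightarrow> nat" where
  "dual l a = 2 * l - 1 - a"

text \<open>The matrix unit that sends \<open>e\<^sub>a\<close> to \<open>e\<^sub>c\<close>.\<close>

definition unit_map :: "nat \<Rightarrow> nat \<Rightarrow> nat \<Rightarrow> complex mat" where
  "unit_map l a c = mat (2 * l) (2 * l) (\<lambda>(i, j). if i = c \<and> j = a then 1 else 0)"

fun edge_mat :: "nat \<Rightarrow> esolp_edge \<times> nat \<times> nat \<Rightarrow> complex mat" where
  "edge_mat l (Arrow i j, s, t) = unit_map l s t - unit_map l (dual l t) (dual l s)"
| "edge_mat l (Loop i, s, t) = unit_map l s t - unit_map l (dual l t) (dual l s)"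
| "edge_mat l (Dotted_Arrow i j, s, t) =
     (if i < j then unit_map l s (dual l t) + unit_map l t (dual l s)
      else unit_map l (dual l s) t + unit_map l (dual l t) s)"
| "edge_mat l (Dotted_Loop Clockwise i, s, t) = unit_map l s (dual l s)"
| "edge_mat l (Dotted_Loop Counterclockwise i, s, t) = unit_map l (dual l s) s"

definition vertex_block :: "nat list \<Rightarrow> nat \<Rightarrow> nat set" where
  "vertex_block b i = {sum_list (take (i - 1) b) ..< sum_list (take i b)}"

fun placed :: "nat list \<Rightarrow> esolp_edge \<times> nat \<times> nat \<Rightarrow> bool" where
  "placed b (Arrow i j, s, t) \<longleftrightarrow> s \<in> vertex_block b i \<and> t \<in> vertex_block b j"
| "placed b (Loop i, s, t) \<longleftrightarrow> s \<in> vertex_block b i \<and> t \<in> vertex_block b i"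
| "placed b (Dotted_Arrow i j, s, t) \<longleftrightarrow> s \<in> vertex_block b i \<and> t \<in> vertex_block b j"
| "placed b (Dotted_Loop c i, s, t) \<longleftrightarrow> s \<in> vertex_block b i \<and> t = s"

fun used_positions :: "esolp_edge \<times> nat \<times> nat \<Rightarrow> nat list" where
  "used_positions (Arrow i j, s, t) = [s, t]"
| "used_positions (Loop i, s, t) = [s, t]"
| "used_positions (Dotted_Arrow i j, s, t) = [s, t]"
| "used_positions (Dotted_Loop c i, s, t) = [s]"

definition esolp_matrices :: "nat \<Rightarrow> nat list \<Rightarrow> esolp_edge multiset \<Rightarrow> complex mat set" where
  "esolp_matrices l b p =
     {foldr (+) (map (edge_mat l) qs) (0\<^sub>m (2 * l) (2 * l)) | qs.
        mset (map fst qs) = p \<and> (\<forall>q \<in> set qs. placed b q) \<and>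
        distinct (concat (map used_positions qs))}"

text \<open>All matrices in \<open>esolp_matrices l b p\<close> are conjugate under \<open>P\<close>; the union avoids choosing
  one of them.\<close>

definition esolp_orbit ::
  "nat \<Rightarrow> complex mat set \<Rightarrow> nat list \<Rightarrow> esolp_edge multiset \<Rightarrow> complex mat set" where
  "esolp_orbit l P b p =
     (\<Union>M \<in> esolp_matrices l b p. orbit ((SP_group l)\<lparr>carrier := P\<rparr>) (conj_action l) M)"

end

(*
  For x in sp the bilinear form beta(v, w) = f(v, x w) is symmetric, x^2 = 0 says that the image of
  x is isotropic, and conjugation by a symplectic g becomes congruence of beta.

  Every Borel-stable subspace is spanned by an initial segment of the standard basis, so P consists
  of the symplectic matrices that are block upper triangular for the labelling of the 2l basis
  vectors by the k vertices and their k duals.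

  Normal form: take the first basis vector e_j with x e_j not 0 and the first e_p with
  beta(e_j, e_p) not 0. The vectors e_j, e_p, x e_j, x e_p, with e_p suitably corrected by a multiple
  of e_j, span a nondegenerate x-stable subspace, and the choice of j and p makes the passage to
  its orthogonal complement upper triangular. So the Borel subgroup alone reduces x to a signed
  partial permutation matrix. Only a dotted arrow inside one vertex block needs the Levi subgroup,
  which turns it into two dotted loops.

  Uniqueness: the ranks of the lower left corners cut out by the labelling are invariant under P,
  and their second differences are the multiplicities of the edges of the pattern.
*)

theory Submission
  imports Defs "HOL-Library.Function_Algebras"
begin

section \<open>Conjugation by symplectic matrices\<close>

text \<open>The orthogonal complement is never formed. The whole space stays in play,
  \<open>x\<close> is replaced by conjugates of itself, and an invariant records which columns
  already agree with a pattern matrix. The positions split off so far are closed under duality and,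
  up to scalars, under \<open>x\<close>; later base changes therefore fix them automatically,
  because the correction terms are values of beta that vanish there. Minimality of j and p does two
  jobs. It confines the images to the coordinates up to the duals of p and j, so that they can stand
  at those places of the new basis, and it lets the corrections of the other vectors involve smaller
  indices only. It also excludes that p is dual to j, since a diagonal entry of \<open>x\<close>
  would then survive in its square. For uniqueness, the pairing of units by duality has to be
  undone. Reflection in the antidiagonal exchanges the two units of an edge and fixes the unit of a
  dotted loop, so the cells on or above the antidiagonal see every edge once. The Lagrangian
  condition enters as \<open>sum_list b = l\<close>: vertices and their duals then label all basis
  vectors.\<close>

definition eps :: "nat \<Rightarrow> nat \<Rightarrow> complex" where
  "eps l a = (if a < l then 1 else -1)"

lemma eps_mult_self [simp]: "eps l a * eps l a = 1" "eps l a * (eps l a * z) = z"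
  by (auto simp: eps_def)

lemma eps_nonzero [simp]: "eps l a \<noteq> 0"
  by (auto simp: eps_def)

lemma dual_less [simp]: "a < 2 * l \<Longrightarrow> dual l a < 2 * l"
  by (auto simp: dual_def)

lemma dual_dual [simp]: "a < 2 * l \<Longrightarrow> dual l (dual l a) = a"
  by (auto simp: dual_def)

lemma dual_eq_iff: "a < 2 * l \<Longrightarrow> c < 2 * l \<Longrightarrow> dual l a = c \<longleftrightarrow> a = dual l c"
  by (auto simp: dual_def)

lemma dual_inject [simp]: "a < 2 * l \<Longrightarrow> c < 2 * l \<Longrightarrow> dual l a = dual l c \<longleftrightarrow> a = c"
  by (auto simp: dual_def)

lemma dual_neq [simp]: "a < 2 * l \<Longrightarrow> dual l a \<noteq> a" "a < 2 * l \<Longrightarrow> a \<noteq> dual l a"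
  unfolding dual_def by presburger+

lemma dual_less_dual [simp]: "a < 2 * l \<Longrightarrow> c < 2 * l \<Longrightarrow> dual l a < dual l c \<longleftrightarrow> c < a"
  by (auto simp: dual_def)

lemma dual_less_iff: "a < 2 * l \<Longrightarrow> dual l a < l \<longleftrightarrow> \<not> a < l"
  by (auto simp: dual_def)

lemma eps_dual [simp]: "a < 2 * l \<Longrightarrow> eps l (dual l a) = - eps l a"
  by (auto simp: eps_def dual_less_iff)

lemma bij_betw_dual: "bij_betw (dual l) {..<2*l} {..<2*l}"
  by (rule bij_betwI[of _ _ _ "dual l"]) auto

lemma sum_dual: "(\<Sum>r<2*l. h (dual l r)) = (\<Sum>r<2*l. h r)"
  using sum.reindex_bij_betw[OF bij_betw_dual] .

lemma F_mat_carrier [simp]: "F_mat l \<in> carrier_mat (2*l) (2*l)"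
  by (auto simp: F_mat_def J_mat_def mult_2)

lemma F_mat_dim [simp]: "dim_row (F_mat l) = 2*l" "dim_col (F_mat l) = 2*l"
  using F_mat_carrier[of l] by (auto simp del: F_mat_carrier)

lemma F_mat_index: "a < 2*l \<Longrightarrow> c < 2*l \<Longrightarrow> F_mat l $$ (a, c) = (if c = dual l a then eps l a else 0)"
  by (auto simp: F_mat_def J_mat_def eps_def dual_def)

text \<open>This rule unfolds an entry of a product into a scalar product of a row and a column. The
  next lemma replaces it by a sum over \<open>{..<2*l}\<close>, the shape of all coordinate sums
  below.\<close>

declare index_mult_mat(1) [simp del]

lemma mult_mat_index:
  assumes "A \<in> carrier_mat (2*l) (2*l)" "B \<in> carrier_mat (2*l) (2*l)" "i < 2*l" "j < 2*l"
  shows "(A * B) $$ (i, j) = (\<Sum>k<2*l. A $$ (i, k) * B $$ (k, j))"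
  using assms by (simp add: index_mult_mat(1) scalar_prod_def atLeast0LessThan)

lemma F_mult_index:
  assumes "A \<in> carrier_mat (2*l) (2*l)" "r < 2*l" "c < 2*l"
  shows "(F_mat l * A) $$ (r, c) = eps l r * A $$ (dual l r, c)"
proof -
  have "(F_mat l * A) $$ (r, c) = (\<Sum>k<2*l. if k = dual l r then eps l r * A $$ (k, c) else 0)"
    unfolding mult_mat_index[OF F_mat_carrier assms]
    using assms by (intro sum.cong) (auto simp: F_mat_index)
  then show ?thesis using assms by simp
qed

lemma mult_F_index:
  assumes "A \<in> carrier_mat (2*l) (2*l)" "r < 2*l" "c < 2*l"
  shows "(A * F_mat l) $$ (r, c) = - eps l c * A $$ (r, dual l c)"
proof -
  have "(A * F_mat l) $$ (r, c) = (\<Sum>k<2*l. if k = dual l c then A $$ (r, k) * eps l k else 0)"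
    unfolding mult_mat_index[OF assms(1) F_mat_carrier assms(2,3)]
    using assms by (intro sum.cong) (auto simp: F_mat_index)
  then show ?thesis using assms by simp
qed

lemma F_mat_square: "F_mat l * F_mat l = - 1\<^sub>m (2*l)"
  by (rule eq_matI) (auto simp: F_mult_index F_mat_index)

text \<open>The adjoint of \<open>A\<close> for the symplectic form. Since the square of
  \<open>F_mat l\<close> is -1, multiplying the symplectic condition by \<open>- F_mat l\<close>
  shows that it is the inverse of a symplectic \<open>A\<close>.\<close>

definition symp_adj :: "nat \<Rightarrow> complex mat \<Rightarrow> complex mat" where
  "symp_adj l A = - (F_mat l * transpose_mat A * F_mat l)"

lemma symp_adj_carrier [simp]:
  "A \<in> carrier_mat (2*l) (2*l) \<Longrightarrow> symp_adj l A \<in> carrier_mat (2*l) (2*l)"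
  by (auto simp: symp_adj_def)

text \<open>Up to signs the adjoint is reflection in the antidiagonal, so statements about columns
  of the first half pass to rows and columns of the second half.\<close>

lemma symp_adj_index:
  assumes "A \<in> carrier_mat (2*l) (2*l)" "r < 2*l" "c < 2*l"
  shows "symp_adj l A $$ (r, c) = eps l r * eps l c * A $$ (dual l c, dual l r)"
proof -
  have "(F_mat l * transpose_mat A * F_mat l) $$ (r, c) = - eps l c * (eps l r * A $$ (dual l c, dual l r))"
    using assms by (subst mult_F_index) (auto simp: F_mult_index)
  moreover have "dim_row (F_mat l * transpose_mat A * F_mat l) = 2*l"
      "dim_col (F_mat l * transpose_mat A * F_mat l) = 2*l"
    by auto
  ultimately show ?thesis using assms unfolding symp_adj_def by (simp)
qed

lemma symp_adj_mult:
  assumes A: "A \<in> carrier_mat (2*l) (2*l)" and F: "transpose_mat A * F_mat l * A = F_mat l"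
  shows "symp_adj l A * A = 1\<^sub>m (2*l)"
proof -
  have T: "transpose_mat A \<in> carrier_mat (2*l) (2*l)" using A by auto
  have "F_mat l * transpose_mat A * F_mat l * A = F_mat l * (transpose_mat A * F_mat l * A)"
    using A T assoc_mult_mat[OF F_mat_carrier T F_mat_carrier] 
     assoc_mult_mat[OF F_mat_carrier mult_carrier_mat[OF T F_mat_carrier] A] by simp
  also have "\<dots> = - 1\<^sub>m (2*l)" by (simp add: F F_mat_square)
  finally show ?thesis unfolding symp_adj_def
    using A T by (subst uminus_mult_left_mat) (auto simp: mult_carrier_mat)
qed

lemma SP_iff: "A \<in> SP l \<longleftrightarrow> A \<in> carrier_mat (2*l) (2*l) \<and> transpose_mat A * F_mat l * A = F_mat l"
proof -
  { assume A: "A \<in> carrier_mat (2*l) (2*l)" and F: "transpose_mat A * F_mat l * A = F_mat l"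
    have 1: "symp_adj l A * A = 1\<^sub>m (2*l)" using symp_adj_mult[OF A F] .
    have 2: "A * symp_adj l A = 1\<^sub>m (2*l)"
      using mat_mult_left_right_inverse[OF symp_adj_carrier[OF A] A 1] .
    have "invertible_mat A"
      unfolding invertible_mat_def inverts_mat_def using A 1 2
      by (intro conjI exI[of _ "symp_adj l A"]) (auto simp: carrier_matD carrier_matD[OF symp_adj_carrier]) }
  then show ?thesis unfolding SP_def by auto
qed

lemma SP_carrier: "A \<in> SP l \<Longrightarrow> A \<in> carrier_mat (2*l) (2*l)"
  by (simp add: SP_iff)

lemma SP_inverse:
  assumes "A \<in> SP l"
  shows "symp_adj l A * A = 1\<^sub>m (2*l)" "A * symp_adj l A = 1\<^sub>m (2*l)"
proof -
  have A: "A \<in> carrier_mat (2*l) (2*l)" using assms by (rule SP_carrier)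
  show 1: "symp_adj l A * A = 1\<^sub>m (2*l)" using symp_adj_mult assms by (auto simp: SP_iff)
  show "A * symp_adj l A = 1\<^sub>m (2*l)"
    using mat_mult_left_right_inverse[OF symp_adj_carrier[OF A] A 1] .
qed

lemma SP_one: "1\<^sub>m (2*l) \<in> SP l"
  by (simp add: SP_iff)

lemma SP_mult:
  assumes "A \<in> SP l" "B \<in> SP l"
  shows "A * B \<in> SP l"
proof -
  let ?F = "F_mat l" and ?n = "2*l"
  have A: "A \<in> carrier_mat ?n ?n" "transpose_mat A * ?F * A = ?F"
    and B: "B \<in> carrier_mat ?n ?n" "transpose_mat B * ?F * B = ?F"
    using assms by (auto simp: SP_iff)
  have TA: "transpose_mat A \<in> carrier_mat ?n ?n" and TB: "transpose_mat B \<in> carrier_mat ?n ?n"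
    using A B by auto
  have "transpose_mat (A * B) * ?F * (A * B) = transpose_mat B * (transpose_mat A * ?F * A) * B"
    using A(1) B(1) TA TB
    by (simp add: transpose_mult[OF A(1) B(1)] assoc_mult_mat[of _ ?n ?n _ ?n _ ?n] mult_carrier_mat[of _ ?n ?n _ ?n])
  then show ?thesis using A B by (auto simp: SP_iff)
qed

lemma symp_adj_SP:
  assumes "A \<in> SP l"
  shows "symp_adj l A \<in> SP l"
proof -
  let ?F = "F_mat l" and ?n = "2*l" and ?A' = "symp_adj l A"
  have A: "A \<in> carrier_mat ?n ?n" "transpose_mat A * ?F * A = ?F" using assms by (auto simp: SP_iff)
  have A': "?A' \<in> carrier_mat ?n ?n" using A by simp
  have "transpose_mat ?A' * (transpose_mat A * ?F * A) * ?A' = transpose_mat (A * ?A') * ?F * (A * ?A')"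
    using A(1) A' by (simp add: transpose_mult[OF A(1) A'] assoc_mult_mat[of _ ?n ?n _ ?n _ ?n] mult_carrier_mat[of _ ?n ?n _ ?n])
  then show ?thesis using A A' SP_inverse(2)[OF assms] by (simp add: SP_iff)
qed

lemma SP_group_simps [simp]:
  "carrier (SP_group l) = SP l" "mult (SP_group l) = (*)" "one (SP_group l) = 1\<^sub>m (2*l)"
  by (auto simp: SP_group_def)

lemma group_SP: "group (SP_group l)"
proof (rule groupI)
  fix x assume "x \<in> carrier (SP_group l)"
  then show "\<exists>y\<in>carrier (SP_group l). y \<otimes>\<^bsub>SP_group l\<^esub> x = \<one>\<^bsub>SP_group l\<^esub>"
    by (intro bexI[of _ "symp_adj l x"]) (auto simp: SP_inverse symp_adj_SP)
qed (auto simp: SP_one SP_mult dest!: SP_carrier)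

lemma inv_SP: "A \<in> SP l \<Longrightarrow> inv\<^bsub>SP_group l\<^esub> A = symp_adj l A"
  by (rule group.inv_equality[OF group_SP]) (auto simp: SP_inverse symp_adj_SP)

text \<open>Intertwining relations compose without any inverse in sight, so conjugacy is handled in
  that form from here on.\<close>

lemma conj_action_eq_iff:
  assumes g: "g \<in> SP l" and x: "x \<in> carrier_mat (2*l) (2*l)" and y: "y \<in> carrier_mat (2*l) (2*l)"
  shows "y = conj_action l g x \<longleftrightarrow> g * x = y * g"
proof -
  let ?n = "2*l" and ?h = "symp_adj l g"
  have gc: "g \<in> carrier_mat ?n ?n" using g by (rule SP_carrier)
  then have hc: "?h \<in> carrier_mat ?n ?n" by simp
  have "(g * x * ?h) * g = g * x"
    using gc hc x SP_inverse[OF g] by (simp add: assoc_mult_mat[of _ ?n ?n _ ?n _ ?n])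
  moreover have "(y * g) * ?h = y"
    using gc hc y SP_inverse[OF g] by (simp add: assoc_mult_mat[of _ ?n ?n _ ?n _ ?n])
  ultimately show ?thesis unfolding conj_action_def inv_SP[OF g] by metis
qed

lemma N2_carrier: "x \<in> N2 l \<Longrightarrow> x \<in> carrier_mat (2*l) (2*l)"
  by (simp add: N2_def sp_def)

lemma sp_iff_index:
  assumes x: "x \<in> carrier_mat (2*l) (2*l)"
  shows "x \<in> sp l \<longleftrightarrow> (\<forall>a<2*l. \<forall>c<2*l. eps l a * x $$ (dual l a, c) = eps l c * x $$ (dual l c, a))"
proof -
  have "(transpose_mat x * F_mat l + F_mat l * x) $$ (a, c) =
      eps l a * x $$ (dual l a, c) - eps l c * x $$ (dual l c, a)" if "a < 2*l" "c < 2*l" for a c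
    using x that by (simp add: F_mult_index mult_F_index)
  then have "transpose_mat x * F_mat l + F_mat l * x = 0\<^sub>m (2*l) (2*l) \<longleftrightarrow>
      (\<forall>a<2*l. \<forall>c<2*l. eps l a * x $$ (dual l a, c) - eps l c * x $$ (dual l c, a) = 0)"
    using x by (auto simp: mat_eq_iff simp del: index_add_mat(1))
  then show ?thesis using x by (simp add: sp_def)
qed

lemma N2_iff_index:
  assumes x: "x \<in> carrier_mat (2*l) (2*l)"
  shows "x \<in> N2 l \<longleftrightarrow>
    (\<forall>a<2*l. \<forall>c<2*l. eps l a * x $$ (dual l a, c) = eps l c * x $$ (dual l c, a)) \<and>
    (\<forall>a<2*l. \<forall>c<2*l. (\<Sum>k<2*l. x $$ (a, k) * x $$ (k, c)) = 0)"
  using x unfolding N2_def sp_iff_index[OF x, symmetric]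
  by (auto simp: mat_eq_iff mult_mat_index)

text \<open>The relation gives \<open>y * y * g = g * (x * x)\<close>, and pulling the
  \<open>sp\<close> expression of \<open>y\<close> back along \<open>g\<close> gives that of
  \<open>x\<close> because \<open>g\<close> preserves \<open>F_mat l\<close>. Invertibility of
  \<open>g\<close> then removes it from both equations.\<close>

lemma N2_conj:
  assumes x: "x \<in> N2 l" and g: "g \<in> SP l" and y: "y \<in> carrier_mat (2*l) (2*l)" and gx: "g * x = y * g"
  shows "y \<in> N2 l"
proof -
  let ?n = "2*l" and ?F = "F_mat l" and ?h = "symp_adj l g"
  have gc: "g \<in> carrier_mat ?n ?n" "transpose_mat g * ?F * g = ?F" using g by (auto simp: SP_iff)
  have hc: "?h \<in> carrier_mat ?n ?n" using gc by simp
  have xc: "x \<in> carrier_mat ?n ?n" and xx: "x * x = 0\<^sub>m ?n ?n" 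
    and xs: "transpose_mat x * ?F + ?F * x = 0\<^sub>m ?n ?n"
    using x by (auto simp: N2_def sp_def)
  note as = assoc_mult_mat[of _ ?n ?n _ ?n _ ?n] and mc = mult_carrier_mat[of _ ?n ?n _ ?n]
  have T: "transpose_mat g \<in> carrier_mat ?n ?n" "transpose_mat x \<in> carrier_mat ?n ?n" "transpose_mat y \<in> carrier_mat ?n ?n"
    using gc xc y by auto
  have "y * y * g = g * (x * x)" using gc xc y gx by (metis as)
  then have "y * y * g = 0\<^sub>m ?n ?n" using xx gc by simp
  then have "(y * y * g) * ?h = 0\<^sub>m ?n ?n" using hc by simp
  then have yy: "y * y = 0\<^sub>m ?n ?n" using SP_inverse[OF g] gc hc y by (simp add: as mc)
  let ?Y = "transpose_mat y * ?F + ?F * y"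
  have Y: "?Y \<in> carrier_mat ?n ?n" using y by auto
  have "transpose_mat g * ?Y * g = transpose_mat g * (transpose_mat y * ?F) * g + transpose_mat g * (?F * y) * g"
    using T gc y by (simp add: mult_add_distrib_mat[of _ ?n ?n _ ?n] add_mult_distrib_mat[of _ ?n ?n _ _ ?n] mc)
  also have "transpose_mat g * (transpose_mat y * ?F) * g = transpose_mat (y * g) * ?F * g"
    using T gc y by (simp add: transpose_mult[OF y gc(1)] as mc)
  also have "\<dots> = transpose_mat x * ?F"
    using T gc y xc by (simp add: gx[symmetric] transpose_mult[OF gc(1) xc] as mc)
  also have "transpose_mat g * (?F * y) * g = transpose_mat g * ?F * (y * g)"
    using T gc y by (simp add: as mc)
  also have "\<dots> = (transpose_mat g * ?F * g) * x"
    using T gc(1) xc by (simp add: gx[symmetric] as mc)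
  also have "\<dots> = ?F * x" using gc by simp
  finally have "transpose_mat g * ?Y * g = 0\<^sub>m ?n ?n" using xs by simp
  then have "transpose_mat ?h * (transpose_mat g * ?Y * g) * ?h = 0\<^sub>m ?n ?n" using hc by simp
  moreover have "transpose_mat ?h * (transpose_mat g * ?Y * g) * ?h = transpose_mat (g * ?h) * ?Y * (g * ?h)"
    using T gc hc Y by (simp add: transpose_mult[OF gc(1) hc] as mc)
  ultimately have "?Y = 0\<^sub>m ?n ?n"
    using SP_inverse[OF g] Y right_mult_one_mat[OF Y] left_mult_one_mat[OF Y] by simp
  then show ?thesis using y yy by (auto simp: N2_def sp_def)
qed

text \<open>Matrix multiplication is total, so the equation alone would not pin down the number of
  columns of \<open>y\<close>.\<close>

definition conj_by :: "nat \<Rightarrow> complex mat set \<Rightarrow> complex mat \<Rightarrow> complex mat \<Rightarrow> bool" where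
  "conj_by l P x y \<longleftrightarrow> y \<in> carrier_mat (2*l) (2*l) \<and> (\<exists>g\<in>P. g * x = y * g)"

lemma orbit_eq:
  assumes P: "subgroup P (SP_group l)" and x: "x \<in> carrier_mat (2*l) (2*l)"
  shows "orbit ((SP_group l)\<lparr>carrier := P\<rparr>) (conj_action l) x = {y. conj_by l P x y}"
proof -
  have PS: "P \<subseteq> SP l" using subgroup.subset[OF P] by simp
  have c: "conj_action l g x \<in> carrier_mat (2*l) (2*l)" if "g \<in> P" for g
    using that PS SP_carrier[of g l] x unfolding conj_action_def
    by (subst inv_SP) (auto intro!: mult_carrier_mat)
  have "y = conj_action l g x \<longleftrightarrow> y \<in> carrier_mat (2*l) (2*l) \<and> g * x = y * g" if "g \<in> P" for g y
    using conj_action_eq_iff[of g l x y] c[OF that] x PS that by auto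
  then show ?thesis unfolding orbit_def conj_by_def by auto
qed

context
  fixes l :: nat and P :: "complex mat set"
  assumes P: "subgroup P (SP_group l)"
begin

lemma conj_by_refl: "x \<in> carrier_mat (2*l) (2*l) \<Longrightarrow> conj_by l P x x"
  using subgroup.one_closed[OF P] unfolding conj_by_def by (auto intro!: bexI[of _ "1\<^sub>m (2*l)"])

lemma conj_by_trans:
  assumes x: "x \<in> carrier_mat (2*l) (2*l)" and "conj_by l P x y" "conj_by l P y z"
  shows "conj_by l P x z"
proof -
  obtain g h where g: "g \<in> P" "g * x = y * g" and h: "h \<in> P" "h * y = z * h"
    and y: "y \<in> carrier_mat (2*l) (2*l)" and z: "z \<in> carrier_mat (2*l) (2*l)"
    using assms(2,3) by (auto simp: conj_by_def)
  have hg: "h * g \<in> P" using subgroup.m_closed[OF P h(1) g(1)] by simp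
  have "g \<in> SP l" "h \<in> SP l" using g(1) h(1) subgroup.subset[OF P] by auto
  then have "g \<in> carrier_mat (2*l) (2*l)" "h \<in> carrier_mat (2*l) (2*l)" using SP_carrier by auto
  then have "(h * g) * x = z * (h * g)" using g(2) h(2) x y z
    by (metis assoc_mult_mat)
  then show ?thesis using hg z by (auto simp: conj_by_def)
qed

lemma conj_by_sym:
  assumes x: "x \<in> carrier_mat (2*l) (2*l)" and "conj_by l P x y"
  shows "conj_by l P y x"
proof -
  obtain g where g: "g \<in> P" "g * x = y * g" and y: "y \<in> carrier_mat (2*l) (2*l)" 
    using assms(2) by (auto simp: conj_by_def)
  have gS: "g \<in> SP l" using g(1) subgroup.subset[OF P] by auto
  let ?h = "symp_adj l g" and ?n = "2*l"
  have h: "?h \<in> P" using subgroup.m_inv_closed[OF P g(1)] inv_SP[OF gS] by simp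
  have gc: "g \<in> carrier_mat ?n ?n" using gS by (rule SP_carrier)
  then have hc: "?h \<in> carrier_mat ?n ?n" by simp
  have "?h * y = ?h * y * (g * ?h)" using hc y SP_inverse[OF gS] by simp
  also have "\<dots> = ?h * (y * g) * ?h" using hc gc y by (simp add: assoc_mult_mat[of _ ?n ?n _ ?n _ ?n] mult_carrier_mat[of _ ?n ?n _ ?n])
  also have "\<dots> = (?h * g) * x * ?h" using hc gc x by (simp add: g(2)[symmetric] assoc_mult_mat[of _ ?n ?n _ ?n _ ?n] mult_carrier_mat[of _ ?n ?n _ ?n])
  also have "\<dots> = x * ?h" using hc gc x SP_inverse[OF gS] by simp
  finally show ?thesis using h x by (auto simp: conj_by_def)
qed

lemma orbit_cong:
  assumes "x \<in> carrier_mat (2*l) (2*l)" "conj_by l P x y"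
  shows "orbit ((SP_group l)\<lparr>carrier := P\<rparr>) (conj_action l) x =
    orbit ((SP_group l)\<lparr>carrier := P\<rparr>) (conj_action l) y"
proof -
  have y: "y \<in> carrier_mat (2*l) (2*l)" using assms(2) by (auto simp: conj_by_def)
  show ?thesis unfolding orbit_eq[OF P assms(1)] orbit_eq[OF P y]
    using conj_by_trans conj_by_sym assms y by blast
qed

end

section \<open>The symplectic form on coordinate functions\<close>

text \<open>Coordinate vectors are plain functions on \<open>nat\<close>, added pointwise, which
  keeps dimension conditions out of the calculations; \<open>form\<close> and \<open>mapply\<close>
  read only the coordinates below \<open>2*l\<close>.\<close>

definition scl :: "complex \<Rightarrow> (nat \<Rightarrow> complex) \<Rightarrow> nat \<Rightarrow> complex" where
  "scl z v = (\<lambda>r. z * v r)"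

definition ebas :: "nat \<Rightarrow> nat \<Rightarrow> complex" where
  "ebas a = (\<lambda>r. if r = a then 1 else 0)"

definition form :: "nat \<Rightarrow> (nat \<Rightarrow> complex) \<Rightarrow> (nat \<Rightarrow> complex) \<Rightarrow> complex" where
  "form l u w = (\<Sum>r<2*l. eps l r * u r * w (dual l r))"

text \<open>The value 0 outside the range allows equations such as
  \<open>mapply l x (ebas c) = scl z (ebas b)\<close> between total functions.\<close>

definition mapply :: "nat \<Rightarrow> complex mat \<Rightarrow> (nat \<Rightarrow> complex) \<Rightarrow> nat \<Rightarrow> complex" where
  "mapply l x v = (\<lambda>r. if r < 2*l then \<Sum>c<2*l. x $$ (r, c) * v c else 0)"

lemma scl_apply: "scl z v r = z * v r" by (simp add: scl_def)
lemma plus_apply: "(u + v) r = u r + v r" for u v :: "nat \<Rightarrow> complex" by (simp add: plus_fun_def)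

lemma form_bilinear [simp]:
  "form l (u + u') w = form l u w + form l u' w"
  "form l u (w + w') = form l u w + form l u w'"
  "form l (scl z u) w = z * form l u w"
  "form l u (scl z w) = z * form l u w"
  "form l 0 w = 0" "form l u 0 = 0"
  by (simp_all add: form_def scl_def plus_apply algebra_simps sum.distrib sum_distrib_left)

lemma form_alt: "form l u w = - form l w u"
proof -
  have "form l w u = (\<Sum>r<2*l. eps l (dual l r) * w (dual l r) * u (dual l (dual l r)))"
    unfolding form_def by (rule sum_dual[symmetric])
  also have "\<dots> = (\<Sum>r<2*l. - (eps l r * u r * w (dual l r)))"
    by (rule sum.cong) auto
  finally show ?thesis by (simp add: form_def sum_negf)
qed

lemma form_ebas_left: "a < 2*l \<Longrightarrow> form l (ebas a) w = eps l a * w (dual l a)"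
proof -
  assume a: "a < 2*l"
  have "form l (ebas a) w = (\<Sum>r<2*l. if r = a then eps l r * w (dual l r) else 0)"
    unfolding form_def by (rule sum.cong) (auto simp: ebas_def)
  then show ?thesis using a by simp
qed

lemma form_ebas [simp]:
  "a < 2*l \<Longrightarrow> c < 2*l \<Longrightarrow> form l (ebas a) (ebas c) = (if c = dual l a then eps l a else 0)"
  by (simp add: form_ebas_left) (auto simp: ebas_def)

lemma mapply_linear [simp]:
  "mapply l x (u + v) = mapply l x u + mapply l x v"
  "mapply l x (scl z u) = scl z (mapply l x u)"
  "mapply l x 0 = 0"
  by (auto simp: mapply_def scl_def plus_fun_def fun_eq_iff algebra_simps sum.distrib sum_distrib_left)

lemma scl_simps [simp]: "scl z 0 = 0" "scl 0 v = 0" "scl 1 v = v" "scl a (scl c v) = scl (a * c) v"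
  by (auto simp: scl_def fun_eq_iff)

lemma mapply_ebas: "c < 2*l \<Longrightarrow> mapply l x (ebas c) r = (if r < 2*l then x $$ (r, c) else 0)"
  by (auto simp: mapply_def ebas_def if_distrib[of "\<lambda>z. _ * z"] cong: if_cong)

lemma form_ebas_mapply:
  "a < 2*l \<Longrightarrow> c < 2*l \<Longrightarrow> form l (ebas a) (mapply l x (ebas c)) = eps l a * x $$ (dual l a, c)"
  by (simp add: form_ebas_left mapply_ebas)

lemma index_form:
  "r < 2*l \<Longrightarrow> c < 2*l \<Longrightarrow> x $$ (r, c) = - eps l r * form l (ebas (dual l r)) (mapply l x (ebas c))"
  by (simp add: form_ebas_mapply)

context
  fixes l :: nat and x :: "complex mat"
  assumes x: "x \<in> N2 l"
begin

lemma mapply_twice [simp]: "mapply l x (mapply l x v) = 0"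
proof
  fix r
  have 0: "\<forall>a<2*l. \<forall>c<2*l. (\<Sum>k<2*l. x $$ (a, k) * x $$ (k, c)) = 0"
    using x N2_iff_index[OF N2_carrier[OF x]] by auto
  have "(\<Sum>k<2*l. x $$ (r, k) * (\<Sum>c<2*l. x $$ (k, c) * v c)) =
      (\<Sum>c<2*l. (\<Sum>k<2*l. x $$ (r, k) * x $$ (k, c)) * v c)"
    by (simp add: sum_distrib_left sum_distrib_right algebra_simps) (rule sum.swap)
  then show "mapply l x (mapply l x v) r = 0 r" using 0 by (auto simp: mapply_def)
qed

lemma form_mapply_left [simp]: "form l (mapply l x u) w = - form l u (mapply l x w)"
proof -
  have s: "eps l a * x $$ (dual l a, c) = eps l c * x $$ (dual l c, a)" if "a < 2*l" "c < 2*l" for a c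
    using x N2_iff_index[OF N2_carrier[OF x]] that by auto
  have "form l (mapply l x u) w = - form l w (mapply l x u)" by (rule form_alt)
  also have "form l w (mapply l x u) = (\<Sum>a<2*l. \<Sum>c<2*l. w a * u c * (eps l a * x $$ (dual l a, c)))"
    by (auto simp: form_def mapply_def sum_distrib_left mult.assoc mult.left_commute intro!: sum.cong)
  also have "\<dots> = (\<Sum>a<2*l. \<Sum>c<2*l. w a * u c * (eps l c * x $$ (dual l c, a)))"
    by (intro sum.cong refl) (simp add: s)
  also have "\<dots> = (\<Sum>c<2*l. \<Sum>a<2*l. w a * u c * (eps l c * x $$ (dual l c, a)))"
    by (rule sum.swap)
  also have "\<dots> = form l u (mapply l x w)"
    by (auto simp: form_def mapply_def sum_distrib_left mult.assoc mult.left_commute intro!: sum.cong)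
  finally show ?thesis .
qed

lemma form_mapply_sym: "form l u (mapply l x w) = form l w (mapply l x u)"
  using form_alt[of l "mapply l x u" w] by simp

text \<open>The matrix \<open>x'\<close> is \<open>g\<^sup>-\<^sup>1 x g\<close>, computed with \<open>g\<^sup>-\<^sup>1 = - F g\<^sup>T F\<close>.\<close>

lemma basis_change:
  fixes v :: "nat \<Rightarrow> nat \<Rightarrow> complex"
  defines "g \<equiv> mat (2*l) (2*l) (\<lambda>(r, a). v a r)"
  defines "x' \<equiv> mat (2*l) (2*l) (\<lambda>(r, c). - eps l r * form l (v (dual l r)) (mapply l x (v c)))"
  assumes v: "\<And>a c. a < 2*l \<Longrightarrow> c < 2*l \<Longrightarrow> form l (v a) (v c) = (if c = dual l a then eps l a else 0)"
  shows "g \<in> SP l" "x' \<in> N2 l" "g * x' = x * g"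
proof -
  let ?n = "2*l"
  have xc: "x \<in> carrier_mat ?n ?n" using x by (rule N2_carrier)
  have g: "g \<in> carrier_mat ?n ?n" and gT: "transpose_mat g \<in> carrier_mat ?n ?n" by (auto simp: g_def)
  have gi: "g $$ (r, a) = v a r" if "r < ?n" "a < ?n" for r a using that by (simp add: g_def)
  have x': "x' \<in> carrier_mat ?n ?n" by (simp add: x'_def)
  have Fg: "F_mat l * g \<in> carrier_mat ?n ?n" using g by (auto intro: mult_carrier_mat)
  have "transpose_mat g * F_mat l * g = transpose_mat g * (F_mat l * g)"
    using g gT by (simp add: assoc_mult_mat[of _ ?n ?n _ ?n _ ?n])
  also have "\<dots> = F_mat l"
  proof (rule eq_matI)
    fix a c assume "a < dim_row (F_mat l)" "c < dim_col (F_mat l)"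
    then have ac: "a < ?n" "c < ?n" by auto
    have "(transpose_mat g * (F_mat l * g)) $$ (a, c) = form l (v a) (v c)"
      unfolding mult_mat_index[OF gT Fg ac] form_def
      using ac by (intro sum.cong refl, subst F_mult_index[OF g]) (auto simp: g_def)
    then show "(transpose_mat g * (F_mat l * g)) $$ (a, c) = F_mat l $$ (a, c)"
      using v[OF ac] F_mat_index[OF ac] by simp
  qed (use g in auto)
  finally show gS: "g \<in> SP l" using g by (simp add: SP_iff)
  let ?h = "symp_adj l g"
  have hc: "?h \<in> carrier_mat ?n ?n" using g by simp
  have xg: "x * g \<in> carrier_mat ?n ?n" using xc g by (rule mult_carrier_mat)
  have xgi: "(x * g) $$ (r, c) = mapply l x (v c) r" if "r < ?n" "c < ?n" for r c
    using that unfolding mult_mat_index[OF xc g that] mapply_def by (auto simp: g_def)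
  have "x' = ?h * (x * g)"
  proof (rule eq_matI)
    fix r c assume "r < dim_row (?h * (x * g))" "c < dim_col (?h * (x * g))"
    then have rc: "r < ?n" "c < ?n" using hc xg by auto
    have "(?h * (x * g)) $$ (r, c) = (\<Sum>k<?n. eps l r * eps l k * v (dual l r) (dual l k) * mapply l x (v c) k)"
      unfolding mult_mat_index[OF hc xg rc]
      using rc by (intro sum.cong refl, subst symp_adj_index[OF g]) (auto simp: gi xgi)
    also have "\<dots> = (\<Sum>k<?n. eps l r * eps l (dual l k) * v (dual l r) (dual l (dual l k)) * mapply l x (v c) (dual l k))"
      by (rule sum_dual[symmetric])
    also have "\<dots> = (\<Sum>k<?n. - eps l r * (eps l k * v (dual l r) k * mapply l x (v c) (dual l k)))"
      by (intro sum.cong refl) auto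
    finally show "x' $$ (r, c) = (?h * (x * g)) $$ (r, c)"
      using rc by (simp add: x'_def form_def sum_distrib_left)
  qed (use hc xg x' in auto)
  then have "g * x' = (g * ?h) * (x * g)" using g hc xg by (simp add: assoc_mult_mat[of _ ?n ?n _ ?n _ ?n])
  then show gx: "g * x' = x * g" using SP_inverse[OF gS] left_mult_one_mat[OF xg] by simp
  have "?h * x = ?h * x * (g * ?h)" using hc xc SP_inverse[OF gS] by simp
  also have "\<dots> = ?h * (x * g) * ?h" using hc g xc by (simp add: assoc_mult_mat[of _ ?n ?n _ ?n _ ?n] mult_carrier_mat[of _ ?n ?n _ ?n])
  also have "\<dots> = (?h * g) * x' * ?h" using hc g x' by (simp add: gx[symmetric] assoc_mult_mat[of _ ?n ?n _ ?n _ ?n] mult_carrier_mat[of _ ?n ?n _ ?n])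
  also have "\<dots> = x' * ?h" using x' hc SP_inverse[OF gS] by simp
  finally show "x' \<in> N2 l" using N2_conj[OF x symp_adj_SP[OF gS] x'] by blast
qed

text \<open>Pairing with the dual basis vector reads off a coefficient, so a basis vector that goes
  to a multiple of another one gives a column with at most one nonzero entry.\<close>

lemma basis_change_column:
  fixes v :: "nat \<Rightarrow> nat \<Rightarrow> complex"
  defines "x' \<equiv> mat (2*l) (2*l) (\<lambda>(r, c). - eps l r * form l (v (dual l r)) (mapply l x (v c)))"
  assumes v: "\<And>a c. a < 2*l \<Longrightarrow> c < 2*l \<Longrightarrow> form l (v a) (v c) = (if c = dual l a then eps l a else 0)"
    and c: "c < 2*l" "b < 2*l" and xv: "mapply l x (v c) = scl z (v b)" and r: "r < 2*l"
  shows "x' $$ (r, c) = (if r = b then z else 0)"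
  using c r v[of "dual l r" b] by (auto simp: x'_def xv)

end

section \<open>Splitting off one or two basis vectors and their images\<close>

definition basis_mat :: "nat \<Rightarrow> (nat \<Rightarrow> nat \<Rightarrow> complex) \<Rightarrow> complex mat" where
  "basis_mat l v = mat (2*l) (2*l) (\<lambda>(r, a). v a r)"

definition symplectic_basis :: "nat \<Rightarrow> (nat \<Rightarrow> nat \<Rightarrow> complex) \<Rightarrow> bool" where
  "symplectic_basis l v \<longleftrightarrow>
    (\<forall>a<2*l. \<forall>c<2*l. form l (v a) (v c) = (if c = dual l a then eps l a else 0))"

text \<open>\<open>D\<close> stands for the part already split off: closure under duality makes its
  span nondegenerate, and the second condition makes the span \<open>x\<close>-stable. The scalar
  may be 0.\<close>

definition reduced_on :: "nat \<Rightarrow> nat set \<Rightarrow> complex mat \<Rightarrow> bool" where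
  "reduced_on l D x \<longleftrightarrow> (\<forall>c\<in>D. c < 2*l \<and> dual l c \<in> D \<and> (\<exists>z. \<exists>b\<in>D. mapply l x (ebas c) = scl z (ebas b)))"

lemma basis_mat_Borel:
  assumes "basis_mat l v \<in> SP l" and tri: "\<And>a r. a < r \<Longrightarrow> r < 2*l \<Longrightarrow> v a r = 0"
  shows "basis_mat l v \<in> Borel l"
  using assms by (auto simp: Borel_def upper_triangular_def basis_mat_def)

lemma symplectic_basisI:
  assumes "\<And>a c. a < 2*l \<Longrightarrow> c < 2*l \<Longrightarrow> form l (v a) (v c) = (if c = dual l a then eps l a else 0)"
  shows "symplectic_basis l v"
  using assms by (simp add: symplectic_basis_def)

text \<open>Columns in \<open>D\<close> survive because \<open>v\<close> fixes both the basis
  vectors in \<open>D\<close> and the basis vectors that their images are multiples of.\<close>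

lemma symplectic_change:
  assumes x: "x \<in> N2 l" and v: "symplectic_basis l v"
    and D: "reduced_on l D x" "\<And>c. c \<in> D \<Longrightarrow> v c = ebas c"
  obtains x' where "basis_mat l v \<in> SP l" "x' \<in> N2 l" "basis_mat l v * x' = x * basis_mat l v"
    "\<And>c r z b. c < 2*l \<Longrightarrow> b < 2*l \<Longrightarrow> r < 2*l \<Longrightarrow> mapply l x (v c) = scl z (v b) \<Longrightarrow>
       x' $$ (r, c) = (if r = b then z else 0)"
    "\<And>c r. c \<in> D \<Longrightarrow> r < 2*l \<Longrightarrow> x' $$ (r, c) = x $$ (r, c)"
proof -
  let ?x' = "mat (2*l) (2*l) (\<lambda>(r, c). - eps l r * form l (v (dual l r)) (mapply l x (v c)))"
  have v': "form l (v a) (v c) = (if c = dual l a then eps l a else 0)" if "a < 2*l" "c < 2*l" for a c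
    using v that by (simp add: symplectic_basis_def)
  have col: "?x' $$ (r, c) = (if r = b then z else 0)"
    if "c < 2*l" "b < 2*l" "r < 2*l" "mapply l x (v c) = scl z (v b)" for c r z b
    by (rule basis_change_column[OF x v' that(1,2,4,3)])
  have "?x' $$ (r, c) = x $$ (r, c)" if c: "c \<in> D" and r: "r < 2*l" for c r
  proof -
    obtain z b where b: "b \<in> D" "mapply l x (ebas c) = scl z (ebas b)" and c2: "c < 2*l"
      using D(1) c unfolding reduced_on_def by blast
    have b2: "b < 2*l" using D(1) b unfolding reduced_on_def by blast
    have "?x' $$ (r, c) = (if r = b then z else 0)"
      using col[OF c2 b2 r, of z] b(2) D(2)[OF c] D(2)[OF b(1)] by simp
    also have "\<dots> = mapply l x (ebas c) r" unfolding b(2) by (simp add: scl_def ebas_def)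
    finally show ?thesis using r c2 by (simp add: mapply_ebas)
  qed
  moreover have "basis_mat l v \<in> SP l" "?x' \<in> N2 l" "basis_mat l v * ?x' = x * basis_mat l v"
    unfolding basis_mat_def by (rule basis_change[OF x v']; assumption)+
  ultimately show thesis using that[of ?x'] col by blast
qed

text \<open>Move \<open>x\<close> to the left argument: the image of \<open>ebas c\<close> is a
  multiple of some \<open>ebas b\<close> with \<open>b\<close> in \<open>D\<close>, and the only
  basis vector not orthogonal to that one has its index in \<open>D\<close>. Hence projections that
  split off new vectors do not disturb \<open>D\<close>.\<close>

lemma form_mapply_reduced:
  assumes x: "x \<in> N2 l" and D: "reduced_on l D x" and c: "c \<in> D" and a: "a \<notin> D" "a < 2*l"
  shows "form l (ebas c) (mapply l x (ebas a)) = 0"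
proof -
  obtain z b where b: "b \<in> D" "mapply l x (ebas c) = scl z (ebas b)" 
    using D c unfolding reduced_on_def by blast
  have b': "b < 2*l" "dual l b \<in> D" using D b unfolding reduced_on_def by blast+
  then have ne: "a \<noteq> dual l b" using a by auto
  have "form l (ebas c) (mapply l x (ebas a)) = - form l (mapply l x (ebas c)) (ebas a)" 
    using x by simp
  also have "\<dots> = 0" unfolding b(2) using b' a ne by simp
  finally show ?thesis .
qed

text \<open>In the next two lemmas the new basis arises by projecting the remaining basis vectors to the
  orthogonal complement of the plane, or four-dimensional space, that is split off.
  The vanishing of the pairings before \<open>j\<close> and \<open>p\<close> makes the base change upper triangular.\<close>

lemma loop_step:
  assumes x: "x \<in> N2 l" and j: "j < 2*l" and D: "reduced_on l D x" "j \<notin> D"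
    and nz: "form l (ebas j) (mapply l x (ebas j)) \<noteq> 0"
    and low: "\<And>b. b < j \<Longrightarrow> form l (ebas b) (mapply l x (ebas j)) = 0"
  obtains g x' where "g \<in> Borel l" "x' \<in> N2 l" "g * x' = x * g"
    "\<And>r. r < 2*l \<Longrightarrow> x' $$ (r, j) = (if r = dual l j then 1 else 0)"
    "\<And>r. r < 2*l \<Longrightarrow> x' $$ (r, dual l j) = 0"
    "\<And>c r. c \<in> D \<Longrightarrow> r < 2*l \<Longrightarrow> x' $$ (r, c) = x $$ (r, c)"
proof -
  let ?X = "mapply l x" and ?e = "ebas"
  define \<beta> where "\<beta> a c = form l (?e a) (?X (?e c))" for a c
  have \<beta>sym: "\<beta> a c = \<beta> c a" for a c unfolding \<beta>_def by (rule form_mapply_sym[OF x])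
  \<comment> \<open>The root rescales \<open>ebas j\<close> so that its pairing with its own image
    becomes \<open>eps l j\<close>.\<close>
  define lam where "lam = csqrt (eps l j / \<beta> j j)"
  have nz': "\<beta> j j \<noteq> 0" using nz by (simp add: \<beta>_def)
  have lam: "lam * (lam * \<beta> j j) = eps l j"
    using nz' power2_csqrt[of "eps l j / \<beta> j j"] unfolding lam_def power2_eq_square by (simp add: field_simps)
  then have lam0: "lam \<noteq> 0" by auto
  \<comment> \<open>For a remaining index \<open>c\<close> the vector \<open>ebas c\<close> is
    already orthogonal to \<open>ebas j\<close>. A multiple of \<open>ebas j\<close> suffices to
    make it orthogonal to the image of \<open>ebas j\<close> as well.\<close>
  define v where "v c = (if c = j then scl lam (?e j) else if c = dual l j then scl lam (?X (?e j))
    else ?e c + scl (- \<beta> c j / \<beta> j j) (?e j))" for c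
  have vj: "v j = scl lam (?e j)" "v (dual l j) = scl lam (?X (?e j))" using j by (auto simp: v_def)
  have vo: "v c = ?e c + scl (- \<beta> c j / \<beta> j j) (?e j)" if "c \<noteq> j" "c \<noteq> dual l j" for c
    using that by (auto simp: v_def)
  note simps = form_mapply_left[OF x] mapply_twice[OF x] \<beta>_def[symmetric]
  have basis: "symplectic_basis l v"
  proof (rule symplectic_basisI)
    note [[linarith_neq_limit = 0]]
    fix a c assume ac: "a < 2*l" "c < 2*l"
    consider "a = j" | "a = dual l j" | "a \<noteq> j" "a \<noteq> dual l j" by blast
    then show "form l (v a) (v c) = (if c = dual l a then eps l a else 0)"
    proof cases
      case 1
      consider "c = j" | "c = dual l j" | "c \<noteq> j" "c \<noteq> dual l j" by blast
      then show ?thesis by cases (use 1 j ac lam in \<open>auto simp: vj vo simps\<close>)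
    next
      case 2
      consider "c = j" | "c = dual l j" | "c \<noteq> j" "c \<noteq> dual l j" by blast
      then show ?thesis
      proof cases
        case 3
        then show ?thesis using 2 j ac nz' \<beta>sym[of j c] by (auto simp: vj vo simps field_simps)
      qed (use 2 j ac lam in \<open>auto simp: vj vo simps\<close>)
    next
      case 3
      then have a': "j \<noteq> dual l a" using j ac by auto
      consider "c = j" | "c = dual l j" | "c \<noteq> j" "c \<noteq> dual l j" by blast
      then show ?thesis
        by cases (use 3 a' j ac nz' in \<open>auto simp: vj vo simps field_simps\<close>)
    qed
  qed
  have vD: "v c = ?e c" if "c \<in> D" for c
  proof -
    have "c < 2*l" "c \<noteq> j" "c \<noteq> dual l j" using that D j unfolding reduced_on_def by auto
    moreover have "\<beta> c j = 0" unfolding \<beta>_def by (rule form_mapply_reduced[OF x D(1) that D(2) j])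
    ultimately show ?thesis by (auto simp: vo)
  qed
  obtain x' where x': "basis_mat l v \<in> SP l" "x' \<in> N2 l" "basis_mat l v * x' = x * basis_mat l v"
    "\<And>c r z b. c < 2*l \<Longrightarrow> b < 2*l \<Longrightarrow> r < 2*l \<Longrightarrow> mapply l x (v c) = scl z (v b) \<Longrightarrow>
       x' $$ (r, c) = (if r = b then z else 0)"
    "\<And>c r. c \<in> D \<Longrightarrow> r < 2*l \<Longrightarrow> x' $$ (r, c) = x $$ (r, c)"
    by (rule symplectic_change[OF x basis D(1) vD], assumption, rule that; assumption)
  have tri: "v a r = 0" if ar: "a < r" "r < 2*l" for a r
  proof -
    consider "a = j" | "a = dual l j" | "a \<noteq> j" "a \<noteq> dual l j" by blast
    then show ?thesis
    proof cases
      case 2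
      \<comment> \<open>Coordinate \<open>r\<close> of the image of \<open>ebas j\<close> is, up to
        sign, its pairing with \<open>ebas (dual l r)\<close>.\<close>
      then have "dual l r < j" using ar j by (auto simp: dual_def)
      from low[OF this] have "x $$ (r, j) = 0" using index_form[of r l j x] ar j by simp
      then show ?thesis using 2 ar j by (simp add: vj scl_apply mapply_ebas)
    next
      case 3
      have "\<beta> a j = 0" if "a < j" unfolding \<beta>_def using low[OF that] by simp
      then show ?thesis using 3 ar by (auto simp: vo plus_apply scl_def ebas_def)
    qed (use ar in \<open>auto simp: vj scl_def ebas_def\<close>)
  qed
  have 1: "mapply l x (v j) = scl 1 (v (dual l j))" by (simp add: vj)
  have 0: "mapply l x (v (dual l j)) = scl 0 (v j)" by (simp add: vj mapply_twice[OF x])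
  show thesis
    by (rule that[OF basis_mat_Borel[OF x'(1) tri] x'(2,3)])
      (use x'(4)[OF j _ _ 1] x'(4)[OF _ j _ 0] x'(5) j in auto)
qed

lemma edge_step:
  assumes x: "x \<in> N2 l" and j: "j < p" and p: "p < 2*l" "p \<noteq> dual l j"
    and D: "reduced_on l D x" "j \<notin> D" "p \<notin> D"
    and nz: "form l (ebas j) (mapply l x (ebas p)) \<noteq> 0"
    and low: "\<And>b. b < p \<Longrightarrow> form l (ebas b) (mapply l x (ebas j)) = 0"
      "\<And>b. b < j \<Longrightarrow> form l (ebas b) (mapply l x (ebas p)) = 0"
  obtains g x' where "g \<in> Borel l" "x' \<in> N2 l" "g * x' = x * g"
    "\<And>r. r < 2*l \<Longrightarrow> x' $$ (r, j) = (if r = dual l p then 1 else 0)"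
    "\<And>r. r < 2*l \<Longrightarrow> x' $$ (r, p) = (if r = dual l j then eps l p * eps l j else 0)"
    "\<And>r. r < 2*l \<Longrightarrow> x' $$ (r, dual l p) = 0"
    "\<And>r. r < 2*l \<Longrightarrow> x' $$ (r, dual l j) = 0"
    "\<And>c r. c \<in> D \<Longrightarrow> r < 2*l \<Longrightarrow> x' $$ (r, c) = x $$ (r, c)"
proof -
  note [[linarith_neq_limit = 0]]
  let ?X = "mapply l x" and ?e = "ebas"
  have j2: "j < 2*l" using j p by simp
  have ne: "j \<noteq> p" "p \<noteq> j" "j \<noteq> dual l p" "dual l p \<noteq> j" "dual l j \<noteq> p" "dual l j \<noteq> dual l p" "dual l p \<noteq> dual l j"
    using j p j2 by auto
  define \<beta> where "\<beta> a c = form l (?e a) (?X (?e c))" for a c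
  have \<beta>sym: "\<beta> a c = \<beta> c a" for a c unfolding \<beta>_def by (rule form_mapply_sym[OF x])
  define \<gamma> where "\<gamma> = \<beta> j p"
  have \<gamma>: "\<gamma> \<noteq> 0" using nz by (simp add: \<beta>_def \<gamma>_def)
  have bpj: "\<beta> p j = \<gamma>" "\<beta> j p = \<gamma>" using \<beta>sym[of p j] by (auto simp: \<gamma>_def)
  have bjj: "\<beta> j j = 0" using low(1)[OF j] by (simp add: \<beta>_def)
  \<comment> \<open>As beta vanishes at \<open>ebas j\<close>, subtracting \<kappa> times
    \<open>ebas j\<close> from \<open>ebas p\<close> changes the value of beta there by
    \<open>2 * \<kappa> * \<gamma>\<close>, so this choice makes \<open>w\<close> isotropic for
    beta.\<close>
  define \<kappa> where "\<kappa> = \<beta> p p / (2*\<gamma>)"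
  \<comment> \<open>Normalizes the pairing of the new vector at \<open>p\<close> with the image of
    \<open>ebas j\<close>, the new vector at \<open>dual l p\<close>, to
    \<open>eps l p\<close>.\<close>
  define \<mu> where "\<mu> = eps l p / \<gamma>"
  have \<mu>: "\<mu> * \<gamma> = eps l p" using \<gamma> by (simp add: \<mu>_def)
  have \<kappa>: "\<kappa> * \<gamma> = \<beta> p p / 2" using \<gamma> by (simp add: \<kappa>_def)
  define w where "w = ?e p + scl (-\<kappa>) (?e j)"
  \<comment> \<open>The vectors \<open>ebas j\<close> and \<open>w\<close> form a hyperbolic pair
    for beta, so the coefficient of each is determined by the pairing with the image of the
    other.\<close>
  define A where "A c = - (\<beta> c p - \<kappa> * \<beta> c j) / \<gamma>" for c
  define R where "R c = - \<beta> c j / \<gamma>" for c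
  have AR: "A c * \<gamma> = - (\<beta> c p - \<kappa> * \<beta> c j)" "R c * \<gamma> = - \<beta> c j" for c
    using \<gamma> by (auto simp: A_def R_def)
  define v where "v c = (if c = j then ?e j else if c = p then scl \<mu> w
    else if c = dual l p then ?X (?e j) else if c = dual l j then scl (eps l p * eps l j * \<mu>) (?X w)
    else ?e c + (scl (A c) (?e j) + scl (R c) w))" for c
  have vj: "v j = ?e j" "v p = scl \<mu> w" "v (dual l p) = ?X (?e j)"
      "v (dual l j) = scl (eps l p * eps l j * \<mu>) (?X w)" using j2 p ne by (auto simp: v_def)
  have vo: "v c = ?e c + (scl (A c) (?e j) + scl (R c) w)"
    if "c \<noteq> j" "c \<noteq> p" "c \<noteq> dual l p" "c \<noteq> dual l j" for c
    using that by (auto simp: v_def)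
  note simps = form_mapply_left[OF x] mapply_twice[OF x] \<beta>_def[symmetric] bpj bjj
  have fjw: "form l (?e j) w = 0" "form l w (?e j) = 0" "form l w w = 0"
    using j2 p ne by (auto simp: w_def)
  have fjXj: "form l (?e j) (?X (?e j)) = 0" by (simp add: simps)
  have fjXw: "form l (?e j) (?X w) = \<gamma>" "form l w (?X (?e j)) = \<gamma>" "form l w (?X w) = 0"
    using \<kappa> by (auto simp: w_def simps algebra_simps)
  have fc: "form l (?e c) (?e j) = 0" "form l (?e j) (?e c) = 0" "form l (?e c) w = 0" "form l w (?e c) = 0"
      "form l (?e c) (?X (?e j)) = \<beta> c j" "form l (?e c) (?X w) = \<beta> c p - \<kappa> * \<beta> c j"
    if "c \<noteq> j" "c \<noteq> p" "c \<noteq> dual l p" "c \<noteq> dual l j" "c < 2*l" for c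
    using that j2 p ne dual_eq_iff[of c l j] dual_eq_iff[of c l p] by (auto simp: w_def simps)
  have fcX: "form l (?e j) (?X (?e c)) = \<beta> c j" "form l w (?X (?e c)) = \<beta> c p - \<kappa> * \<beta> c j"
    if "c \<noteq> j" "c \<noteq> p" "c \<noteq> dual l p" "c \<noteq> dual l j" "c < 2*l" for c
    using fc(5,6)[OF that] form_mapply_sym[OF x, of "?e j" "?e c"] form_mapply_sym[OF x, of w "?e c"] by auto
  note ff = fjw fjXj fjXw fc fcX form_mapply_left[OF x] mapply_twice[OF x]
  have split: "c = j \<or> c = p \<or> c = dual l p \<or> c = dual l j \<or>
    (c \<noteq> j \<and> c \<noteq> p \<and> c \<noteq> dual l p \<and> c \<noteq> dual l j)" for c by blast
  have basis: "symplectic_basis l v"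
  proof (rule symplectic_basisI)
    note [[linarith_neq_limit = 0]]
    fix a c assume ac: "a < 2*l" "c < 2*l"
    have M: "eps l p * eps l j * \<mu> * \<gamma> = eps l j" "eps l p * (eps l j * \<mu>) * \<gamma> = eps l j"
      using \<mu> by (simp_all add: mult.assoc mult.left_commute[of "eps l p" "eps l j"])
    have M': "eps l p * (\<mu> * (\<kappa> * \<beta> c j - \<beta> c p)) = A c" for c
      by (simp add: A_def \<mu>_def)
    note s = vj ff AR \<mu> M M'
    show "form l (v a) (v c) = (if c = dual l a then eps l a else 0)"
      using split[of a]
    proof (elim disjE)
      assume a: "a = j"
      show ?thesis using split[of c] 
        by (elim disjE) (use a ac j2 p ne in \<open>simp_all add: s vo\<close>)
    next
      assume a: "a = p"
      show ?thesis using split[of c] 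
        by (elim disjE) (use a ac j2 p ne in \<open>simp_all add: s vo\<close>)
    next
      assume a: "a = dual l p"
      show ?thesis using split[of c] 
        by (elim disjE) (use a ac j2 p ne in \<open>simp_all add: s vo\<close>)
    next
      assume a: "a = dual l j"
      show ?thesis using split[of c] 
        by (elim disjE) (use a ac j2 p ne in \<open>simp_all add: s vo\<close>)
    next
      assume a: "a \<noteq> j \<and> a \<noteq> p \<and> a \<noteq> dual l p \<and> a \<noteq> dual l j"
      then have a': "a \<noteq> j" "a \<noteq> p" "a \<noteq> dual l p" "a \<noteq> dual l j" "j \<noteq> a" "p \<noteq> a"
        "dual l a \<noteq> j" "dual l a \<noteq> p" "dual l p \<noteq> dual l a" "dual l j \<noteq> dual l a"
        "j \<noteq> dual l a" "p \<noteq> dual l a"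
        using ac j2 p dual_eq_iff[of a l j] dual_eq_iff[of a l p] by auto
      note va = vo[OF a'(1-4)] and fa = fc[OF a'(1-4) ac(1)] fcX[OF a'(1-4) ac(1)]
      show ?thesis
      proof (cases "c = j \<or> c = p \<or> c = dual l p \<or> c = dual l j")
        case True
        then show ?thesis
          by (elim disjE) (simp_all add: va vj fa fjw fjXj fjXw AR a' j2)
      next
        case False
        then have c: "c \<noteq> j" "c \<noteq> p" "c \<noteq> dual l p" "c \<noteq> dual l j" by auto
        show ?thesis unfolding va vo[OF c]
          by (simp add: fa fc[OF c ac(2)] fjw ac j2)
      qed
    qed
  qed
  have vD: "v c = ?e c" if "c \<in> D" for c
  proof -
    have "c < 2*l" "dual l c \<in> D" using that D(1) unfolding reduced_on_def by auto
    then have "c \<noteq> j" "c \<noteq> p" "c \<noteq> dual l j" "c \<noteq> dual l p" using that D j2 p by auto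
    moreover have "\<beta> c j = 0" "\<beta> c p = 0"
      unfolding \<beta>_def by (auto intro!: form_mapply_reduced[OF x D(1) that] D(2,3) j2 p)
    ultimately show ?thesis by (auto simp: vo A_def R_def)
  qed
  obtain x' where x': "basis_mat l v \<in> SP l" "x' \<in> N2 l" "basis_mat l v * x' = x * basis_mat l v"
    "\<And>c r z b. c < 2*l \<Longrightarrow> b < 2*l \<Longrightarrow> r < 2*l \<Longrightarrow> mapply l x (v c) = scl z (v b) \<Longrightarrow>
       x' $$ (r, c) = (if r = b then z else 0)"
    "\<And>c r. c \<in> D \<Longrightarrow> r < 2*l \<Longrightarrow> x' $$ (r, c) = x $$ (r, c)"
    by (rule symplectic_change[OF x basis D(1) vD], assumption, rule that; assumption)
  have w0: "w r = 0" if "p < r" for r using that j by (auto simp: w_def plus_apply scl_def ebas_def)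
  have tri: "v a r = 0" if ar: "a < r" "r < 2*l" for a r
    using split[of a]
  proof (elim disjE)
    assume a: "a = dual l p"
    then have "dual l r < p" using ar p by (auto simp: dual_def)
    from low(1)[OF this] have "x $$ (r, j) = 0" using index_form[of r l j x] ar j2 by simp
    then show ?thesis using a ar j2 by (simp add: vj mapply_ebas)
  next
    assume a: "a = dual l j"
    then have "dual l r < j" using ar j2 by (auto simp: dual_def)
    from low(2)[OF this] low(1)[of "dual l r"] this j
    have "x $$ (r, j) = 0" "x $$ (r, p) = 0" using index_form[of r l _ x] ar j2 p by simp_all
    then show ?thesis using a ar j2 p by (simp add: vj mapply_ebas scl_apply w_def plus_apply)
  next
    assume a: "a \<noteq> j \<and> a \<noteq> p \<and> a \<noteq> dual l p \<and> a \<noteq> dual l j"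
    \<comment> \<open>\<open>w\<close> reaches up to coordinate \<open>p\<close> and
      \<open>ebas j\<close> up to coordinate \<open>j\<close>. Below these indices their
      coefficients have to vanish.\<close>
    have "R a = 0" if "a < p" unfolding R_def \<beta>_def using low(1)[OF that] by simp
    moreover have "A a = 0" if "a < j" unfolding A_def \<beta>_def using low(2)[OF that] low(1)[of a] that j by simp
    ultimately show ?thesis using a ar w0[of r] j
      by (cases "a < j"; cases "a < p") (auto simp: vo plus_apply scl_def ebas_def)
  qed (use ar j w0 in \<open>auto simp: vj scl_def ebas_def\<close>)
  have 1: "mapply l x (v j) = scl 1 (v (dual l p))" by (simp add: vj)
  have 2: "mapply l x (v p) = scl (eps l p * eps l j) (v (dual l j))"
    by (simp add: vj mult.assoc mult.left_commute)
  have 3: "mapply l x (v (dual l p)) = scl 0 (v j)" by (simp add: vj mapply_twice[OF x])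
  have 4: "mapply l x (v (dual l j)) = scl 0 (v j)" by (simp add: vj mapply_twice[OF x])
  show thesis
    by (rule that[OF basis_mat_Borel[OF x'(1) tri] x'(2,3)])
      (use x'(4)[OF _ _ _ 1] x'(4)[OF _ _ _ 2] x'(4)[OF _ _ _ 3] x'(4)[OF _ _ _ 4] x'(5) j2 p in auto)
qed

text \<open>Over the complex numbers a hyperbolic plane has an orthonormal basis
  \<open>(e\<^sub>j + e\<^sub>p) / sqrt 2\<close>, \<open>i (e\<^sub>j - e\<^sub>p) / sqrt 2\<close>.\<close>

lemma pair_step:
  assumes x: "x \<in> N2 l" and j: "j < 2*l" and p: "p < 2*l" "p \<noteq> dual l j" "p \<noteq> j" and same: "eps l p = eps l j"
    and D: "reduced_on l D x" "j \<notin> D" "p \<notin> D"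
    and cols: "\<And>r. r < 2*l \<Longrightarrow> x $$ (r, j) = (if r = dual l p then 1 else 0)"
    "\<And>r. r < 2*l \<Longrightarrow> x $$ (r, p) = (if r = dual l j then 1 else 0)"
  obtains g x' where "g \<in> SP l" "x' \<in> N2 l" "g * x' = x * g"
    "\<And>r c. r < 2*l \<Longrightarrow> c < 2*l \<Longrightarrow> g $$ (r, c) \<noteq> 0 \<Longrightarrow>
      r = c \<or> r \<in> {j, p} \<and> c \<in> {j, p} \<or> r \<in> {dual l j, dual l p} \<and> c \<in> {dual l j, dual l p}"
    "\<And>r. r < 2*l \<Longrightarrow> x' $$ (r, j) = (if r = dual l j then 1 else 0)"
    "\<And>r. r < 2*l \<Longrightarrow> x' $$ (r, p) = (if r = dual l p then 1 else 0)"
    "\<And>r. r < 2*l \<Longrightarrow> x' $$ (r, dual l p) = 0"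
    "\<And>r. r < 2*l \<Longrightarrow> x' $$ (r, dual l j) = 0"
    "\<And>c r. c \<in> D \<Longrightarrow> r < 2*l \<Longrightarrow> x' $$ (r, c) = x $$ (r, c)"
proof -
  note [[linarith_neq_limit = 0]]
  let ?X = "mapply l x" and ?e = "ebas"
  have ne: "dual l j \<noteq> j" "dual l p \<noteq> p" "j \<noteq> p" "p \<noteq> j" "j \<noteq> dual l p" "dual l p \<noteq> j" "dual l j \<noteq> p" "dual l j \<noteq> dual l p" "dual l p \<noteq> dual l j"
    using j p by auto
  define s where "s = csqrt (1/2)"
  have "s * s = 1/2" using power2_csqrt[of "1/2"] by (simp add: s_def power2_eq_square)
  then have s: "s * s = 1/2" "s * (s * z) = z / 2" "s * (2 * z) = 2 * (s * z)"
    "s * (\<i> * z) = \<i> * (s * z)" "\<i> * s * z = \<i> * (s * z)" "\<i> * (2 * (\<i> * z)) = - 2 * z" "\<i> * (\<i> * z) = - z" for z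
    by (simp_all flip: mult.assoc)
  have Xj: "?X (?e j) = ?e (dual l p)" "?X (?e p) = ?e (dual l j)"
    using j p by (auto simp: fun_eq_iff mapply_ebas cols) (auto simp: ebas_def)
  have Xd: "?X (?e (dual l p)) = 0" "?X (?e (dual l j)) = 0"
    unfolding Xj[symmetric] by (auto simp: mapply_twice[OF x])
  \<comment> \<open>The vectors at the dual places are the images of the first two. The factor
    \<open>\<i>\<close> gives the difference of \<open>ebas j\<close> and \<open>ebas p\<close> the
    same value of beta as their sum.\<close>
  define v where "v c = (if c = j then scl s (?e j + ?e p) else if c = p then scl (\<i>*s) (?e j + scl (-1) (?e p))
    else if c = dual l j then scl s (?e (dual l p) + ?e (dual l j))
    else if c = dual l p then scl (\<i>*s) (?e (dual l p) + scl (-1) (?e (dual l j))) else ?e c)" for c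
  have vj: "v j = scl s (?e j + ?e p)" "v p = scl (\<i>*s) (?e j + scl (-1) (?e p))"
      "v (dual l j) = scl s (?e (dual l p) + ?e (dual l j))"
      "v (dual l p) = scl (\<i>*s) (?e (dual l p) + scl (-1) (?e (dual l j)))" using ne by (auto simp: v_def)
  have vo: "v c = ?e c"
    if "c \<noteq> j" "c \<noteq> p" "c \<noteq> dual l p" "c \<noteq> dual l j" for c
    using that by (auto simp: v_def)
  have split: "c = j \<or> c = p \<or> c = dual l p \<or> c = dual l j \<or>
    (c \<noteq> j \<and> c \<noteq> p \<and> c \<noteq> dual l p \<and> c \<noteq> dual l j)" for c by blast
  have basis: "symplectic_basis l v"
  proof (rule symplectic_basisI)
    note [[linarith_neq_limit = 0]]
    fix a c assume ac: "a < 2*l" "c < 2*l"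
    have d: "dual l a \<noteq> j \<and> dual l a \<noteq> p \<and> j \<noteq> dual l a \<and> p \<noteq> dual l a" if "a \<noteq> dual l p" "a \<noteq> dual l j"
      using that ac(1) j p(1) by auto
    show "form l (v a) (v c) = (if c = dual l a then eps l a else 0)"
      using split[of a]
    proof (elim disjE)
      assume a: "a = j"
      show ?thesis using split[of c]
        by (elim disjE) (use a ac j p ne same in \<open>simp_all add: vj vo s same\<close>)
    next
      assume a: "a = p"
      show ?thesis using split[of c]
        by (elim disjE) (use a ac j p ne same in \<open>simp_all add: vj vo s same\<close>)
    next
      assume a: "a = dual l p"
      show ?thesis using split[of c]
        by (elim disjE) (use a ac j p ne same in \<open>simp_all add: vj vo s same\<close>)
    next
      assume a: "a = dual l j"
      show ?thesis using split[of c]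
        by (elim disjE) (use a ac j p ne same in \<open>simp_all add: vj vo s same\<close>)
    next
      assume a: "a \<noteq> j \<and> a \<noteq> p \<and> a \<noteq> dual l p \<and> a \<noteq> dual l j"
      note d' = d[OF conjunct1[OF conjunct2[OF conjunct2[OF a]]] conjunct2[OF conjunct2[OF conjunct2[OF a]]]]
      show ?thesis using split[of c]
        by (elim disjE) (use a d' not_sym[of a j] not_sym[of a p] ac j p ne same in \<open>simp_all add: vj vo\<close>)
    qed
  qed
  have vD: "v c = ?e c" if "c \<in> D" for c
  proof -
    have "c < 2*l" "dual l c \<in> D" using that D(1) unfolding reduced_on_def by auto
    then have "c \<noteq> j" "c \<noteq> p" "c \<noteq> dual l j" "c \<noteq> dual l p" using that D j p by auto
    then show ?thesis by (auto simp: vo)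
  qed
  obtain x' where x': "basis_mat l v \<in> SP l" "x' \<in> N2 l" "basis_mat l v * x' = x * basis_mat l v"
    "\<And>c r z b. c < 2*l \<Longrightarrow> b < 2*l \<Longrightarrow> r < 2*l \<Longrightarrow> mapply l x (v c) = scl z (v b) \<Longrightarrow>
       x' $$ (r, c) = (if r = b then z else 0)"
    "\<And>c r. c \<in> D \<Longrightarrow> r < 2*l \<Longrightarrow> x' $$ (r, c) = x $$ (r, c)"
    by (rule symplectic_change[OF x basis D(1) vD], assumption, rule that; assumption)
  \<comment> \<open>This support later puts the base change into the Levi subgroup, when
    \<open>j\<close> and \<open>p\<close> have equal labels.\<close>
  have supp: "r = c \<or> r \<in> {j, p} \<and> c \<in> {j, p} \<or> r \<in> {dual l j, dual l p} \<and> c \<in> {dual l j, dual l p}"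
    if "r < 2*l" "c < 2*l" "basis_mat l v $$ (r, c) \<noteq> 0" for r c
    using that split[of c]
    by (elim disjE conjE) (auto simp: basis_mat_def vj vo scl_def plus_apply ebas_def split: if_splits)
  have 1: "mapply l x (v j) = scl 1 (v (dual l j))" by (simp add: vj Xj)
  have 2: "mapply l x (v p) = scl 1 (v (dual l p))" by (simp add: vj Xj)
  have 3: "mapply l x (v (dual l p)) = scl 0 (v j)" by (simp add: vj Xd)
  have 4: "mapply l x (v (dual l j)) = scl 0 (v j)" by (simp add: vj Xd)
  show thesis
    by (rule that[OF x'(1-3) supp])
      (use x'(4)[OF _ _ _ 1] x'(4)[OF _ _ _ 2] x'(4)[OF _ _ _ 3] x'(4)[OF _ _ _ 4] x'(5) j p in auto)
qed

section \<open>Matrices of placed patterns\<close>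

text \<open>One entry for each basis position that the edge occupies: an undotted loop takes two
  positions of its block, a dotted loop only one.\<close>

fun edge_vertices :: "esolp_edge \<Rightarrow> nat list" where
  "edge_vertices (Arrow i j) = [i, j]"
| "edge_vertices (Loop i) = [i, i]"
| "edge_vertices (Dotted_Arrow i j) = [i, j]"
| "edge_vertices (Dotted_Loop c i) = [i]"

text \<open>A sparse form of \<open>edge_mat\<close> with entries (column, row, value); being a
  list, it can be counted and checked for repetitions.\<close>

fun edge_units :: "nat \<Rightarrow> esolp_edge \<times> nat \<times> nat \<Rightarrow> (nat \<times> nat \<times> complex) list" where
  "edge_units l (Arrow i j, s, t) = [(s, t, 1), (dual l t, dual l s, -1)]"
| "edge_units l (Loop i, s, t) = [(s, t, 1), (dual l t, dual l s, -1)]"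
| "edge_units l (Dotted_Arrow i j, s, t) =
     (if i < j then [(s, dual l t, 1), (t, dual l s, 1)] else [(dual l s, t, 1), (dual l t, s, 1)])"
| "edge_units l (Dotted_Loop Clockwise i, s, t) = [(s, dual l s, 1)]"
| "edge_units l (Dotted_Loop Counterclockwise i, s, t) = [(dual l s, s, 1)]"

definition pattern_mat :: "nat \<Rightarrow> (esolp_edge \<times> nat \<times> nat) list \<Rightarrow> complex mat" where
  "pattern_mat l qs = foldr (+) (map (edge_mat l) qs) (0\<^sub>m (2*l) (2*l))"

definition pattern_units :: "nat \<Rightarrow> (esolp_edge \<times> nat \<times> nat) list \<Rightarrow> (nat \<times> nat \<times> complex) list" where
  "pattern_units l qs = concat (map (edge_units l) qs)"

definition positions :: "(esolp_edge \<times> nat \<times> nat) list \<Rightarrow> nat list" where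
  "positions qs = concat (map used_positions qs)"

text \<open>The representative in the first half of the pair formed by \<open>a\<close> and its
  dual. A placement uses every such pair at most once.\<close>

definition base :: "nat \<Rightarrow> nat \<Rightarrow> nat" where
  "base l a = (if a < l then a else dual l a)"

lemma base_simps [simp]:
  "a < l \<Longrightarrow> base l a = a" "a < l \<Longrightarrow> base l (dual l a) = a" 
  by (auto simp: base_def dual_def)

lemma base_dual [simp]: "a < 2*l \<Longrightarrow> base l (dual l a) = base l a"
  by (auto simp: base_def dual_def)

lemma base_less: "a < 2*l \<Longrightarrow> base l a < l"
  by (auto simp: base_def dual_def)

lemma base_eq_iff: "a < 2*l \<Longrightarrow> c < 2*l \<Longrightarrow> base l a = base l c \<longleftrightarrow> a = c \<or> a = dual l c"
  by (auto simp: base_def dual_def)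

lemma pattern_mat_simps [simp]:
  "pattern_mat l [] = 0\<^sub>m (2*l) (2*l)"
  "pattern_mat l (q # qs) = edge_mat l q + pattern_mat l qs"
  by (simp_all add: pattern_mat_def)

lemma edge_mat_carrier [simp]: "edge_mat l q \<in> carrier_mat (2*l) (2*l)"
  by (cases "(l, q)" rule: edge_mat.cases) (auto simp: unit_map_def)

lemma pattern_mat_carrier [simp]: "pattern_mat l qs \<in> carrier_mat (2*l) (2*l)"
  by (induction qs) auto

lemma pattern_mat_dim [simp]: "dim_row (pattern_mat l qs) = 2*l" "dim_col (pattern_mat l qs) = 2*l"
  using pattern_mat_carrier[of l qs] by (auto simp del: pattern_mat_carrier)

lemma pattern_mat_Cons_index:
  "r < 2*l \<Longrightarrow> c < 2*l \<Longrightarrow> pattern_mat l (q # qs) $$ (r, c) = edge_mat l q $$ (r, c) + pattern_mat l qs $$ (r, c)"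
  by simp

lemma pattern_mat_index:
  "r < 2*l \<Longrightarrow> c < 2*l \<Longrightarrow> pattern_mat l qs $$ (r, c) = (\<Sum>q\<leftarrow>qs. edge_mat l q $$ (r, c))"
  by (induction qs) (auto simp del: pattern_mat_simps(2) simp: pattern_mat_Cons_index)

lemma unit_map_index:
  "r < 2*l \<Longrightarrow> c < 2*l \<Longrightarrow> unit_map l a b $$ (r, c) = (if r = b \<and> c = a then 1 else 0)"
  by (simp add: unit_map_def)

lemma unit_map_carrier [simp]: "unit_map l a b \<in> carrier_mat (2*l) (2*l)"
  by (simp add: unit_map_def)

lemma unit_map_dim [simp]: "dim_row (unit_map l a b) = 2*l" "dim_col (unit_map l a b) = 2*l"
  by (simp_all add: unit_map_def)

lemma edge_mat_index:
  assumes "r < 2*l" "c < 2*l"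
  shows "edge_mat l q $$ (r, c) = (\<Sum>(a, b, z)\<leftarrow>edge_units l q. if r = b \<and> c = a then z else 0)"
  by (cases "(l, q)" rule: edge_mat.cases) (use assms in \<open>auto simp: unit_map_index\<close>)

lemma pattern_mat_index_units:
  assumes "r < 2*l" "c < 2*l"
  shows "pattern_mat l qs $$ (r, c) = (\<Sum>(a, b, z)\<leftarrow>pattern_units l qs. if r = b \<and> c = a then z else 0)"
  by (induction qs) (use assms in \<open>auto simp: pattern_units_def edge_mat_index pattern_mat_Cons_index simp del: pattern_mat_simps(2)\<close>)

definition placement :: "nat \<Rightarrow> nat list \<Rightarrow> (esolp_edge \<times> nat \<times> nat) list \<Rightarrow> bool" where
  "placement l b qs \<longleftrightarrow> (\<forall>q\<in>set qs. placed b q \<and> edge_wf (length b) (fst q)) \<and> distinct (positions qs)"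

definition covered :: "nat \<Rightarrow> (esolp_edge \<times> nat \<times> nat) list \<Rightarrow> nat set" where
  "covered l qs = {a. a < 2*l \<and> base l a \<in> set (positions qs)}"

text \<open>A used position contributes either itself or its dual as a column, never both. Distinct
  positions therefore give columns that are distinct even up to duality.\<close>

lemma base_columns:
  assumes "set (positions qs) \<subseteq> {..<l}"
  shows "map (\<lambda>u. base l (fst u)) (pattern_units l qs) = positions qs"
  using assms
proof (induction qs)
  case (Cons q qs)
  then show ?case by (cases "(l, q)" rule: edge_mat.cases) (auto simp: pattern_units_def positions_def)
qed (simp add: pattern_units_def positions_def)

text \<open>The unit from \<open>a\<close> to \<open>c\<close> comes with the unit from
  \<open>dual l c\<close> to \<open>dual l a\<close>, or is its own mirror image; in both cases the
  rows are the duals of the columns.\<close>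

lemma mset_rows:
  assumes "set (positions qs) \<subseteq> {..<l}"
  shows "mset (map (\<lambda>u. fst (snd u)) (pattern_units l qs)) = mset (map (\<lambda>u. dual l (fst u)) (pattern_units l qs))"
  using assms
proof (induction qs)
  case (Cons q qs)
  then show ?case by (cases "(l, q)" rule: edge_mat.cases) (auto simp: pattern_units_def positions_def)
qed (simp add: pattern_units_def positions_def)

text \<open>Membership in \<open>sp l\<close> ties each entry to its mirror image in the
  antidiagonal, up to a sign. Off the antidiagonal a unit thus needs its partner, with exactly this
  coefficient.\<close>

lemma unit_pair_sp:
  assumes a: "a < 2*l" and b: "b < 2*l"
  shows "unit_map l a b + (- eps l a * eps l b) \<cdot>\<^sub>m unit_map l (dual l b) (dual l a) \<in> sp l" (is "?u \<in> _")
proof -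
  have u: "?u \<in> carrier_mat (2*l) (2*l)" by (simp add: unit_map_def)
  have ui: "?u $$ (dual l r, c) = (if r = dual l b \<and> c = a then 1 else 0) -
      eps l a * eps l b * (if r = a \<and> c = dual l b then 1 else 0)" if "r < 2*l" "c < 2*l" for r c
  proof -
    have d: "dual l r < 2*l" using that by simp
    have "?u $$ (dual l r, c) = unit_map l a b $$ (dual l r, c) +
        (- eps l a * eps l b) * unit_map l (dual l b) (dual l a) $$ (dual l r, c)"
      using d that(2) by simp
    then show ?thesis
      unfolding unit_map_index[OF d that(2)] dual_eq_iff[OF that(1) b] dual_inject[OF that(1) a] by simp
  qed
  show ?thesis unfolding sp_iff_index[OF u]
  proof (intro allI impI)
    fix r c assume rc: "r < 2*l" "c < 2*l"
    show "eps l r * ?u $$ (dual l r, c) = eps l c * ?u $$ (dual l c, r)"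
    proof -
      define A where "A \<longleftrightarrow> r = dual l b \<and> c = a"
      define B where "B \<longleftrightarrow> r = a \<and> c = dual l b"
      have A: "eps l r = - eps l b" "eps l c = eps l a" if A using that b by (simp_all add: A_def)
      have B: "eps l r = eps l a" "eps l c = - eps l b" if B using that b by (simp_all add: B_def)
      have "eps l r * ((if A then 1 else 0) - eps l a * eps l b * (if B then 1 else 0)) =
        eps l c * ((if B then 1 else 0) - eps l a * eps l b * (if A then 1 else 0))"
        by (cases A; cases B) (use A B in \<open>simp_all add: mult.left_commute[of "eps l b" "eps l a"]\<close>)
      then show ?thesis unfolding ui[OF rc] ui[OF rc(2,1)] A_def B_def by (simp only: conj_commute)
    qed
  qed
qed

text \<open>An entry on the antidiagonal is its own mirror image and the signs agree, which is why a
  dotted loop is a single unit.\<close>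

lemma unit_dual_sp:
  assumes a: "a < 2*l"
  shows "unit_map l a (dual l a) \<in> sp l"
  unfolding sp_iff_index[OF unit_map_carrier]
proof (intro allI impI)
  fix r c assume rc: "r < 2*l" "c < 2*l"
  show "eps l r * unit_map l a (dual l a) $$ (dual l r, c) = eps l c * unit_map l a (dual l a) $$ (dual l c, r)"
  proof -
    have i: "unit_map l a (dual l a) $$ (dual l r, c) = (if r = a \<and> c = a then 1 else 0)" if "r < 2*l" "c < 2*l" for r c
      unfolding unit_map_index[OF dual_less[OF that(1)] that(2)] dual_inject[OF that(1) a] ..
    show ?thesis unfolding i[OF rc] i[OF rc(2,1)] by auto
  qed
qed

lemma edge_mat_sp:
  assumes "set (used_positions q) \<subseteq> {..<l}"
  shows "edge_mat l q \<in> sp l"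
proof -
  have d: "x < 2*l" "dual l x < 2*l" "eps l x = 1" "eps l (dual l x) = -1" "dual l (dual l x) = x" if "x < l" for x
    using that by (auto simp: dual_def eps_def)
  have 1: "unit_map l s t - unit_map l (dual l t) (dual l s) \<in> sp l" if "s < l" "t < l" for s t
  proof -
    have "unit_map l s t - unit_map l (dual l t) (dual l s) =
        unit_map l s t + (-1) \<cdot>\<^sub>m unit_map l (dual l t) (dual l s)"
      by (rule eq_matI) auto
    then show ?thesis using unit_pair_sp[of s l t] d(1,3)[OF that(1)] d(1,3)[OF that(2)] by simp
  qed
  have one: "1 \<cdot>\<^sub>m A = A" for A :: "complex mat" by (rule eq_matI) auto
  have 2: "unit_map l s (dual l t) + unit_map l t (dual l s) \<in> sp l" if "s < l" "t < l" for s t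
    using unit_pair_sp[of s l "dual l t"] d[OF that(1)] d[OF that(2)] by (simp add: one)
  have 3: "unit_map l (dual l s) t + unit_map l (dual l t) s \<in> sp l" if "s < l" "t < l" for s t
    using unit_pair_sp[of "dual l s" l t] d[OF that(1)] d[OF that(2)] by (simp add: one)
  have 4: "unit_map l s (dual l s) \<in> sp l" "unit_map l (dual l s) s \<in> sp l" if "s < l" for s
    using unit_dual_sp[of s l] unit_dual_sp[of "dual l s" l] d[OF that] by simp_all
  show ?thesis
    by (cases "(l, q)" rule: edge_mat.cases) (use assms 1 2 3 4 in simp_all)
qed

lemma sp_add: 
  assumes "x \<in> sp l" "y \<in> sp l"
  shows "x + y \<in> sp l"
proof -
  have c: "x \<in> carrier_mat (2*l) (2*l)" "y \<in> carrier_mat (2*l) (2*l)" "x + y \<in> carrier_mat (2*l) (2*l)"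
    using assms by (auto simp: sp_def)
  show ?thesis
    using assms c unfolding sp_iff_index[OF c(1)] sp_iff_index[OF c(2)] sp_iff_index[OF c(3)]
    by (auto simp: distrib_left)
qed

lemma pattern_mat_sp:
  "set (positions qs) \<subseteq> {..<l} \<Longrightarrow> pattern_mat l qs \<in> sp l"
proof (induction qs)
  case Nil
  then show ?case by (simp add: sp_iff_index)
next
  case (Cons q qs)
  then show ?case by (auto simp: positions_def intro!: sp_add edge_mat_sp)
qed

lemma sum_list_map_zero: "(\<And>x. x \<in> set xs \<Longrightarrow> f x = 0) \<Longrightarrow> (\<Sum>x\<leftarrow>xs. f x) = (0 :: 'b :: comm_monoid_add)"
  by (induction xs) auto

lemma sum_list_unique:
  assumes "distinct (map h xs)" "u \<in> set xs" "\<And>w. w \<in> set xs \<Longrightarrow> h w \<noteq> h u \<Longrightarrow> f w = 0"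
  shows "(\<Sum>w\<leftarrow>xs. f w) = (f u :: 'b :: comm_monoid_add)"
  using assms
proof (induction xs)
  case (Cons y xs)
  show ?case
  proof (cases "y = u")
    case True
    then have "(\<Sum>w\<leftarrow>xs. f w) = 0"
      using Cons.prems by (intro sum_list_map_zero) (auto simp: image_iff)
    then show ?thesis using True by simp
  next
    case False
    then have "u \<in> set xs" using Cons.prems by auto
    then have "f y = 0" using Cons.prems by (intro Cons.prems(3)) auto
    then show ?thesis using Cons \<open>u \<in> set xs\<close> by simp
  qed
qed simp

section \<open>The units of a placed pattern and the vanishing of the square of its matrix\<close>

context
  fixes l :: nat and qs :: "(esolp_edge \<times> nat \<times> nat) list"
  assumes pos: "set (positions qs) \<subseteq> {..<l}" and dist: "distinct (positions qs)"
begin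

lemma units_less:
  assumes "(c, r, z) \<in> set (pattern_units l qs)"
  shows "c < 2*l" "r < 2*l"
proof -
  have *: "x \<in> set (positions qs) \<Longrightarrow> x < 2*l" for x using pos by auto
  have "c < 2*l \<and> r < 2*l" if "q \<in> set qs" "(c, r, z) \<in> set (edge_units l q)" for q
  proof -
    have "set (used_positions q) \<subseteq> set (positions qs)" using that(1) by (auto simp: positions_def)
    then show ?thesis using * that(2) by (cases "(l, q)" rule: edge_mat.cases) (auto split: if_splits)
  qed
  then show "c < 2*l" "r < 2*l" using assms by (auto simp: pattern_units_def)
qed

lemma distinct_bases: "distinct (map (\<lambda>u. base l (fst u)) (pattern_units l qs))"
  using base_columns[OF pos] dist by simp

lemma distinct_columns: "distinct (map fst (pattern_units l qs))"
  using distinct_map[of "base l" "map fst (pattern_units l qs)"] distinct_bases by (simp add: comp_def)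

lemma distinct_rows: "distinct (map (\<lambda>u. fst (snd u)) (pattern_units l qs))"
proof -
  have less: "fst u < 2*l" if "u \<in> set (pattern_units l qs)" for u
    using units_less(1)[of "fst u" "fst (snd u)" "snd (snd u)"] that by simp
  have "inj_on (dual l) (set (map fst (pattern_units l qs)))"
  proof (rule inj_onI)
    fix a c assume "a \<in> set (map fst (pattern_units l qs))" "c \<in> set (map fst (pattern_units l qs))" "dual l a = dual l c"
    moreover then have "a < 2*l" "c < 2*l" using less by auto
    ultimately show "a = c" by simp
  qed
  then have "distinct (map (dual l) (map fst (pattern_units l qs)))"
    using distinct_columns unfolding distinct_map[of "dual l"] by blast
  then have "distinct (map (\<lambda>u. dual l (fst u)) (pattern_units l qs))" by (simp add: comp_def)
  then show ?thesis using mset_rows[OF pos] by (metis mset_eq_imp_distinct_iff)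
qed

lemma row_dual_column:
  assumes "(c, r, z) \<in> set (pattern_units l qs)"
  obtains c' r' z' where "(c', r', z') \<in> set (pattern_units l qs)" "r = dual l c'"
proof -
  have "r \<in> set (map (\<lambda>u. fst (snd u)) (pattern_units l qs))"
    using assms by force
  then have "r \<in> set (map (\<lambda>u. dual l (fst u)) (pattern_units l qs))"
    using mset_rows[OF pos] by (metis set_mset_mset)
  then show thesis using that by force
qed

lemma base_inj_columns:
  assumes "(c, r, z) \<in> set (pattern_units l qs)" "(c', r', z') \<in> set (pattern_units l qs)" "base l c = base l c'"
  shows "c = c'"
  using distinct_bases assms unfolding distinct_map inj_on_def by force

text \<open>A row index is the dual of some column index, and of two dual indices only one occurs
  among the columns. So no two units compose, and the matrix squares to zero.\<close>

lemma row_not_column: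
  assumes "(c, r, z) \<in> set (pattern_units l qs)" "(r, r', z') \<in> set (pattern_units l qs)"
  shows False
proof -
  obtain c'' r'' z'' where u: "(c'', r'', z'') \<in> set (pattern_units l qs)" "r = dual l c''"
    using row_dual_column[OF assms(1)] .
  have "c'' < 2*l" using units_less[OF u(1)] by simp
  then have "base l r = base l c''" using u(2) by simp
  then have "r = c''" using base_inj_columns[OF assms(2) u(1)] by simp
  then show False using u(2) \<open>c'' < 2*l\<close> by simp
qed

lemma pattern_mat_unit:
  assumes "(c, r, z) \<in> set (pattern_units l qs)"
  shows "pattern_mat l qs $$ (r, c) = z"
proof -
  have "pattern_mat l qs $$ (r, c) = (case (c, r, z) of (a, b, z) \<Rightarrow> if r = b \<and> c = a then z else 0)"
    unfolding pattern_mat_index_units[OF units_less(2,1)[OF assms]]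
    by (rule sum_list_unique[OF distinct_columns assms]) auto
  then show ?thesis by simp
qed

lemma pattern_mat_nonzero:
  assumes "r < 2*l" "c < 2*l" "pattern_mat l qs $$ (r, c) \<noteq> 0"
  obtains z where "(c, r, z) \<in> set (pattern_units l qs)"
proof -
  have "\<exists>z. (c, r, z) \<in> set (pattern_units l qs)"
  proof (rule ccontr)
    assume "\<not> ?thesis"
    then have "(\<Sum>(a, b, z)\<leftarrow>pattern_units l qs. if r = b \<and> c = a then z else 0) = 0"
      by (intro sum_list_map_zero) auto
    then show False using assms by (simp add: pattern_mat_index_units)
  qed
  then show thesis using that by blast
qed

lemma unit_nonzero: "(c, r, z) \<in> set (pattern_units l qs) \<Longrightarrow> z \<noteq> 0"
proof -
  assume "(c, r, z) \<in> set (pattern_units l qs)"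
  then obtain q where "q \<in> set qs" "(c, r, z) \<in> set (edge_units l q)" by (auto simp: pattern_units_def)
  then show ?thesis by (cases "(l, q)" rule: edge_mat.cases) (auto split: if_splits)
qed

lemma pattern_mat_N2: "pattern_mat l qs \<in> N2 l"
proof -
  have "pattern_mat l qs * pattern_mat l qs = 0\<^sub>m (2*l) (2*l)"
  proof (rule eq_matI)
    fix a c assume "a < dim_row (0\<^sub>m (2*l) (2*l) :: complex mat)" "c < dim_col (0\<^sub>m (2*l) (2*l) :: complex mat)"
    then have ac: "a < 2*l" "c < 2*l" by auto
    have "pattern_mat l qs $$ (a, k) * pattern_mat l qs $$ (k, c) = 0" if k: "k < 2*l" for k
    proof (rule ccontr)
      assume "\<not> ?thesis"
      then have "pattern_mat l qs $$ (a, k) \<noteq> 0" "pattern_mat l qs $$ (k, c) \<noteq> 0" by auto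
      then show False using pattern_mat_nonzero ac k row_not_column by metis
    qed
    then show "(pattern_mat l qs * pattern_mat l qs) $$ (a, c) = 0\<^sub>m (2*l) (2*l) $$ (a, c)"
      using ac by (subst mult_mat_index[of _ l]) (auto intro!: sum.neutral)
  qed auto
  then show ?thesis using pattern_mat_sp[OF pos] by (simp add: N2_def)
qed

lemma unit_covered:
  assumes "(c, r, z) \<in> set (pattern_units l qs)"
  shows "c \<in> covered l qs" "r \<in> covered l qs"
proof -
  have *: "c \<in> covered l qs" if "(c, r, z) \<in> set (pattern_units l qs)" for c r z
  proof -
    have "base l c \<in> set (map (\<lambda>u. base l (fst u)) (pattern_units l qs))" using that by force
    then show ?thesis using units_less[OF that] base_columns[OF pos] by (simp add: covered_def)
  qed
  show "c \<in> covered l qs" using *[OF assms] .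
  obtain c'' r'' z'' where u: "(c'', r'', z'') \<in> set (pattern_units l qs)" "r = dual l c''"
    using row_dual_column[OF assms] .
  then show "r \<in> covered l qs" using *[OF u(1)] by (auto simp: covered_def)
qed

lemma pattern_mat_uncovered:
  assumes "c < 2*l" "r < 2*l" "c \<notin> covered l qs"
  shows "pattern_mat l qs $$ (r, c) = 0"
  using pattern_mat_nonzero[of r c] unit_covered assms by metis

lemma reduced_on_covered:
  assumes agree: "\<And>c r. c \<in> covered l qs \<Longrightarrow> r < 2*l \<Longrightarrow> x $$ (r, c) = pattern_mat l qs $$ (r, c)"
  shows "reduced_on l (covered l qs) x"
  unfolding reduced_on_def
proof (intro ballI conjI)
  fix c assume c: "c \<in> covered l qs"
  show c2: "c < 2*l" and "dual l c \<in> covered l qs" using c by (auto simp: covered_def)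
  show "\<exists>z. \<exists>b\<in>covered l qs. mapply l x (ebas c) = scl z (ebas b)"
  proof (cases "\<exists>r<2*l. pattern_mat l qs $$ (r, c) \<noteq> 0")
    case True
    then obtain b where b: "b < 2*l" "pattern_mat l qs $$ (b, c) \<noteq> 0" by blast
    then obtain z where z: "(c, b, z) \<in> set (pattern_units l qs)" using pattern_mat_nonzero c2 by blast
    have "r = b" if r: "r < 2*l" "pattern_mat l qs $$ (r, c) \<noteq> 0" for r
    proof -
      obtain z' where "(c, r, z') \<in> set (pattern_units l qs)" using pattern_mat_nonzero c2 r by blast
      then show ?thesis using z distinct_columns unfolding distinct_map inj_on_def by force
    qed
    then have *: "pattern_mat l qs $$ (r, c) = (if r = b then pattern_mat l qs $$ (b, c) else 0)" if "r < 2*l" for r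
      using that by (cases "r = b") auto
    have "mapply l x (ebas c) = scl (pattern_mat l qs $$ (b, c)) (ebas b)"
    proof
      fix r
      show "mapply l x (ebas c) r = scl (pattern_mat l qs $$ (b, c)) (ebas b) r"
        using *[of r] agree[OF c, of r] b(1) by (cases "r < 2*l") (simp_all add: mapply_ebas[OF c2] scl_apply, simp_all add: ebas_def)
    qed
    then show ?thesis using unit_covered[OF z] by blast
  next
    case False
    then have "mapply l x (ebas c) = scl 0 (ebas c)"
      using agree[OF c] by (intro ext) (simp add: mapply_ebas[OF c2] scl_def)
    then show ?thesis using c by blast
  qed
qed

end

section \<open>Vertices, labels and placements\<close>

text \<open>The partial sums of \<open>b\<close> are the ends of the blocks. Vertices count from 1
  because the empty partial sum is 0.\<close>

definition vtx :: "nat list \<Rightarrow> nat \<Rightarrow> nat" where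
  "vtx b a = (LEAST i. a < sum_list (take i b))"

text \<open>If the blocks fill the first half of the basis, labels increase weakly along the whole
  basis, so the flag and the duality are both visible in them.\<close>

definition label :: "nat \<Rightarrow> nat list \<Rightarrow> nat \<Rightarrow> nat" where
  "label l b a = (if a < l then vtx b a else 2 * length b + 1 - vtx b (dual l a))"

lemma sum_take_mono: "i \<le> j \<Longrightarrow> sum_list (take i b) \<le> sum_list (take j b)" for b :: "nat list"
proof -
  assume "i \<le> j"
  then have "take j b = take i b @ take (j - i) (drop i b)"
    by (metis le_add_diff_inverse take_add)
  then show ?thesis by simp
qed

lemma vtx_le_iff: "a < sum_list b \<Longrightarrow> vtx b a \<le> i \<longleftrightarrow> a < sum_list (take i b)"
proof -
  assume a: "a < sum_list b"
  then have "a < sum_list (take (length b) b)" by simp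
  then have *: "a < sum_list (take (vtx b a) b)" unfolding vtx_def by (rule LeastI)
  show ?thesis
  proof
    assume "vtx b a \<le> i"
    then show "a < sum_list (take i b)" using * sum_take_mono[of "vtx b a" i b] by simp
  next
    assume "a < sum_list (take i b)"
    then show "vtx b a \<le> i" unfolding vtx_def by (rule Least_le)
  qed
qed

lemma vtx_bounds: "a < sum_list b \<Longrightarrow> 1 \<le> vtx b a \<and> vtx b a \<le> length b"
  using vtx_le_iff[of a b 0] vtx_le_iff[of a b "length b"] by (simp add: Suc_le_eq)

lemma vertex_block_iff: "a < sum_list b \<Longrightarrow> a \<in> vertex_block b i \<longleftrightarrow> vtx b a = i"
  using vtx_le_iff[of a b i] vtx_le_iff[of a b "i - 1"] vtx_bounds[of a b]
  by (cases i) (auto simp: vertex_block_def)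

lemma vertex_block_less: "a \<in> vertex_block b i \<Longrightarrow> a < sum_list b"
  using sum_take_mono[of i "max i (length b)" b] by (auto simp: vertex_block_def)

lemma vertex_block_eq: "vertex_block b i = {a. a < sum_list b \<and> vtx b a = i}"
  using vertex_block_iff vertex_block_less by blast

lemma vtx_mono: "a \<le> a' \<Longrightarrow> a' < sum_list b \<Longrightarrow> vtx b a \<le> vtx b a'"
  using vtx_le_iff[of a' b "vtx b a'"] vtx_le_iff[of a b "vtx b a'"] by simp

lemma card_vertex_block: 
  assumes "i \<in> {1..length b}"
  shows "card (vertex_block b i) = b ! (i - 1)"
proof -
  have "take i b = take (i - 1) b @ [b ! (i - 1)]"
    using assms by (cases i) (auto simp: take_Suc_conv_app_nth)
  then show ?thesis by (simp add: vertex_block_def)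
qed

fun is_dotted_loop :: "esolp_edge \<Rightarrow> bool" where
  "is_dotted_loop (Dotted_Loop c i) = True"
| "is_dotted_loop _ = False"

lemma placed_iff:
  "placed b (e, s, t) \<longleftrightarrow> set (used_positions (e, s, t)) \<subseteq> {..<sum_list b} \<and>
     map (vtx b) (used_positions (e, s, t)) = edge_vertices e \<and> (is_dotted_loop e \<longrightarrow> t = s)"
  by (cases e) (auto simp: vertex_block_eq)

lemma placed_positions:
  assumes "\<forall>q\<in>set qs. placed b q"
  shows "set (positions qs) \<subseteq> {..<sum_list b}" "map (vtx b) (positions qs) = concat (map (edge_vertices \<circ> fst) qs)"
  using assms by (induction qs) (auto simp: positions_def placed_iff)

text \<open>A dotted loop counts as a source and as a target but occupies one position, and an
  undotted loop occupies two. The type condition thus says that the edges fit into the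
  blocks.\<close>

lemma count_positions:
  "num_sources p i + num_targets p i + 2 * num_loops p i - num_dotted_loops p i =
     (\<Sum>e\<in>#p. count_list (edge_vertices e) i)"
proof -
  have "num_sources p i + num_targets p i + 2 * num_loops p i =
     (\<Sum>e\<in>#p. count_list (edge_vertices e) i) + num_dotted_loops p i"
  proof (induction p)
    case (add e p)
    have "num_sources (add_mset e p) i = count (sources e) i + num_sources p i"
      "num_targets (add_mset e p) i = count (targets e) i + num_targets p i"
      "num_loops (add_mset e p) i = (if e = Loop i then 1 else 0) + num_loops p i"
      "num_dotted_loops (add_mset e p) i =
        (if e = Dotted_Loop Clockwise i \<or> e = Dotted_Loop Counterclockwise i then 1 else 0) + num_dotted_loops p i"
      by (auto simp: num_sources_def num_targets_def num_loops_def num_dotted_loops_def)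
    moreover have "c = Clockwise \<or> c = Counterclockwise" for c by (cases c) auto
    ultimately show ?case using add by (cases e) auto
  qed (simp add: num_sources_def num_targets_def num_loops_def num_dotted_loops_def)
  then show ?thesis by simp
qed

lemma count_list_concat_edges:
  "(\<Sum>e\<in>#mset es. count_list (edge_vertices e) i) = count_list (concat (map edge_vertices es)) i"
  by (induction es) auto

lemma count_list_map_le:
  assumes "distinct xs" "finite A" "set xs \<subseteq> A"
  shows "count_list (map f xs) i \<le> card {a \<in> A. f a = i}"
proof -
  have "count_list (map f xs) i = length (filter (\<lambda>x. f x = i) xs)"
    by (induction xs) auto
  also have "\<dots> = card (set (filter (\<lambda>x. f x = i) xs))"
    by (rule distinct_card[symmetric]) (use assms(1) in simp)
  also have "\<dots> \<le> card {a \<in> A. f a = i}"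
    using assms by (intro card_mono) auto
  finally show ?thesis .
qed

lemma placement_esolps:
  assumes "placement l b qs"
  shows "mset (map fst qs) \<in> esolps b"
proof -
  have pl: "\<forall>q\<in>set qs. placed b q" "\<forall>q\<in>set qs. edge_wf (length b) (fst q)" "distinct (positions qs)"
    using assms by (auto simp: placement_def)
  have "num_sources (mset (map fst qs)) i + num_targets (mset (map fst qs)) i
      + 2 * num_loops (mset (map fst qs)) i - num_dotted_loops (mset (map fst qs)) i \<le> b ! (i - 1)"
    if i: "i \<in> {1..length b}" for i
  proof -
    have "(\<Sum>e\<in>#mset (map fst qs). count_list (edge_vertices e) i) = count_list (map (vtx b) (positions qs)) i"
      unfolding count_list_concat_edges placed_positions(2)[OF pl(1)] by (simp add: comp_def)
    also have "\<dots> \<le> card {a \<in> {..<sum_list b}. vtx b a = i}"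
      by (rule count_list_map_le[OF pl(3) _ placed_positions(1)[OF pl(1)]]) simp
    also have "{a \<in> {..<sum_list b}. vtx b a = i} = vertex_block b i" by (auto simp: vertex_block_eq)
    finally show ?thesis using card_vertex_block[OF i] by (simp add: count_positions)
  qed
  then show ?thesis using pl(2) by (auto simp: esolps_def)
qed

text \<open>A greedy choice works: fibres over different values are disjoint, so only the earlier
  choices over the same value compete, and these are too few to exhaust the fibre.\<close>

lemma ex_distinct_preimage:
  assumes "finite A" "\<And>i. count_list xs i \<le> card {a \<in> A. f a = i}"
  shows "\<exists>ps. distinct ps \<and> set ps \<subseteq> A \<and> map f ps = xs"
  using assms(2)
proof (induction xs)
  case (Cons x xs)
  have "count_list xs i \<le> card {a \<in> A. f a = i}" for i
    using Cons.prems[of i] by (auto split: if_splits)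
  then obtain ps where ps: "distinct ps" "set ps \<subseteq> A" "map f ps = xs" using Cons.IH by blast
  have "card (set (filter (\<lambda>a. f a = x) ps)) = count_list xs x"
    using ps(1) unfolding ps(3)[symmetric] by (induction ps) auto
  then have "card (set (filter (\<lambda>a. f a = x) ps)) < card {a \<in> A. f a = x}"
    using Cons.prems[of x] by simp
  then have "\<not> {a \<in> A. f a = x} \<subseteq> set (filter (\<lambda>a. f a = x) ps)"
    using card_mono[of "set (filter (\<lambda>a. f a = x) ps)" "{a \<in> A. f a = x}"] by auto
  then obtain a where "a \<in> A" "f a = x" "a \<notin> set ps" by auto
  then show ?case using ps by (intro exI[of _ "a # ps"]) auto
qed simp

lemma ex_placed:
  assumes "set ps \<subseteq> {..<sum_list b}" "map (vtx b) ps = concat (map edge_vertices es)"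
  shows "\<exists>qs. map fst qs = es \<and> positions qs = ps \<and> (\<forall>q\<in>set qs. placed b q)"
  using assms
proof (induction es arbitrary: ps)
  case Nil
  then show ?case by (simp add: positions_def)
next
  case (Cons e es)
  obtain ps1 ps2 where ps: "ps = ps1 @ ps2" "map (vtx b) ps1 = edge_vertices e"
      "map (vtx b) ps2 = concat (map edge_vertices es)"
    using Cons.prems(2) by (auto simp: map_eq_append_conv)
  obtain qs where qs: "map fst qs = es" "positions qs = ps2" "\<forall>q\<in>set qs. placed b q"
    using Cons.IH[OF _ ps(3)] Cons.prems(1) ps(1) by auto
  have "\<exists>s t. used_positions (e, s, t) = ps1 \<and> (is_dotted_loop e \<longrightarrow> t = s)"
    using ps(2) by (cases e) (auto simp: map_eq_Cons_conv)
  then obtain s t where st: "used_positions (e, s, t) = ps1" "is_dotted_loop e \<longrightarrow> t = s" by blast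
  have "placed b (e, s, t)" unfolding placed_iff using st ps Cons.prems(1) by auto
  then show ?case using qs st ps(1)
    by (intro exI[of _ "(e, s, t) # qs"]) (auto simp: positions_def)
qed

lemma ex_placement:
  assumes p: "p \<in> esolps b"
  obtains qs where "placement l b qs" "mset (map fst qs) = p"
proof -
  obtain es where es: "mset es = p" using ex_mset by blast
  have wf: "\<forall>e\<in>set es. edge_wf (length b) e" using p es by (auto simp: esolps_def)
  have "count_list (concat (map edge_vertices es)) i \<le> card {a \<in> {..<sum_list b}. vtx b a = i}" for i
  proof (cases "i \<in> {1..length b}")
    case True
    have "{a \<in> {..<sum_list b}. vtx b a = i} = vertex_block b i" by (auto simp: vertex_block_eq)
    moreover have "(\<Sum>e\<in>#p. count_list (edge_vertices e) i) \<le> b ! (i - 1)"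
      using p True unfolding esolps_def count_positions by blast
    ultimately show ?thesis
      using card_vertex_block[OF True] count_list_concat_edges[of i es] es by simp
  next
    case False
    have "i \<notin> set (edge_vertices e)" if "e \<in> set es" for e
    proof -
      have "edge_wf (length b) e" using wf that by blast
      then show ?thesis using False by (cases e) auto
    qed
    then have "i \<notin> set (concat (map edge_vertices es))" by auto
    then have "count_list (concat (map edge_vertices es)) i = 0" by (rule count_notin)
    then show ?thesis by simp
  qed
  then obtain ps where ps: "distinct ps" "set ps \<subseteq> {..<sum_list b}" "map (vtx b) ps = concat (map edge_vertices es)"
    using ex_distinct_preimage[of "{..<sum_list b}" "concat (map edge_vertices es)" "vtx b"] by blast
  obtain qs where qs: "map fst qs = es" "positions qs = ps" "\<forall>q\<in>set qs. placed b q"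
    using ex_placed[OF ps(2,3)] by blast
  have "placement l b qs" using qs ps wf unfolding placement_def by (metis image_eqI list.set_map)
  then show thesis using that qs es by blast
qed

lemma extend_to_bij:
  assumes "distinct xs" "distinct ys" "set xs \<subseteq> A" "set ys \<subseteq> A" "map f xs = map f ys"
  shows "\<exists>\<sigma>. bij_betw \<sigma> A A \<and> (\<forall>a\<in>A. f (\<sigma> a) = f a) \<and> map \<sigma> xs = ys"
  using assms
proof (induction xs arbitrary: ys)
  case Nil
  then show ?case by (intro exI[of _ id]) (auto simp: bij_betw_def)
next
  case (Cons x xs)
  then obtain y ys' where ys: "ys = y # ys'" by (cases ys) auto
  obtain \<sigma> where s: "bij_betw \<sigma> A A" "\<forall>a\<in>A. f (\<sigma> a) = f a" "map \<sigma> xs = ys'"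
    using Cons.IH[of ys'] Cons.prems ys by auto
  \<comment> \<open>A transposition inside one fibre of \<open>f\<close> corrects the image of
    \<open>x\<close>; it moves none of the images already arranged.\<close>
  define \<tau> where "\<tau> c = (if c = \<sigma> x then y else if c = y then \<sigma> x else c)" for c
  have xA: "x \<in> A" "y \<in> A" and fx: "f x = f y" using Cons.prems ys by auto
  have sx: "\<sigma> x \<in> A" using s(1) xA by (auto simp: bij_betw_def)
  have \<tau>: "bij_betw \<tau> A A" by (rule bij_betwI[of _ _ _ \<tau>]) (use xA sx in \<open>auto simp: \<tau>_def\<close>)
  have "\<tau> (\<sigma> a) = \<sigma> a" if "a \<in> set xs" for a
  proof -
    have "\<sigma> a \<in> set ys'" using that s(3) by auto
    then have "\<sigma> a \<noteq> y" using Cons.prems ys by auto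
    moreover have "\<sigma> a \<noteq> \<sigma> x"
      using that Cons.prems xA s(1) unfolding bij_betw_def inj_on_def by auto
    ultimately show ?thesis by (simp add: \<tau>_def)
  qed
  then have "map (\<tau> \<circ> \<sigma>) xs = ys'" using s(3) by auto
  moreover have "(\<tau> \<circ> \<sigma>) x = y" by (simp add: \<tau>_def)
  moreover have "f ((\<tau> \<circ> \<sigma>) a) = f a" if "a \<in> A" for a
  proof -
    have 1: "f (\<sigma> a) = f a" using s(2) that by blast
    have 2: "f (\<sigma> x) = f y" using s(2) xA(1) fx by metis
    show ?thesis unfolding comp_def \<tau>_def using 1 2 by metis
  qed
  ultimately show ?case unfolding ys using bij_betw_trans[OF s(1) \<tau>]
    by (intro exI[of _ "\<tau> \<circ> \<sigma>"] conjI ballI) (simp_all add: comp_def)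
qed

lemma reorder_preimage:
  assumes "mset (map f xs) = mset ys"
  shows "\<exists>xs'. mset xs' = mset xs \<and> map f xs' = ys"
  using assms
proof (induction ys arbitrary: xs)
  case (Cons y ys)
  then have "y \<in> set (map f xs)" by (metis list.set_intros(1) set_mset_mset)
  then obtain x where x: "x \<in> set xs" "f x = y" by auto
  have "mset (map f (remove1 x xs)) = mset ys"
    using Cons.prems x by (simp add: mset_map image_mset_Diff)
  then obtain xs' where "mset xs' = mset (remove1 x xs)" "map f xs' = ys" using Cons.IH by blast
  then show ?case using x by (intro exI[of _ "x # xs'"]) auto
qed simp

lemma pattern_mat_mset_cong:
  assumes "mset qs = mset qs'"
  shows "pattern_mat l qs = pattern_mat l qs'"
proof (rule eq_matI)
  fix r c assume "r < dim_row (pattern_mat l qs')" "c < dim_col (pattern_mat l qs')"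
  then have "r < 2*l" "c < 2*l" by auto
  moreover have "(\<Sum>q\<leftarrow>qs. edge_mat l q $$ (r, c)) = (\<Sum>q\<leftarrow>qs'. edge_mat l q $$ (r, c))"
    by (simp only: sum_mset_sum_list[symmetric] mset_map assms)
  ultimately show "pattern_mat l qs $$ (r, c) = pattern_mat l qs' $$ (r, c)"
    by (simp add: pattern_mat_index)
qed auto

lemma placement_mset_cong: "mset qs = mset qs' \<Longrightarrow> placement l b qs \<longleftrightarrow> placement l b qs'"
proof -
  assume m: "mset qs = mset qs'"
  then have "mset (positions qs) = mset (positions qs')"
    unfolding positions_def mset_concat by (simp only: map_map sum_mset_sum_list[symmetric] mset_map)
  then show ?thesis
    using mset_eq_setD[OF m] mset_eq_imp_distinct_iff[of "positions qs" "positions qs'"]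
    unfolding placement_def by simp
qed

section \<open>Conjugacy of placements and rank invariants\<close>

lemma relabel_placed:
  assumes "map fst qs' = map fst qs" "positions qs' = map \<sigma> (positions qs)"
    "\<forall>q\<in>set qs. placed b q" "\<forall>q\<in>set qs'. placed b q"
  shows "qs' = map (\<lambda>(e, s, t). (e, \<sigma> s, \<sigma> t)) qs"
  using assms
proof (induction qs arbitrary: qs')
  case (Cons q qs)
  obtain e s t where q: "q = (e, s, t)" by (cases q) auto
  from Cons.prems(1) q obtain s' t' qs'' where qs': "qs' = (e, s', t') # qs''" "map fst qs'' = map fst qs"
    by (auto simp: map_eq_Cons_conv)
  have pl: "placed b (e, s, t)" "placed b (e, s', t')" using Cons.prems(3,4) q qs' by auto
  have eq: "used_positions (e, s', t') @ positions qs'' = map \<sigma> (used_positions (e, s, t)) @ map \<sigma> (positions qs)"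
    using Cons.prems(2) by (simp add: positions_def q qs')
  have "length (used_positions (e, s', t')) = length (map \<sigma> (used_positions (e, s, t)))"
    by (cases e) auto
  then have eqs: "used_positions (e, s', t') = map \<sigma> (used_positions (e, s, t))" "positions qs'' = map \<sigma> (positions qs)"
    using eq by auto
  have "s' = \<sigma> s \<and> t' = \<sigma> t" using eqs(1) pl by (cases e) auto
  moreover have "qs'' = map (\<lambda>(e, s, t). (e, \<sigma> s, \<sigma> t)) qs"
    using Cons.IH[OF qs'(2) eqs(2)] Cons.prems(3,4) qs' by auto
  ultimately show ?case by (simp add: q qs')
qed simp

lemma label_less: "s < l \<Longrightarrow> label l b s = vtx b s"
  by (simp add: label_def)

lemma label_dual: "s < l \<Longrightarrow> label l b (dual l s) = 2 * length b + 1 - vtx b s"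
  by (auto simp: label_def dual_def)

text \<open>Two placements of a pattern differ by a permutation of positions inside the vertex
  blocks. Extended to the dual positions it becomes a symplectic permutation matrix that preserves
  labels.\<close>

lemma placements_conj:
  assumes b: "sum_list b = l" and q1: "placement l b qs1" and q2: "placement l b qs2"
    and m: "mset (map fst qs1) = mset (map fst qs2)"
  obtains g where "g \<in> SP l" "g * pattern_mat l qs1 = pattern_mat l qs2 * g"
    "\<And>r c. r < 2*l \<Longrightarrow> c < 2*l \<Longrightarrow> g $$ (r, c) \<noteq> 0 \<Longrightarrow> label l b r = label l b c"
proof -
  obtain qs where qs: "mset qs = mset qs2" "map fst qs = map fst qs1"
    using reorder_preimage[of fst qs2 "map fst qs1"] m by auto
  have q: "placement l b qs" and Meq: "pattern_mat l qs = pattern_mat l qs2"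
    using placement_mset_cong[OF qs(1)] q2 pattern_mat_mset_cong[OF qs(1)] by auto
  have p1: "\<forall>q\<in>set qs1. placed b q" "distinct (positions qs1)"
    and p: "\<forall>q\<in>set qs. placed b q" "distinct (positions qs)"
    using q1 q by (auto simp: placement_def)
  have pos1: "set (positions qs1) \<subseteq> {..<l}" and pos: "set (positions qs) \<subseteq> {..<l}"
    using placed_positions(1)[OF p1(1)] placed_positions(1)[OF p(1)] b by auto
  have "map (vtx b) (positions qs1) = map (vtx b) (positions qs)"
    using placed_positions(2)[OF p1(1)] placed_positions(2)[OF p(1)] qs(2) by (simp flip: map_map)
  then obtain \<sigma> where \<sigma>: "bij_betw \<sigma> {..<l} {..<l}" "\<forall>a\<in>{..<l}. vtx b (\<sigma> a) = vtx b a"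
      "map \<sigma> (positions qs1) = positions qs"
    using extend_to_bij[OF p1(2) p(2) pos1 pos] by metis
  \<comment> \<open>Commuting with \<open>dual l\<close> and keeping the two halves apart preserves
    both the pairing and its signs.\<close>
  define \<pi> where "\<pi> a = (if a < l then \<sigma> a else dual l (\<sigma> (dual l a)))" for a
  have \<sigma>l: "\<sigma> a < l" if "a < l" for a using \<sigma>(1) that by (auto simp: bij_betw_def)
  have \<pi>1: "\<pi> a = \<sigma> a" "\<pi> (dual l a) = dual l (\<sigma> a)" if "a < l" for a
    using that by (auto simp: \<pi>_def dual_def)
  have split: "(\<exists>s<l. a = s) \<or> (\<exists>s<l. a = dual l s)" if "a < 2*l" for a
  proof (cases "a < l")
    case False
    then have "dual l a < l" "a = dual l (dual l a)" using that by (auto simp: dual_def)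
    then show ?thesis by blast
  qed auto
  have \<pi>2: "\<pi> a < 2*l \<and> \<pi> (dual l a) = dual l (\<pi> a) \<and> label l b (\<pi> a) = label l b a \<and> eps l (\<pi> a) = eps l a"
    if a: "a < 2*l" for a
    using split[OF a]
  proof (elim disjE exE conjE)
    fix s assume s: "s < l" "a = s"
    then show ?thesis using \<pi>1[OF s(1)] \<sigma>l[OF s(1)] \<sigma>(2) by (auto simp: label_less eps_def)
  next
    fix s assume s: "s < l" "a = dual l s"
    have "s < 2*l" "\<sigma> s < 2*l" "\<not> dual l s < l" "\<not> dual l (\<sigma> s) < l"
      using s \<sigma>l[OF s(1)] by (auto simp: dual_def)
    then show ?thesis using s \<pi>1[OF s(1)] \<sigma>l[OF s(1)] \<sigma>(2) by (auto simp: label_dual eps_def)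
  qed
  have \<pi>inj: "a = c" if "\<pi> a = \<pi> c" and ac: "a < 2*l" "c < 2*l" for a c
  proof -
    have inj: "\<sigma> s = \<sigma> t \<longleftrightarrow> s = t" if "s < l" "t < l" for s t
      using \<sigma>(1) that by (auto simp: bij_betw_def inj_on_def)
    have e: "eps l a = eps l c" using \<pi>2[OF ac(1)] \<pi>2[OF ac(2)] that(1) by simp
    show ?thesis
    proof (cases "a < l")
      case True
      then have "c < l" using e by (auto simp: eps_def split: if_splits)
      then show ?thesis using True that(1) \<pi>1(1) inj by metis
    next
      case False
      then have "\<not> c < l" using e by (auto simp: eps_def split: if_splits)
      then have d: "dual l a < l" "dual l c < l" using False ac by (auto simp: dual_def)
      have "dual l (\<sigma> (dual l a)) = dual l (\<sigma> (dual l c))"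
        using that(1) False \<open>\<not> c < l\<close> by (simp add: \<pi>_def)
      then have "\<sigma> (dual l a) = \<sigma> (dual l c)"
        using \<sigma>l[OF d(1)] \<sigma>l[OF d(2)] by simp
      then show ?thesis using inj d ac by simp
    qed
  qed
  have qs_eq: "qs = map (\<lambda>(e, s, t). (e, \<sigma> s, \<sigma> t)) qs1"
    by (rule relabel_placed[OF qs(2) \<sigma>(3)[symmetric] p1(1) p(1)])
  have units: "pattern_units l qs = map (\<lambda>(a, c, z). (\<pi> a, \<pi> c, z)) (pattern_units l qs1)"
    unfolding qs_eq using pos1
  proof (induction qs1)
    case (Cons q qs1)
    then show ?case
      by (cases "(l, q)" rule: edge_mat.cases) (auto simp: pattern_units_def positions_def \<pi>1)
  qed (simp add: pattern_units_def)
  have M: "pattern_mat l qs $$ (\<pi> r, \<pi> c) = pattern_mat l qs1 $$ (r, c)" if rc: "r < 2*l" "c < 2*l" for r c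
  proof -
    have "(case u of (a, d, z) \<Rightarrow> if \<pi> r = \<pi> d \<and> \<pi> c = \<pi> a then z else 0) = (case u of (a, d, z) \<Rightarrow> if r = d \<and> c = a then z else 0)"
      if "u \<in> set (pattern_units l qs1)" for u
    proof -
      obtain a d z where u: "u = (a, d, z)" by (cases u) auto
      have "a < 2*l" "d < 2*l" using units_less[OF pos1 p1(2)] that u by auto
      then have "\<pi> r = \<pi> d \<longleftrightarrow> r = d" "\<pi> c = \<pi> a \<longleftrightarrow> c = a" using \<pi>inj rc by blast+
      then show ?thesis by (simp add: u)
    qed
    then have *: "map (\<lambda>u. case u of (a, d, z) \<Rightarrow> if \<pi> r = \<pi> d \<and> \<pi> c = \<pi> a then z else 0) (pattern_units l qs1)
        = map (\<lambda>u. case u of (a, d, z) \<Rightarrow> if r = d \<and> c = a then z else 0) (pattern_units l qs1)"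
      by (intro map_cong refl)
    have "pattern_mat l qs $$ (\<pi> r, \<pi> c) =
        sum_list (map (\<lambda>u. case u of (a, d, z) \<Rightarrow> if \<pi> r = \<pi> d \<and> \<pi> c = \<pi> a then z else 0) (pattern_units l qs1))"
      using \<pi>2[OF rc(1)] \<pi>2[OF rc(2)]
      by (simp add: pattern_mat_index_units units comp_def case_prod_unfold cong: if_cong)
    also have "\<dots> = pattern_mat l qs1 $$ (r, c)"
      unfolding * pattern_mat_index_units[OF rc] ..
    finally show ?thesis .
  qed
  define v where "v a = ebas (\<pi> a)" for a
  have v: "form l (v a) (v c) = (if c = dual l a then eps l a else 0)" if ac: "a < 2*l" "c < 2*l" for a c
  proof -
    have "\<pi> c = dual l (\<pi> a) \<longleftrightarrow> c = dual l a"
      using \<pi>2[OF ac(1)] \<pi>inj[of c "dual l a"] ac by auto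
    then show ?thesis using \<pi>2[OF ac(1)] \<pi>2[OF ac(2)] by (simp add: v_def)
  qed
  have N: "pattern_mat l qs \<in> N2 l" by (rule pattern_mat_N2[OF pos p(2)])
  have eq: "mat (2*l) (2*l) (\<lambda>(r, c). - eps l r * form l (v (dual l r)) (mapply l (pattern_mat l qs) (v c))) = pattern_mat l qs1"
  proof (rule eq_matI)
    fix r c assume "r < dim_row (pattern_mat l qs1)" "c < dim_col (pattern_mat l qs1)"
    then have rc: "r < 2*l" "c < 2*l" by auto
    have d: "dual l r < 2*l" using rc by simp
    have "form l (v (dual l r)) (mapply l (pattern_mat l qs) (v c)) =
        eps l (\<pi> (dual l r)) * pattern_mat l qs $$ (dual l (\<pi> (dual l r)), \<pi> c)"
      unfolding v_def by (rule form_ebas_mapply) (use \<pi>2[OF d] \<pi>2[OF rc(2)] in auto)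
    also have "\<dots> = - eps l r * pattern_mat l qs1 $$ (r, c)"
      using \<pi>2[OF d] \<pi>2[OF rc(1)] rc M[OF rc] by simp
    finally show "mat (2*l) (2*l) (\<lambda>(r, c). - eps l r * form l (v (dual l r)) (mapply l (pattern_mat l qs) (v c))) $$ (r, c)
        = pattern_mat l qs1 $$ (r, c)"
      using rc by simp
  qed auto
  have g: "basis_mat l v \<in> SP l" "basis_mat l v * pattern_mat l qs1 = pattern_mat l qs * basis_mat l v"
    unfolding basis_mat_def eq[symmetric] by (rule basis_change[OF N v]; assumption)+
  have "label l b r = label l b c" if "r < 2*l" "c < 2*l" "basis_mat l v $$ (r, c) \<noteq> 0" for r c
  proof -
    have "r = \<pi> c" using that by (auto simp: basis_mat_def v_def ebas_def split: if_splits)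
    then show ?thesis using \<pi>2[OF that(2)] by simp
  qed
  then show thesis using that g Meq by metis
qed

text \<open>Gaussian elimination: an equation with a nonzero coefficient is solved for one unknown,
  which removes one equation and one unknown. A zero equation is dropped.\<close>

lemma underdetermined_system:
  fixes A :: "'a \<Rightarrow> 'b \<Rightarrow> complex"
  assumes "finite S" "finite T" "card S < card T"
  shows "\<exists>v. (\<exists>t\<in>T. v t \<noteq> 0) \<and> (\<forall>s\<in>S. (\<Sum>t\<in>T. A s t * v t) = 0)"
  using assms
proof (induction S arbitrary: T A)
  case empty
  then obtain t where "t \<in> T" by (metis card.empty card_gt_0_iff equals0I)
  then show ?case by (intro exI[of _ "\<lambda>_. 1"]) auto
next
  case (insert s0 S)
  show ?case
  proof (cases "\<exists>t\<in>T. A s0 t \<noteq> 0")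
    case False
    obtain v where "\<exists>t\<in>T. v t \<noteq> 0" "\<forall>s\<in>S. (\<Sum>t\<in>T. A s t * v t) = 0"
      using insert.IH[of T A] insert.prems insert.hyps by auto
    then show ?thesis using False by (intro exI[of _ v]) (auto intro!: sum.neutral)
  next
    case True
    then obtain t0 where t0: "t0 \<in> T" "A s0 t0 \<noteq> 0" by blast
    define T' where "T' = T - {t0}"
    have T': "finite T'" "card S < card T'" "t0 \<notin> T'" "T = insert t0 T'"
      using insert.prems insert.hyps t0 by (auto simp: T'_def)
    obtain v where v: "\<exists>t\<in>T'. v t \<noteq> 0" "\<forall>s\<in>S. (\<Sum>t\<in>T'. (A s t - A s t0 * A s0 t / A s0 t0) * v t) = 0"
      using insert.IH[OF T'(1,2), of "\<lambda>s t. A s t - A s t0 * A s0 t / A s0 t0"] by blast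
    define w where "w = v(t0 := - (\<Sum>t\<in>T'. A s0 t * v t) / A s0 t0)"
    have w: "(\<Sum>t\<in>T. A s t * w t) = (\<Sum>t\<in>T'. A s t * v t) - A s t0 * (\<Sum>t\<in>T'. A s0 t * v t) / A s0 t0" for s
    proof -
      have "(\<Sum>t\<in>T'. A s t * w t) = (\<Sum>t\<in>T'. A s t * v t)"
        using T'(3) by (intro sum.cong) (auto simp: w_def)
      then show ?thesis unfolding T'(4) using T'(1,3) by (simp add: w_def)
    qed
    have "(\<Sum>t\<in>T. A s t * w t) = 0" if "s \<in> S" for s
    proof -
      have "0 = (\<Sum>t\<in>T'. A s t * v t - A s t0 * (A s0 t * v t) / A s0 t0)"
        using v(2) that by (simp add: left_diff_distrib mult.assoc)
      also have "\<dots> = (\<Sum>t\<in>T. A s t * w t)"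
        unfolding w by (simp add: sum_subtractf sum_distrib_left sum_divide_distrib)
      finally show ?thesis by simp
    qed
    moreover have "(\<Sum>t\<in>T. A s0 t * w t) = 0" unfolding w using t0 by simp
    moreover have "\<exists>t\<in>T. w t \<noteq> 0" using v(1) T' by (auto simp: w_def)
    ultimately show ?thesis by (intro exI[of _ w]) simp
  qed
qed

lemma mapply_mult:
  assumes "A \<in> carrier_mat (2*l) (2*l)" "B \<in> carrier_mat (2*l) (2*l)"
  shows "mapply l (A * B) u = mapply l A (mapply l B u)"
proof
  fix r
  show "mapply l (A * B) u r = mapply l A (mapply l B u) r"
  proof (cases "r < 2*l")
    case True
    have "(\<Sum>c<2*l. (A * B) $$ (r, c) * u c) = (\<Sum>c<2*l. \<Sum>k<2*l. A $$ (r, k) * B $$ (k, c) * u c)"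
      using assms True by (intro sum.cong refl) (simp add: mult_mat_index[OF assms] sum_distrib_right)
    also have "\<dots> = (\<Sum>k<2*l. \<Sum>c<2*l. A $$ (r, k) * B $$ (k, c) * u c)" by (rule sum.swap)
    finally show ?thesis using True by (simp add: mapply_def sum_distrib_left mult.assoc)
  qed (simp add: mapply_def)
qed

lemma mapply_one: "(\<And>r. \<not> r < 2*l \<Longrightarrow> w r = 0) \<Longrightarrow> mapply l (1\<^sub>m (2*l)) w = w"
proof
  fix r assume "\<And>r. \<not> r < 2*l \<Longrightarrow> w r = 0"
  moreover have "(\<Sum>c<2*l. 1\<^sub>m (2*l) $$ (r, c) * w c) = (\<Sum>c<2*l. if c = r then w c else 0)" if "r < 2*l"
    using that by (intro sum.cong) auto
  ultimately show "mapply l (1\<^sub>m (2*l)) w r = w r" by (cases "r < 2*l") (auto simp: mapply_def)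
qed

text \<open>If \<open>M\<close> has at most one nonzero entry in each row and column, the number of these columns is
  the rank of the corner of \<open>M\<close> with column labels at most \<open>\<alpha>\<close> and row labels at least \<open>\<beta>\<close>.\<close>

definition corner_columns :: "nat \<Rightarrow> (nat \<Rightarrow> nat) \<Rightarrow> nat \<Rightarrow> nat \<Rightarrow> complex mat \<Rightarrow> nat set" where
  "corner_columns l L \<alpha> \<beta> M = {c. c < 2*l \<and> L c \<le> \<alpha> \<and> (\<exists>r<2*l. \<beta> \<le> L r \<and> M $$ (r, c) \<noteq> 0)}"

text \<open>If the count for \<open>M\<close> were larger, a nonzero \<open>u\<close> supported on
  its counted columns would have \<open>g u\<close> vanishing on those counted for
  \<open>M'\<close>. Then \<open>M' g u\<close> has no coordinates with label at least \<beta>, and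
  neither has its image \<open>M u\<close> under the inverse of \<open>g\<close>; but
  \<open>M u\<close> does have one.\<close>

lemma card_corner_columns_le:
  assumes g: "g \<in> SP l" and M: "M \<in> carrier_mat (2*l) (2*l)" and M': "M' \<in> carrier_mat (2*l) (2*l)"
    and gM: "g * M = M' * g"
    and gL: "\<And>r c. r < 2*l \<Longrightarrow> c < 2*l \<Longrightarrow> g $$ (r, c) \<noteq> 0 \<Longrightarrow> L r \<le> L c"
    and hL: "\<And>r c. r < 2*l \<Longrightarrow> c < 2*l \<Longrightarrow> symp_adj l g $$ (r, c) \<noteq> 0 \<Longrightarrow> L r \<le> L c"
    and uniq: "\<And>r c c'. r < 2*l \<Longrightarrow> c < 2*l \<Longrightarrow> c' < 2*l \<Longrightarrow> M $$ (r, c) \<noteq> 0 \<Longrightarrow> M $$ (r, c') \<noteq> 0 \<Longrightarrow> c = c'"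
  shows "card (corner_columns l L \<alpha> \<beta> M) \<le> card (corner_columns l L \<alpha> \<beta> M')"
proof (rule ccontr)
  let ?T = "corner_columns l L \<alpha> \<beta> M" and ?T' = "corner_columns l L \<alpha> \<beta> M'" and ?h = "symp_adj l g"
  assume "\<not> ?thesis"
  moreover have fin: "finite ?T" "finite ?T'" by (auto simp: corner_columns_def)
  ultimately obtain v where v: "\<exists>t\<in>?T. v t \<noteq> 0" "\<forall>s\<in>?T'. (\<Sum>t\<in>?T. g $$ (s, t) * v t) = 0"
    using underdetermined_system[of ?T' ?T "\<lambda>s t. g $$ (s, t)"] by auto
  have gc: "g \<in> carrier_mat (2*l) (2*l)" using g by (rule SP_carrier)
  have hc: "?h \<in> carrier_mat (2*l) (2*l)" using gc by simp
  define u where "u c = (if c \<in> ?T then v c else 0)" for c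
  have sub: "?T \<subseteq> {..<2*l}" by (auto simp: corner_columns_def)
  have gu: "mapply l g u s = (\<Sum>t\<in>?T. g $$ (s, t) * v t)" if "s < 2*l" for s
  proof -
    have "(\<Sum>t\<in>?T. g $$ (s, t) * v t) = (\<Sum>c<2*l. g $$ (s, c) * u c)"
      by (rule sum.mono_neutral_cong_left) (use sub in \<open>auto simp: u_def\<close>)
    then show ?thesis using that by (simp add: mapply_def)
  qed
  \<comment> \<open>\<open>g\<close> does not raise labels, so \<open>g u\<close> stays within the
    labels up to \<alpha>.\<close>
  have gu0: "mapply l g u s = 0" if s: "s < 2*l" "\<alpha> < L s" for s
  proof -
    have "g $$ (s, t) * v t = 0" if "t \<in> ?T" for t
      using gL[OF s(1), of t] that s(2) by (force simp: corner_columns_def)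
    then show ?thesis unfolding gu[OF s(1)] by (intro sum.neutral) blast
  qed
  define y where "y = mapply l M' (mapply l g u)"
  have y0: "y r = 0" if r: "r < 2*l" "\<beta> \<le> L r" for r
  proof -
    have "M' $$ (r, s) * mapply l g u s = 0" if s: "s < 2*l" for s
    proof (cases "L s \<le> \<alpha> \<and> M' $$ (r, s) \<noteq> 0")
      case True
      then have "s \<in> ?T'" using r s by (auto simp: corner_columns_def)
      then show ?thesis using v(2) gu[OF s] by simp
    next
      case False
      then show ?thesis using gu0[OF s] by fastforce
    qed
    then show ?thesis using r by (auto simp: y_def mapply_def[of l M'] intro!: sum.neutral)
  qed
  have "y = mapply l (g * M) u" unfolding y_def gM by (simp add: mapply_mult[OF M' gc])
  then have "mapply l ?h y = mapply l (?h * g) (mapply l M u)"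
    by (simp add: mapply_mult[OF gc M] mapply_mult[OF hc gc])
  also have "\<dots> = mapply l M u"
    unfolding SP_inverse(1)[OF g] by (rule mapply_one) (simp add: mapply_def)
  finally have hy: "mapply l M u = mapply l ?h y" by simp
  obtain t where t: "t \<in> ?T" "v t \<noteq> 0" using v(1) by blast
  then obtain r where r: "r < 2*l" "\<beta> \<le> L r" "M $$ (r, t) \<noteq> 0" and t2: "t < 2*l" by (auto simp: corner_columns_def)
  have "?h $$ (r, s) * y s = 0" if s: "s < 2*l" for s
  proof (cases "?h $$ (r, s) = 0")
    case False
    then have "\<beta> \<le> L s" using hL[OF r(1) s] r(2) by simp
    then show ?thesis using y0[OF s] by simp
  qed simp
  then have "mapply l ?h y r = 0" using r(1) by (auto simp: mapply_def intro!: sum.neutral)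
  \<comment> \<open>Row \<open>r\<close> of \<open>M\<close> has its only nonzero entry in column
    \<open>t\<close>, so nothing can cancel it.\<close>
  moreover have "mapply l M u r = (\<Sum>c<2*l. if c = t then M $$ (r, t) * v t else 0)"
  proof -
    have "M $$ (r, c) * u c = (if c = t then M $$ (r, t) * v t else 0)" if "c < 2*l" for c
      using uniq[OF r(1) that t2 _ r(3)] t by (auto simp: u_def)
    then show ?thesis using r(1) by (simp add: mapply_def)
  qed
  ultimately show False using hy r t t2 by simp
qed

section \<open>Reading off a pattern from its ranks\<close>

text \<open>The basis vectors are labelled \<open>1, \<dots>, 2 k\<close>, the dual of the vertex \<open>i\<close> being \<open>2 k + 1 - i\<close>.
  An edge contributes a unit in the block with column and row label \<open>edge_corner\<close>, on or above
  the antidiagonal \<open>\<alpha> + \<beta> = 2 k + 1\<close>, and apart from dotted loops the mirror image of this unit.\<close>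

definition flip_vertex :: "nat \<Rightarrow> nat \<Rightarrow> nat" where
  "flip_vertex k i = 2 * k + 1 - i"

fun edge_corner :: "nat \<Rightarrow> esolp_edge \<Rightarrow> nat \<times> nat" where
  "edge_corner k (Arrow i j) = (i, j)"
| "edge_corner k (Loop i) = (i, i)"
| "edge_corner k (Dotted_Arrow i j) = (if i < j then (i, flip_vertex k j) else (flip_vertex k i, j))"
| "edge_corner k (Dotted_Loop Clockwise i) = (i, flip_vertex k i)"
| "edge_corner k (Dotted_Loop Counterclockwise i) = (flip_vertex k i, i)"

fun mirror_corner :: "nat \<Rightarrow> esolp_edge \<Rightarrow> (nat \<times> nat) list" where
  "mirror_corner k (Arrow i j) = [(flip_vertex k j, flip_vertex k i)]"
| "mirror_corner k (Loop i) = [(flip_vertex k i, flip_vertex k i)]"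
| "mirror_corner k (Dotted_Arrow i j) = [if i < j then (j, flip_vertex k i) else (flip_vertex k j, i)]"
| "mirror_corner k (Dotted_Loop c i) = []"

definition unit_corner :: "nat \<Rightarrow> nat list \<Rightarrow> nat \<times> nat \<times> complex \<Rightarrow> nat \<times> nat" where
  "unit_corner l b u = (label l b (fst u), label l b (fst (snd u)))"

lemma label_dual_flip: "s < l \<Longrightarrow> label l b (dual l s) = flip_vertex (length b) (vtx b s)"
  by (simp add: label_dual flip_vertex_def)

lemma corners_edge_units:
  assumes "placed b (e, s, t)" "sum_list b = l"
  shows "map (unit_corner l b) (edge_units l (e, s, t)) = edge_corner (length b) e # mirror_corner (length b) e"
proof -
  have "set (used_positions (e, s, t)) \<subseteq> {..<l}" "map (vtx b) (used_positions (e, s, t)) = edge_vertices e"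
    using assms unfolding placed_iff by auto
  then show ?thesis
    by (cases "(l, e, s, t)" rule: edge_mat.cases) (simp_all add: unit_corner_def label_less label_dual_flip)
qed

text \<open>Whether the column and row labels exceed \<open>k\<close> separates the kinds of edges.
  Being a left inverse of \<open>edge_corner\<close> on well-formed edges, it proves
  injectivity.\<close>

definition corner_edge :: "nat \<Rightarrow> nat \<times> nat \<Rightarrow> esolp_edge" where
  "corner_edge k = (\<lambda>(\<alpha>, \<beta>).
     if \<alpha> \<le> k \<and> \<beta> \<le> k then (if \<alpha> = \<beta> then Loop \<alpha> else Arrow \<alpha> \<beta>)
     else if \<alpha> \<le> k then
       (if \<alpha> = flip_vertex k \<beta> then Dotted_Loop Clockwise \<alpha> else Dotted_Arrow \<alpha> (flip_vertex k \<beta>))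
     else if flip_vertex k \<alpha> = \<beta> then Dotted_Loop Counterclockwise \<beta> else Dotted_Arrow (flip_vertex k \<alpha>) \<beta>)"

lemma corner_edge_corner: "edge_wf k e \<Longrightarrow> corner_edge k (edge_corner k e) = e"
  by (cases "(k, e)" rule: edge_corner.cases) (auto simp: corner_edge_def flip_vertex_def)

lemma edge_corner_eq_iff:
  assumes "edge_wf k e" "edge_wf k e'"
  shows "edge_corner k e' = edge_corner k e \<longleftrightarrow> e' = e"
  using corner_edge_corner[OF assms(1)] corner_edge_corner[OF assms(2)] by metis

text \<open>The convention on the direction of dotted arrows puts their corners on this side.
  Reflection replaces a label sum \<open>s\<close> by \<open>4 * k + 2 - s\<close>, so mirror images
  lie strictly on the other side.\<close>

lemma edge_corner_sum_le: "edge_wf k e \<Longrightarrow> fst (edge_corner k e) + snd (edge_corner k e) \<le> 2 * k + 1"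
  by (cases "(k, e)" rule: edge_corner.cases) (auto simp: flip_vertex_def)

lemma mirror_corner_sum_gt:
  "edge_wf k e \<Longrightarrow> c \<in> set (mirror_corner k e) \<Longrightarrow> 2 * k + 1 < fst c + snd c"
  by (cases "(k, e)" rule: edge_corner.cases) (auto simp: flip_vertex_def)

lemma mirror_corner_neq:
  assumes "edge_wf k e" "edge_wf k e'"
  shows "edge_corner k e \<notin> set (mirror_corner k e')"
  using edge_corner_sum_le[OF assms(1)] mirror_corner_sum_gt[OF assms(2)] by fastforce

lemma edge_units_corner:
  assumes "placed b (e', s, t)" "edge_wf (length b) e'" "sum_list b = l" "edge_wf (length b) e"
  shows "length (filter (\<lambda>u. unit_corner l b u = edge_corner (length b) e) (edge_units l (e', s, t))) = (if e' = e then 1 else 0)"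
proof -
  have "length (filter (\<lambda>u. unit_corner l b u = edge_corner (length b) e) us) =
    count_list (map (unit_corner l b) us) (edge_corner (length b) e)" for us
    by (induction us) auto
  then have "length (filter (\<lambda>u. unit_corner l b u = edge_corner (length b) e) (edge_units l (e', s, t))) =
      count_list (edge_corner (length b) e' # mirror_corner (length b) e') (edge_corner (length b) e)"
    unfolding corners_edge_units[OF assms(1,3), symmetric] .
  then show ?thesis
    using edge_corner_eq_iff[OF assms(4,2)] count_notin[OF mirror_corner_neq[OF assms(4,2)]] by auto
qed

text \<open>No mirror image lies in an \<open>edge_corner\<close> cell and different edges have
  different cells, so every copy of \<open>e\<close> is seen exactly once.\<close>

lemma count_edges_corner:
  assumes "placement l b qs" and l: "sum_list b = l" and e: "edge_wf (length b) e"
  shows "count (mset (map fst qs)) e =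
    length (filter (\<lambda>u. unit_corner l b u = edge_corner (length b) e) (pattern_units l qs))"
proof -
  have "\<forall>q\<in>set qs. placed b q \<and> edge_wf (length b) (fst q)" using assms(1) by (auto simp: placement_def)
  then show ?thesis
  proof (induction qs)
    case (Cons q qs)
    obtain e' s t where q: "q = (e', s, t)" by (cases q) auto
    have "placed b (e', s, t)" "edge_wf (length b) e'" using Cons.prems q by auto
    note head = edge_units_corner[OF this l e]
    have tail: "count (mset (map fst qs)) e =
        length (filter (\<lambda>u. unit_corner l b u = edge_corner (length b) e) (pattern_units l qs))"
      using Cons.IH Cons.prems by simp
    have "pattern_units l (q # qs) = edge_units l (e', s, t) @ pattern_units l qs"
      by (simp add: pattern_units_def q)
    then show ?case using tail by (simp only: filter_append length_append head) (simp add: q)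
  qed (simp add: pattern_units_def)
qed

text \<open>A single cell is a second difference of quadrant counts, written additively because
  subtraction on \<open>nat\<close> truncates; \<open>1 \<le> \<alpha>\<close> keeps
  \<open>\<alpha> - 1\<close> a true predecessor.\<close>

lemma corner_count_eq:
  fixes us :: "'a list" and C :: "'a \<Rightarrow> nat \<times> nat"
  assumes "1 \<le> \<alpha>"
  defines "N \<equiv> \<lambda>\<alpha> \<beta>. length (filter (\<lambda>u. fst (C u) \<le> \<alpha> \<and> \<beta> \<le> snd (C u)) us)"
  shows "length (filter (\<lambda>u. C u = (\<alpha>, \<beta>)) us) + N (\<alpha> - 1) \<beta> + N \<alpha> (Suc \<beta>) = N \<alpha> \<beta> + N (\<alpha> - 1) (Suc \<beta>)"
  unfolding N_def
proof (induction us)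
  case (Cons u us)
  have *: "(if C u = (\<alpha>, \<beta>) then 1 else 0) + (if fst (C u) \<le> \<alpha> - 1 \<and> \<beta> \<le> snd (C u) then 1 else 0)
     + (if fst (C u) \<le> \<alpha> \<and> Suc \<beta> \<le> snd (C u) then 1 else 0) =
     (if fst (C u) \<le> \<alpha> \<and> \<beta> \<le> snd (C u) then 1 else 0)
     + (if fst (C u) \<le> \<alpha> - 1 \<and> Suc \<beta> \<le> snd (C u) then 1 else (0::nat))"
    using assms(1) by (cases "C u") auto
  have len: "length (filter P (u # us)) = (if P u then 1 else 0) + length (filter P us)" for P by simp
  have "x + x' + (y + y') + (z + z') = v + v' + (w + w')"
    if "x + y + z = v + w" "x' + y' + z' = v' + w'" for x x' y y' z z' v v' w w' :: nat
    using that by simp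
  from this[OF * Cons.IH] show ?case unfolding len .
qed simp

lemma card_corner_columns_pattern:
  assumes pos: "set (positions qs) \<subseteq> {..<l}" and dist: "distinct (positions qs)"
  shows "card (corner_columns l L \<alpha> \<beta> (pattern_mat l qs)) =
    length (filter (\<lambda>u. L (fst u) \<le> \<alpha> \<and> \<beta> \<le> L (fst (snd u))) (pattern_units l qs))"
proof -
  let ?us = "filter (\<lambda>u. L (fst u) \<le> \<alpha> \<and> \<beta> \<le> L (fst (snd u))) (pattern_units l qs)"
  have "corner_columns l L \<alpha> \<beta> (pattern_mat l qs) = set (map fst ?us)"
  proof (intro equalityI subsetI)
    fix c assume "c \<in> corner_columns l L \<alpha> \<beta> (pattern_mat l qs)"
    then obtain r where c: "c < 2*l" "L c \<le> \<alpha>" "r < 2*l" "\<beta> \<le> L r" "pattern_mat l qs $$ (r, c) \<noteq> 0"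
      by (auto simp: corner_columns_def)
    obtain z where "(c, r, z) \<in> set (pattern_units l qs)" using pattern_mat_nonzero[OF pos dist c(3,1,5)] .
    then show "c \<in> set (map fst ?us)" using c by force
  next
    fix c assume "c \<in> set (map fst ?us)"
    then obtain r z where u: "(c, r, z) \<in> set (pattern_units l qs)" "L c \<le> \<alpha>" "\<beta> \<le> L r" by auto
    have "pattern_mat l qs $$ (r, c) \<noteq> 0"
      using pattern_mat_unit[OF pos dist u(1)] unit_nonzero[OF pos dist u(1)] by simp
    then show "c \<in> corner_columns l L \<alpha> \<beta> (pattern_mat l qs)"
      using units_less[OF pos dist u(1)] u by (auto simp: corner_columns_def)
  qed
  moreover have "distinct (map fst ?us)" using distinct_columns[OF pos dist] by (rule distinct_map_filter)
  ultimately show ?thesis using distinct_card[of "map fst ?us"] by simp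
qed

text \<open>This is what the classification uses of \<open>P\<close>: the Borel subgroup for the
  reduction, the Levi subgroup for splitting pairs and moving placements, and block upper
  triangularity for the invariants. Flags enter only when these properties are verified.\<close>

locale adapted_parabolic =
  fixes l :: nat and b :: "nat list" and P :: "complex mat set"
  assumes sum_b: "sum_list b = l"
    and subgroup_P: "subgroup P (SP_group l)"
    and Borel_P: "Borel l \<subseteq> P"
    and P_upper: "\<And>g r c. g \<in> P \<Longrightarrow> r < 2*l \<Longrightarrow> c < 2*l \<Longrightarrow> g $$ (r, c) \<noteq> 0 \<Longrightarrow> label l b r \<le> label l b c"
    and P_Levi: "\<And>g. g \<in> SP l \<Longrightarrow> (\<And>r c. r < 2*l \<Longrightarrow> c < 2*l \<Longrightarrow> g $$ (r, c) \<noteq> 0 \<Longrightarrow> label l b r = label l b c) \<Longrightarrow> g \<in> P"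
begin

lemma P_SP: "g \<in> P \<Longrightarrow> g \<in> SP l"
  using subgroup.subset[OF subgroup_P] by auto

lemma placementD:
  assumes "placement l b qs"
  shows "set (positions qs) \<subseteq> {..<l}" "distinct (positions qs)"
  using assms placed_positions(1)[of qs b] sum_b by (auto simp: placement_def)

lemma pattern_mat_row_unique:
  assumes "placement l b qs" "r < 2*l" "c < 2*l" "c' < 2*l"
    "pattern_mat l qs $$ (r, c) \<noteq> 0" "pattern_mat l qs $$ (r, c') \<noteq> 0"
  shows "c = c'"
proof -
  note pd = placementD[OF assms(1)]
  obtain z z' where "(c, r, z) \<in> set (pattern_units l qs)" "(c', r, z') \<in> set (pattern_units l qs)"
    using pattern_mat_nonzero[OF pd assms(2,3,5)] pattern_mat_nonzero[OF pd assms(2,4,6)] by metis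
  then have "(c, r, z) = (c', r, z')"
    using distinct_rows[OF pd] unfolding distinct_map inj_on_def by (metis fst_conv snd_conv)
  then show ?thesis by simp
qed

lemma card_corner_columns_conj:
  assumes q: "placement l b qs" and M: "conj_by l P (pattern_mat l qs) M"
  shows "card (corner_columns l (label l b) \<alpha> \<beta> (pattern_mat l qs)) \<le> card (corner_columns l (label l b) \<alpha> \<beta> M)"
proof -
  obtain g where g: "g \<in> P" "g * pattern_mat l qs = M * g" and Mc: "M \<in> carrier_mat (2*l) (2*l)"
    using M by (auto simp: conj_by_def)
  have "symp_adj l g \<in> P" using subgroup.m_inv_closed[OF subgroup_P g(1)] inv_SP[OF P_SP[OF g(1)]] by simp
  then show ?thesis
    using card_corner_columns_le[OF P_SP[OF g(1)] pattern_mat_carrier Mc g(2), of "label l b" \<alpha> \<beta>]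
      P_upper pattern_mat_row_unique[OF q] g(1) by blast
qed

lemma conj_placements_mset_eq:
  assumes q1: "placement l b qs1" and q2: "placement l b qs2"
    and conj: "conj_by l P (pattern_mat l qs1) (pattern_mat l qs2)"
  shows "mset (map fst qs1) = mset (map fst qs2)"
proof (rule multiset_eqI)
  fix e
  note pd = placementD[OF q1] placementD[OF q2]
  let ?N = "\<lambda>qs \<alpha> \<beta>. length (filter (\<lambda>u. fst (unit_corner l b u) \<le> \<alpha> \<and> \<beta> \<le> snd (unit_corner l b u)) (pattern_units l qs))"
  \<comment> \<open>Conjugacy is symmetric, so the one-sided estimate applies in both
    directions.\<close>
  have N: "?N qs1 \<alpha> \<beta> = ?N qs2 \<alpha> \<beta>" for \<alpha> \<beta>
    using card_corner_columns_conj[OF q1 conj, of \<alpha> \<beta>]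
      card_corner_columns_conj[OF q2 conj_by_sym[OF subgroup_P pattern_mat_carrier conj], of \<alpha> \<beta>]
    unfolding card_corner_columns_pattern[OF pd(1,2)] card_corner_columns_pattern[OF pd(3,4)]
    by (simp add: unit_corner_def)
  show "count (mset (map fst qs1)) e = count (mset (map fst qs2)) e"
  proof (cases "edge_wf (length b) e")
    case True
    obtain \<alpha> \<beta> where k: "edge_corner (length b) e = (\<alpha>, \<beta>)" by fastforce
    have \<alpha>: "1 \<le> \<alpha>" using True k by (cases "(length b, e)" rule: edge_corner.cases) (auto simp: flip_vertex_def split: if_splits)
    show ?thesis
      unfolding count_edges_corner[OF q1 sum_b True] count_edges_corner[OF q2 sum_b True] k
      using corner_count_eq[OF \<alpha>, of "unit_corner l b" \<beta> "pattern_units l qs1"]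
        corner_count_eq[OF \<alpha>, of "unit_corner l b" \<beta> "pattern_units l qs2"] N by simp
  next
    case False
    then have "e \<notin> set (map fst qs1)" "e \<notin> set (map fst qs2)"
      using q1 q2 by (auto simp: placement_def)
    then show ?thesis by (metis count_mset_0_iff)
  qed
qed

end

section \<open>Reduction to a pattern\<close>

lemma ex_loop_edge:
  assumes b: "sum_list b = l" and j: "j < 2*l"
  obtains q where "placed b q" "edge_wf (length b) (fst q)" "used_positions q = [base l j]"
    "\<And>r c. r < 2*l \<Longrightarrow> c < 2*l \<Longrightarrow> edge_mat l q $$ (r, c) = (if r = dual l j \<and> c = j then 1 else 0)"
proof -
  have bl: "base l j < l" using base_less[OF j] .
  define ori where "ori = (if j < l then Clockwise else Counterclockwise)"
  define q where "q = (Dotted_Loop ori (vtx b (base l j)), base l j, base l j)"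
  have "placed b q" unfolding q_def placed_iff using bl b by simp
  moreover have "edge_wf (length b) (fst q)" using vtx_bounds[of "base l j" b] bl b by (simp add: q_def)
  moreover have "used_positions q = [base l j]" by (simp add: q_def)
  moreover have "edge_mat l q $$ (r, c) = (if r = dual l j \<and> c = j then 1 else 0)" if "r < 2*l" "c < 2*l" for r c
    using that j by (cases "j < l") (simp_all add: q_def ori_def base_def unit_map_index)
  ultimately show thesis using that by blast
qed

text \<open>The halves containing \<open>j\<close> and \<open>p\<close> decide the kind of edge:
  equal halves give a dotted arrow, different halves an undotted arrow or loop. The last hypothesis
  excludes a dotted arrow inside one block.\<close>

lemma ex_pair_edge:
  assumes b: "sum_list b = l" and j: "j < p" and p: "p < 2*l" "p \<noteq> dual l j"
    and ne: "(j < l \<longleftrightarrow> p < l) \<Longrightarrow> vtx b (base l j) \<noteq> vtx b (base l p)"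
  obtains q where "placed b q" "edge_wf (length b) (fst q)" "used_positions q = [base l j, base l p]"
    "\<And>r c. r < 2*l \<Longrightarrow> c < 2*l \<Longrightarrow> edge_mat l q $$ (r, c) =
       (if r = dual l p \<and> c = j then 1 else 0) + (if r = dual l j \<and> c = p then eps l p * eps l j else 0)"
proof -
  have j2: "j < 2*l" using j p by simp
  have bl: "base l j < l" "base l p < l" using base_less[OF j2] base_less[OF p(1)] by auto
  have vb: "vtx b (base l j) \<in> {1..length b}" "vtx b (base l p) \<in> {1..length b}"
    using vtx_bounds bl b by auto
  consider "p < l" | "j < l" "\<not> p < l" | "\<not> j < l" using j by linarith
  then show thesis
  proof cases
    case 1
    then have jl: "j < l" using j by simp
    have "vtx b j \<le> vtx b p" using vtx_mono[of j p b] j 1 b by simp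
    then have lt: "vtx b j < vtx b p" using ne jl 1 by (simp add: base_def)
    show thesis
    proof (rule that[of "(Dotted_Arrow (vtx b j) (vtx b p), j, p)"])
      show "placed b (Dotted_Arrow (vtx b j) (vtx b p), j, p)" unfolding placed_iff using jl 1 b by simp
      show "edge_wf (length b) (fst (Dotted_Arrow (vtx b j) (vtx b p), j, p))"
        using vb lt jl 1 by (simp add: base_def)
      show "used_positions (Dotted_Arrow (vtx b j) (vtx b p), j, p) = [base l j, base l p]"
        using jl 1 by (simp add: base_def)
      fix r c assume "r < 2*l" "c < 2*l"
      then show "edge_mat l (Dotted_Arrow (vtx b j) (vtx b p), j, p) $$ (r, c) =
          (if r = dual l p \<and> c = j then 1 else 0) + (if r = dual l j \<and> c = p then eps l p * eps l j else 0)"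
        using lt jl 1 by (simp add: unit_map_index eps_def)
    qed
  next
    case 2
    let ?i = "vtx b j" and ?k = "vtx b (dual l p)"
    have d: "dual l p < l" using 2 p by (auto simp: dual_def)
    define e where "e = (if ?i = ?k then Loop ?i else Arrow ?i ?k)"
    show thesis
    proof (rule that[of "(e, j, dual l p)"])
      show "placed b (e, j, dual l p)" unfolding placed_iff using 2 d b by (simp add: e_def)
      show "edge_wf (length b) (fst (e, j, dual l p))"
        using vb 2 by (simp add: base_def e_def)
      show "used_positions (e, j, dual l p) = [base l j, base l p]"
        using 2 by (simp add: base_def e_def)
      fix r c assume rc: "r < 2*l" "c < 2*l"
      have "edge_mat l (e, j, dual l p) $$ (r, c) = unit_map l j (dual l p) $$ (r, c) - unit_map l p (dual l j) $$ (r, c)"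
        using rc p by (simp add: e_def)
      then show "edge_mat l (e, j, dual l p) $$ (r, c) =
          (if r = dual l p \<and> c = j then 1 else 0) + (if r = dual l j \<and> c = p then eps l p * eps l j else 0)"
        using 2 rc by (simp add: unit_map_index eps_def)
    qed
  next
    case 3
    then have pl: "\<not> p < l" using j by simp
    let ?s = "dual l j" and ?t = "dual l p"
    \<comment> \<open>Duality reverses the order of positions, so the source now has the larger
      vertex, which selects the second branch of the dotted arrow in
      \<open>edge_mat\<close>.\<close>
    have d: "?s < l" "?t < l" "?t \<le> ?s" using 3 pl p j2 j by (auto simp: dual_def)
    have "vtx b ?t \<le> vtx b ?s" using vtx_mono[of ?t ?s b] d b by simp
    then have lt: "\<not> vtx b ?s < vtx b ?t" "vtx b ?s \<noteq> vtx b ?t" using ne 3 pl by (simp_all add: base_def)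
    show thesis
    proof (rule that[of "(Dotted_Arrow (vtx b ?s) (vtx b ?t), ?s, ?t)"])
      show "placed b (Dotted_Arrow (vtx b ?s) (vtx b ?t), ?s, ?t)" unfolding placed_iff using d b by simp
      show "edge_wf (length b) (fst (Dotted_Arrow (vtx b ?s) (vtx b ?t), ?s, ?t))"
        using vb lt 3 pl by (simp add: base_def)
      show "used_positions (Dotted_Arrow (vtx b ?s) (vtx b ?t), ?s, ?t) = [base l j, base l p]"
        using 3 pl by (simp add: base_def)
      fix r c assume rc: "r < 2*l" "c < 2*l"
      have "edge_mat l (Dotted_Arrow (vtx b ?s) (vtx b ?t), ?s, ?t) $$ (r, c) =
          unit_map l j ?t $$ (r, c) + unit_map l p ?s $$ (r, c)"
        using lt rc p j2 by simp
      then show "edge_mat l (Dotted_Arrow (vtx b ?s) (vtx b ?t), ?s, ?t) $$ (r, c) =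
          (if r = dual l p \<and> c = j then 1 else 0) + (if r = dual l j \<and> c = p then eps l p * eps l j else 0)"
        using 3 pl rc by (simp add: unit_map_index eps_def)
    qed
  qed
qed

text \<open>The invariant of the reduction: columns at covered positions have reached their final
  form, while the other columns of \<open>x\<close> are arbitrary.\<close>

definition agrees_on_covered :: "nat \<Rightarrow> (esolp_edge \<times> nat \<times> nat) list \<Rightarrow> complex mat \<Rightarrow> bool" where
  "agrees_on_covered l qs x \<longleftrightarrow>
    (\<forall>c\<in>covered l qs. \<forall>r<2*l. x $$ (r, c) = pattern_mat l qs $$ (r, c))"

lemma covered_Cons: "covered l (q # qs) = {c. c < 2*l \<and> base l c \<in> set (used_positions q)} \<union> covered l qs"
  by (auto simp: covered_def positions_def)

context adapted_parabolic
begin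

lemma add_edge:
  assumes qs: "placement l b qs" "agrees_on_covered l qs x"
    and q: "placed b q" "edge_wf (length b) (fst q)" "distinct (used_positions q)"
      "set (used_positions q) \<inter> set (positions qs) = {}"
    and x: "\<And>r c. r < 2*l \<Longrightarrow> c < 2*l \<Longrightarrow> base l c \<in> set (used_positions q) \<Longrightarrow> x $$ (r, c) = edge_mat l q $$ (r, c)"
  shows "placement l b (q # qs)" "agrees_on_covered l (q # qs) x"
proof -
  show "placement l b (q # qs)" using qs(1) q by (auto simp: placement_def positions_def)
  have q1: "placement l b [q]" using q by (simp add: placement_def positions_def)
  note pd = placementD[OF qs(1)] and pd1 = placementD[OF q1]
  show "agrees_on_covered l (q # qs) x"
    unfolding agrees_on_covered_def
  proof (intro ballI allI impI)
    fix c r assume c: "c \<in> covered l (q # qs)" and r: "r < 2*l"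
    have c2: "c < 2*l" using c by (simp add: covered_def)
    show "x $$ (r, c) = pattern_mat l (q # qs) $$ (r, c)"
    proof (cases "c \<in> covered l qs")
      case True
      then have "c \<notin> covered l [q]" using q(4) by (auto simp: covered_def positions_def)
      then have "pattern_mat l [q] $$ (r, c) = 0" using pattern_mat_uncovered[OF pd1 c2 r] by simp
      then have "edge_mat l q $$ (r, c) = 0" using c2 r by simp
      then show ?thesis using qs(2) True c2 r by (simp add: agrees_on_covered_def)
    next
      case False
      then have "base l c \<in> set (used_positions q)" using c by (simp add: covered_Cons)
      then show ?thesis using x[OF r c2] pattern_mat_uncovered[OF pd c2 r False] c2 r by simp
    qed
  qed
qed

lemma reduced_on_agrees:
  assumes "placement l b qs" "agrees_on_covered l qs x"
  shows "reduced_on l (covered l qs) x"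
  using reduced_on_covered[OF placementD[OF assms(1)]] assms(2) by (auto simp: agrees_on_covered_def)

lemma uncovered_position: "a < 2*l \<Longrightarrow> a \<notin> covered l qs \<Longrightarrow> base l a \<notin> set (positions qs)"
  by (simp add: covered_def)

lemma agrees_on_covered_cong:
  assumes "agrees_on_covered l qs x" "\<And>c r. c \<in> covered l qs \<Longrightarrow> r < 2*l \<Longrightarrow> x' $$ (r, c) = x $$ (r, c)"
  shows "agrees_on_covered l qs x'"
  using assms by (simp add: agrees_on_covered_def)

lemma extend_by_loop:
  assumes qs: "placement l b qs" "agrees_on_covered l qs x" and j: "j < 2*l" "j \<notin> covered l qs"
    and cols: "\<And>r. r < 2*l \<Longrightarrow> x $$ (r, j) = (if r = dual l j then 1 else 0)"
      "\<And>r. r < 2*l \<Longrightarrow> x $$ (r, dual l j) = 0"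
  obtains qs' where "placement l b qs'" "agrees_on_covered l qs' x"
    "covered l qs' = covered l qs \<union> {j, dual l j}"
proof -
  obtain q where q: "placed b q" "edge_wf (length b) (fst q)" "used_positions q = [base l j]"
    "\<And>r c. r < 2*l \<Longrightarrow> c < 2*l \<Longrightarrow> edge_mat l q $$ (r, c) = (if r = dual l j \<and> c = j then 1 else 0)"
    using ex_loop_edge[OF sum_b j(1)] by blast
  have c: "c = j \<or> c = dual l j" if "c < 2*l" "base l c \<in> set (used_positions q)" for c
    using that q(3) base_eq_iff[OF that(1) j(1)] by auto
  have "covered l (q # qs) = covered l qs \<union> {j, dual l j}"
    unfolding covered_Cons using c j q(3) by auto
  moreover have "x $$ (r, c) = edge_mat l q $$ (r, c)"
    if "r < 2*l" "c < 2*l" "base l c \<in> set (used_positions q)" for r c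
    using c[OF that(2,3)] q(4)[OF that(1,2)] cols that(1) j(1) by auto
  moreover have "set (used_positions q) \<inter> set (positions qs) = {}" "distinct (used_positions q)"
    using q(3) uncovered_position[OF j] by auto
  ultimately show thesis using that add_edge[OF qs q(1,2)] by blast
qed

lemma extend_by_pair:
  assumes qs: "placement l b qs" "agrees_on_covered l qs x" and j: "j < p" "j \<notin> covered l qs"
    and p: "p < 2*l" "p \<noteq> dual l j" "p \<notin> covered l qs"
    and ne: "(j < l \<longleftrightarrow> p < l) \<Longrightarrow> vtx b (base l j) \<noteq> vtx b (base l p)"
    and cols: "\<And>r. r < 2*l \<Longrightarrow> x $$ (r, j) = (if r = dual l p then 1 else 0)"
      "\<And>r. r < 2*l \<Longrightarrow> x $$ (r, p) = (if r = dual l j then eps l p * eps l j else 0)"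
      "\<And>r. r < 2*l \<Longrightarrow> x $$ (r, dual l p) = 0" "\<And>r. r < 2*l \<Longrightarrow> x $$ (r, dual l j) = 0"
  obtains qs' where "placement l b qs'" "agrees_on_covered l qs' x"
    "covered l qs' = covered l qs \<union> {j, dual l j, p, dual l p}"
proof -
  have j2: "j < 2*l" using j p by simp
  have neq: "j \<noteq> p" "j \<noteq> dual l p" "dual l j \<noteq> p" "dual l j \<noteq> j" "dual l p \<noteq> p" "dual l p \<noteq> j"
    using j(1) j2 p(1,2) by auto
  obtain q where q: "placed b q" "edge_wf (length b) (fst q)" "used_positions q = [base l j, base l p]"
    "\<And>r c. r < 2*l \<Longrightarrow> c < 2*l \<Longrightarrow> edge_mat l q $$ (r, c) =
       (if r = dual l p \<and> c = j then 1 else 0) + (if r = dual l j \<and> c = p then eps l p * eps l j else 0)"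
    using ex_pair_edge[OF sum_b j(1) p(1,2) ne] by blast
  have c: "c = j \<or> c = dual l j \<or> c = p \<or> c = dual l p" if "c < 2*l" "base l c \<in> set (used_positions q)" for c
    using that q(3) base_eq_iff[OF that(1) j2] base_eq_iff[OF that(1) p(1)] by auto
  have "covered l (q # qs) = covered l qs \<union> {j, dual l j, p, dual l p}"
    unfolding covered_Cons using c j2 p(1) q(3) by auto
  moreover have "x $$ (r, c) = edge_mat l q $$ (r, c)"
    if "r < 2*l" "c < 2*l" "base l c \<in> set (used_positions q)" for r c
    using c[OF that(2,3)] unfolding q(4)[OF that(1,2)]
  proof (elim disjE)
  qed (use cols[OF that(1)] neq in simp_all)
  moreover have "base l j \<noteq> base l p" using base_eq_iff[OF j2 p(1)] neq by auto
  then have "distinct (used_positions q)" using q(3) by simp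
  moreover have "set (used_positions q) \<inter> set (positions qs) = {}"
    using q(3) uncovered_position[OF j2 j(2)] uncovered_position[OF p(1,3)] by auto
  ultimately show thesis using that add_edge[OF qs q(1,2)] by blast
qed

text \<open>The pivot: the first column that is not yet in normal form, and the first vector of the basis
  that pairs with its image. Nilpotency excludes that the two vectors are dual.\<close>

lemma pivot:
  assumes x: "x \<in> N2 l" and D: "reduced_on l D x" and nz: "\<exists>c<2*l. c \<notin> D \<and> (\<exists>r<2*l. x $$ (r, c) \<noteq> 0)"
  obtains j p where "j \<le> p" "p < 2*l" "p \<noteq> dual l j" "j \<notin> D" "p \<notin> D"
    "form l (ebas j) (mapply l x (ebas p)) \<noteq> 0"
    "\<And>a. a < p \<Longrightarrow> form l (ebas a) (mapply l x (ebas j)) = 0"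
    "\<And>a. a < j \<Longrightarrow> form l (ebas a) (mapply l x (ebas p)) = 0"
proof -
  let ?B = "\<lambda>a c. form l (ebas a) (mapply l x (ebas c))"
  have sym: "?B a c = ?B c a" for a c by (rule form_mapply_sym[OF x])
  define J where "J c \<longleftrightarrow> c < 2*l \<and> c \<notin> D \<and> (\<exists>r<2*l. x $$ (r, c) \<noteq> 0)" for c
  define j where "j = (LEAST c. J c)"
  have "\<exists>c. J c" using nz by (auto simp: J_def)
  then have "J j" unfolding j_def by (rule LeastI_ex)
  then obtain r0 where j: "j < 2*l" "j \<notin> D" and r0: "r0 < 2*l" "x $$ (r0, j) \<noteq> 0" by (auto simp: J_def)
  have minj: "x $$ (r, a) = 0" if "a < j" "a \<notin> D" "r < 2*l" for a r
  proof (rule ccontr)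
    assume "x $$ (r, a) \<noteq> 0"
    then have "J a" using that j by (auto simp: J_def)
    then have "j \<le> a" unfolding j_def by (rule Least_le)
    then show False using that by simp
  qed
  define p where "p = (LEAST a. a < 2*l \<and> ?B a j \<noteq> 0)"
  have "?B (dual l r0) j \<noteq> 0" using r0 j by (simp add: form_ebas_mapply)
  then have "\<exists>a. a < 2*l \<and> ?B a j \<noteq> 0" using dual_less[OF r0(1)] by blast
  then have p: "p < 2*l \<and> ?B p j \<noteq> 0" unfolding p_def by (rule LeastI_ex)
  have minp: "?B a j = 0" if "a < p" for a
  proof (rule ccontr)
    assume "?B a j \<noteq> 0"
    then have "a < 2*l \<and> ?B a j \<noteq> 0" using that p by simp
    then have "p \<le> a" unfolding p_def by (rule Least_le)
    then show False using that by simp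
  qed
  have pD: "p \<notin> D" using form_mapply_reduced[OF x D _ j(2,1), of p] p by blast
  \<comment> \<open>Outside \<open>D\<close> the columns before \<open>j\<close> are zero; inside
    \<open>D\<close> the pairing with an index outside \<open>D\<close> vanishes.\<close>
  have Bz: "?B c a = 0" if "a < j" "c \<notin> D" "c < 2*l" for a c
  proof (cases "a \<in> D")
    case True
    then show ?thesis using form_mapply_reduced[OF x D True that(2,3)] sym by simp
  next
    case False
    then show ?thesis using minj[OF that(1) False] that j by (simp add: form_ebas_mapply)
  qed
  have jp: "j \<le> p" using Bz[of p j] p j sym[of p j] by (metis not_le)
  have "p \<noteq> dual l j"
  proof
    assume pj: "p = dual l j"
    have jj: "x $$ (j, j) \<noteq> 0" using p j pj by (simp add: form_ebas_mapply)
    \<comment> \<open>Row \<open>j\<close> vanishes left of the diagonal by the choice of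
      \<open>j\<close>, and column \<open>j\<close> vanishes below it by the choice of
      \<open>p\<close>. The diagonal entry of the square is then the square of a nonzero
      entry.\<close>
    have "x $$ (j, k) * x $$ (k, j) = (if k = j then x $$ (j, j) * x $$ (j, j) else 0)" if k: "k < 2*l" for k
    proof -
      have "x $$ (j, k) = 0" if "k < j"
      proof -
        have "dual l j \<notin> D" using pD pj by simp
        then have "?B (dual l j) k = 0" using Bz[OF that] j by simp
        then show ?thesis using j k by (simp add: form_ebas_mapply)
      qed
      moreover have "x $$ (k, j) = 0" if "j < k"
      proof -
        have "dual l k < p" using that j k pj by simp
        from minp[OF this] show ?thesis using j k by (simp add: form_ebas_mapply)
      qed
      ultimately show ?thesis by (cases k j rule: linorder_cases) auto
    qed
    then have "(\<Sum>k<2*l. x $$ (j, k) * x $$ (k, j)) = (\<Sum>k<2*l. if k = j then x $$ (j, j) * x $$ (j, j) else 0)"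
      by (intro sum.cong) auto
    also have "\<dots> = x $$ (j, j) * x $$ (j, j)" using j by simp
    finally have "x $$ (j, j) * x $$ (j, j) = 0" using x j N2_iff_index[OF N2_carrier[OF x]] by auto
    then show False using jj by simp
  qed
  moreover have "?B a p = 0" if "a < j" for a using Bz[OF that pD] p sym[of a p] by simp
  ultimately show thesis using that[of j p] jp p j(2) pD minp sym[of j p] by auto
qed

text \<open>Induction on the number of uncovered positions. If no uncovered column is nonzero,
  \<open>x\<close> is itself a pattern matrix; otherwise the pivot covers at least one more dual
  pair.\<close>

lemma ex_conj_pattern:
  assumes "x \<in> N2 l" "placement l b qs" "agrees_on_covered l qs x"
  shows "\<exists>qs'. placement l b qs' \<and> conj_by l P x (pattern_mat l qs')"
  using assms
proof (induction "card ({..<2*l} - covered l qs)" arbitrary: x qs rule: less_induct)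
  case less
  note x = less.prems(1) and qs = less.prems(2) and agree = less.prems(3)
  note red = reduced_on_agrees[OF qs agree]
  let ?D = "covered l qs"
  have xc: "x \<in> carrier_mat (2*l) (2*l)" using x by (rule N2_carrier)
  have step: "\<exists>qs'. placement l b qs' \<and> conj_by l P x (pattern_mat l qs')"
    if "g \<in> P" "x' \<in> N2 l" "g * x' = x * g" "placement l b qs'" "agrees_on_covered l qs' x'"
      "covered l qs' = ?D \<union> E" "j \<in> E" "j < 2*l" "j \<notin> ?D" for g x' qs' E j
  proof -
    have "{..<2*l} - covered l qs' \<subset> {..<2*l} - ?D" using that(6-9) by auto
    then have "card ({..<2*l} - covered l qs') < card ({..<2*l} - ?D)" by (intro psubset_card_mono) auto
    from less.hyps[OF this that(2,4,5)] obtain qs'' where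
      qs'': "placement l b qs''" "conj_by l P x' (pattern_mat l qs'')" by blast
    have "conj_by l P x' x" using that(1,3) xc by (auto simp: conj_by_def)
    then have "conj_by l P x x'" using conj_by_sym[OF subgroup_P N2_carrier[OF that(2)]] by blast
    then show ?thesis using conj_by_trans[OF subgroup_P xc _ qs''(2)] qs''(1) by blast
  qed
  show ?case
  proof (cases "\<exists>c<2*l. c \<notin> ?D \<and> (\<exists>r<2*l. x $$ (r, c) \<noteq> 0)")
    case False
    have "x = pattern_mat l qs"
    proof (rule eq_matI)
      fix r c assume "r < dim_row (pattern_mat l qs)" "c < dim_col (pattern_mat l qs)"
      then have rc: "r < 2*l" "c < 2*l" by auto
      show "x $$ (r, c) = pattern_mat l qs $$ (r, c)"
        using agree False rc pattern_mat_uncovered[OF placementD[OF qs] rc(2,1)]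
        by (cases "c \<in> ?D") (auto simp: agrees_on_covered_def)
    qed (use xc in auto)
    then show ?thesis using qs conj_by_refl[OF subgroup_P xc] by auto
  next
    case True
    obtain j p where jp: "j \<le> p" "p < 2*l" "p \<noteq> dual l j" "j \<notin> ?D" "p \<notin> ?D"
      "form l (ebas j) (mapply l x (ebas p)) \<noteq> 0"
      "\<And>a. a < p \<Longrightarrow> form l (ebas a) (mapply l x (ebas j)) = 0"
      "\<And>a. a < j \<Longrightarrow> form l (ebas a) (mapply l x (ebas p)) = 0"
      by (rule pivot[OF x red True]) (assumption | (rule that; assumption))+
    have j2: "j < 2*l" using jp by simp
    show ?thesis
    proof (cases "p = j")
      case True
      note jp' = jp[unfolded True]
      obtain g x' where g: "g \<in> Borel l" "x' \<in> N2 l" "g * x' = x * g"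
        "\<And>r. r < 2*l \<Longrightarrow> x' $$ (r, j) = (if r = dual l j then 1 else 0)"
        "\<And>r. r < 2*l \<Longrightarrow> x' $$ (r, dual l j) = 0"
        "\<And>c r. c \<in> ?D \<Longrightarrow> r < 2*l \<Longrightarrow> x' $$ (r, c) = x $$ (r, c)"
        by (rule loop_step[OF x j2 red jp(4) jp'(6,7)]) (assumption | (rule that; assumption))+
      obtain qs' where "placement l b qs'" "agrees_on_covered l qs' x'" "covered l qs' = ?D \<union> {j, dual l j}"
        by (rule extend_by_loop[OF qs agrees_on_covered_cong[OF agree g(6)] j2 jp(4) g(4,5)]) (assumption | (rule that; assumption))+
      then show ?thesis using step[of g x'] g(1-3) Borel_P j2 jp(4) by blast
    next
      case False
      then have lt: "j < p" using jp(1) by simp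
      obtain g x' where g: "g \<in> Borel l" "x' \<in> N2 l" "g * x' = x * g"
        "\<And>r. r < 2*l \<Longrightarrow> x' $$ (r, j) = (if r = dual l p then 1 else 0)"
        "\<And>r. r < 2*l \<Longrightarrow> x' $$ (r, p) = (if r = dual l j then eps l p * eps l j else 0)"
        "\<And>r. r < 2*l \<Longrightarrow> x' $$ (r, dual l p) = 0"
        "\<And>r. r < 2*l \<Longrightarrow> x' $$ (r, dual l j) = 0"
        "\<And>c r. c \<in> ?D \<Longrightarrow> r < 2*l \<Longrightarrow> x' $$ (r, c) = x $$ (r, c)"
        by (rule edge_step[OF x lt jp(2,3) red jp(4-8)]) (assumption | (rule that; assumption))+
      note agree' = agrees_on_covered_cong[OF agree g(8)]
      show ?thesis
      proof (cases "(j < l \<longleftrightarrow> p < l) \<and> vtx b (base l j) = vtx b (base l p)")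
        case False
        obtain qs' where "placement l b qs'" "agrees_on_covered l qs' x'"
            "covered l qs' = ?D \<union> {j, dual l j, p, dual l p}"
          by (rule extend_by_pair[OF qs agree' lt jp(4,2,3,5) _ g(4-7)])
            (use False in blast | assumption | (rule that; assumption))+
        then show ?thesis using step[of g x'] g(1-3) Borel_P j2 jp(4) by blast
      next
        case True
        \<comment> \<open>What remains is a dotted arrow inside one block, which no pattern
          contains. Equal signs give columns \<open>j\<close> and \<open>p\<close> the symmetric
          shape that splits into two dotted loops.\<close>
        have e: "eps l p = eps l j" using True by (simp add: eps_def)
        have lab: "label l b j = label l b p" "label l b (dual l j) = label l b (dual l p)"
          using True j2 jp(2) by (cases "p < l"; simp add: label_def base_def dual_less_iff)+
        have cp: "x' $$ (r, p) = (if r = dual l j then 1 else 0)" if "r < 2*l" for r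
          using g(5)[OF that] e by simp
        obtain h y where h: "h \<in> SP l" "y \<in> N2 l" "h * y = x' * h"
          "\<And>r c. r < 2*l \<Longrightarrow> c < 2*l \<Longrightarrow> h $$ (r, c) \<noteq> 0 \<Longrightarrow>
            r = c \<or> r \<in> {j, p} \<and> c \<in> {j, p} \<or> r \<in> {dual l j, dual l p} \<and> c \<in> {dual l j, dual l p}"
          "\<And>r. r < 2*l \<Longrightarrow> y $$ (r, j) = (if r = dual l j then 1 else 0)"
          "\<And>r. r < 2*l \<Longrightarrow> y $$ (r, p) = (if r = dual l p then 1 else 0)"
          "\<And>r. r < 2*l \<Longrightarrow> y $$ (r, dual l p) = 0"
          "\<And>r. r < 2*l \<Longrightarrow> y $$ (r, dual l j) = 0"
          "\<And>c r. c \<in> ?D \<Longrightarrow> r < 2*l \<Longrightarrow> y $$ (r, c) = x' $$ (r, c)"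
        by (rule pair_step[OF g(2) j2 jp(2,3) False e reduced_on_agrees[OF qs agree'] jp(4,5) g(4) cp]) (assumption | (rule that; assumption))+
        have "label l b r = label l b c" if "r < 2*l" "c < 2*l" "h $$ (r, c) \<noteq> 0" for r c
          using h(4)[OF that] lab by auto
        then have hP: "h \<in> P" using P_Levi[OF h(1)] by blast
        have gP: "g \<in> P" using g(1) Borel_P by blast
        obtain qs1 where qs1: "placement l b qs1" "agrees_on_covered l qs1 y" "covered l qs1 = ?D \<union> {j, dual l j}"
        by (rule extend_by_loop[OF qs agrees_on_covered_cong[OF agree' h(9)] j2 jp(4) h(5,8)]) (assumption | (rule that; assumption))+
        have "p \<notin> covered l qs1" using jp(3,5) False qs1(3) by auto
        then obtain qs2 where qs2: "placement l b qs2" "agrees_on_covered l qs2 y"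
            "covered l qs2 = covered l qs1 \<union> {p, dual l p}"
        by (rule extend_by_loop[OF qs1(1,2) jp(2) _ h(6,7)]) (assumption | (rule that; assumption))+
        have cov: "covered l qs2 = ?D \<union> {j, dual l j, p, dual l p}" using qs2(3) qs1(3) by auto
        have gh: "g * h \<in> P" using subgroup.m_closed[OF subgroup_P gP hP] by simp
        have c: "g \<in> carrier_mat (2*l) (2*l)" "h \<in> carrier_mat (2*l) (2*l)" "x' \<in> carrier_mat (2*l) (2*l)" "y \<in> carrier_mat (2*l) (2*l)"
          using SP_carrier[OF P_SP[OF gP]] SP_carrier[OF h(1)] N2_carrier[OF g(2)] N2_carrier[OF h(2)] by auto
        have "(g * h) * y = x * (g * h)" using g(3) h(3) c xc by (metis assoc_mult_mat)
        then show ?thesis using step[OF gh h(2) _ qs2(1,2) cov] j2 jp(4) by blast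
      qed
    qed
  qed
qed

end

section \<open>Coordinate subspaces\<close>

context adapted_parabolic
begin

abbreviation P_orbit :: "complex mat \<Rightarrow> complex mat set" where
  "P_orbit \<equiv> orbit ((SP_group l)\<lparr>carrier := P\<rparr>) (conj_action l)"

lemma esolp_matrices_eq:
  assumes "p \<in> esolps b"
  shows "esolp_matrices l b p = pattern_mat l ` {qs. placement l b qs \<and> mset (map fst qs) = p}"
proof -
  have "edge_wf (length b) (fst q)" if "mset (map fst qs) = p" "q \<in> set qs" for q qs
  proof -
    have "fst q \<in># p" using that by (metis image_eqI list.set_map set_mset_mset)
    then show ?thesis using assms by (simp add: esolps_def)
  qed
  then show ?thesis
    unfolding esolp_matrices_def placement_def positions_def pattern_mat_def by blast
qed

text \<open>The union over placements collapses to one orbit, since any two placements are conjugate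
  under the Levi subgroup.\<close>

lemma esolp_orbit_eq:
  assumes qs: "placement l b qs" and p: "mset (map fst qs) = p"
  shows "esolp_orbit l P b p = P_orbit (pattern_mat l qs)"
proof -
  have pe: "p \<in> esolps b" using placement_esolps[OF qs] p by simp
  have "P_orbit (pattern_mat l qs') = P_orbit (pattern_mat l qs)"
    if qs': "placement l b qs'" "mset (map fst qs') = p" for qs'
  proof -
    have m: "mset (map fst qs') = mset (map fst qs)" using qs'(2) p by simp
    obtain g where g: "g \<in> SP l" "g * pattern_mat l qs' = pattern_mat l qs * g"
      "\<And>r c. r < 2*l \<Longrightarrow> c < 2*l \<Longrightarrow> g $$ (r, c) \<noteq> 0 \<Longrightarrow> label l b r = label l b c"
      by (rule placements_conj[OF sum_b qs'(1) qs m]) (rule that; assumption)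
    have "g \<in> P" using P_Levi[OF g(1,3)] .
    then have "conj_by l P (pattern_mat l qs') (pattern_mat l qs)"
      using g(2) unfolding conj_by_def by auto
    then show ?thesis by (intro orbit_cong[OF subgroup_P]) auto
  qed
  then show ?thesis
    unfolding esolp_orbit_def esolp_matrices_eq[OF pe] using qs p by blast
qed

text \<open>Injectivity comes from the corner counts, surjectivity from the reduction.\<close>

theorem esolp_orbit_bij:
  "bij_betw (esolp_orbit l P b) (esolps b) (orbits ((SP_group l)\<lparr>carrier := P\<rparr>) (N2 l) (conj_action l))"
proof (intro bij_betwI' ballI)
  fix p p' assume p: "p \<in> esolps b" and p': "p' \<in> esolps b"
  obtain qs where qs: "placement l b qs" "mset (map fst qs) = p" using ex_placement[OF p] .
  obtain qs' where qs': "placement l b qs'" "mset (map fst qs') = p'" using ex_placement[OF p'] .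
  show "esolp_orbit l P b p = esolp_orbit l P b p' \<longleftrightarrow> p = p'"
  proof
    assume "esolp_orbit l P b p = esolp_orbit l P b p'"
    then have "{y. conj_by l P (pattern_mat l qs) y} = {y. conj_by l P (pattern_mat l qs') y}"
      unfolding esolp_orbit_eq[OF qs] esolp_orbit_eq[OF qs'] orbit_eq[OF subgroup_P pattern_mat_carrier] .
    then have "conj_by l P (pattern_mat l qs) (pattern_mat l qs')"
      using conj_by_refl[OF subgroup_P pattern_mat_carrier] by blast
    then show "p = p'" using conj_placements_mset_eq[OF qs(1) qs'(1)] qs(2) qs'(2) by simp
  qed simp
next
  fix p assume p: "p \<in> esolps b"
  obtain qs where qs: "placement l b qs" "mset (map fst qs) = p" using ex_placement[OF p] .
  show "esolp_orbit l P b p \<in> orbits ((SP_group l)\<lparr>carrier := P\<rparr>) (N2 l) (conj_action l)"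
    unfolding esolp_orbit_eq[OF qs] orbits_def using pattern_mat_N2[OF placementD[OF qs(1)]] by blast
next
  fix S assume "S \<in> orbits ((SP_group l)\<lparr>carrier := P\<rparr>) (N2 l) (conj_action l)"
  then obtain x where x: "x \<in> N2 l" "S = P_orbit x" by (auto simp: orbits_def)
  \<comment> \<open>The reduction starts from the empty placement, which covers nothing and imposes
    no condition on \<open>x\<close>.\<close>
  have "placement l b []" "agrees_on_covered l [] x"
    by (simp_all add: placement_def positions_def agrees_on_covered_def covered_def)
  then obtain qs where qs: "placement l b qs" "conj_by l P x (pattern_mat l qs)"
    using ex_conj_pattern[OF x(1)] by blast
  have "S = esolp_orbit l P b (mset (map fst qs))"
    unfolding esolp_orbit_eq[OF qs(1) refl] x(2) by (rule orbit_cong[OF subgroup_P N2_carrier[OF x(1)] qs(2)])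
  then show "\<exists>p\<in>esolps b. S = esolp_orbit l P b p" using placement_esolps[OF qs(1)] by blast
qed

end

section \<open>Initial coordinate subspaces and their dimension\<close>

definition coord_space :: "nat \<Rightarrow> nat \<Rightarrow> complex vec set" where
  "coord_space n d = {v \<in> carrier_vec n. \<forall>r. d \<le> r \<longrightarrow> r < n \<longrightarrow> v $ r = 0}"

lemma coord_space_subset_iff:
  assumes "d \<le> n" 
  shows "coord_space n d \<subseteq> coord_space n d' \<longleftrightarrow> d \<le> d'"
proof
  assume *: "coord_space n d \<subseteq> coord_space n d'"
  show "d \<le> d'"
  proof (rule ccontr)
    assume "\<not> d \<le> d'"
    then have "unit_vec n d' \<in> coord_space n d" using assms by (auto simp: coord_space_def)
    then have "unit_vec n d' \<in> coord_space n d'" using * by blast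
    then show False using \<open>\<not> d \<le> d'\<close> assms by (auto simp: coord_space_def)
  qed
qed (auto simp: coord_space_def)

lemma coord_space_subset:
  assumes "d \<le> n"
    and unit: "\<And>i. i < d \<Longrightarrow> unit_vec n i \<in> N"
    and zero: "0\<^sub>v n \<in> N" and add: "\<And>v w. v \<in> N \<Longrightarrow> w \<in> N \<Longrightarrow> v + w \<in> N"
    and smult: "\<And>c v. v \<in> N \<Longrightarrow> c \<cdot>\<^sub>v v \<in> N"
  shows "coord_space n d \<subseteq> N"
  using assms(1,2)
proof (induction d)
  case 0
  have "v = 0\<^sub>v n" if "v \<in> coord_space n 0" for v
    using that by (intro eq_vecI) (auto simp: coord_space_def)
  then show ?case using zero by blast
next
  case (Suc d)
  show ?case
  proof
    fix v assume v: "v \<in> coord_space n (Suc d)"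
    define w where "w = vec n (\<lambda>r. if r < d then v $ r else 0)"
    have "w \<in> coord_space n d" by (auto simp: w_def coord_space_def)
    then have "w \<in> N" using Suc by auto
    moreover have "v $ d \<cdot>\<^sub>v unit_vec n d \<in> N" using Suc.prems smult by simp
    moreover have "v = w + v $ d \<cdot>\<^sub>v unit_vec n d"
    proof (rule eq_vecI)
      fix i assume "i < dim_vec (w + v $ d \<cdot>\<^sub>v unit_vec n d)"
      then have i: "i < n" by simp
      have "v $ i = 0" if "d < i" using v i that by (auto simp: coord_space_def)
      then show "v $ i = (w + v $ d \<cdot>\<^sub>v unit_vec n d) $ i"
        using i Suc.prems(1) by (cases i d rule: linorder_cases) (auto simp: w_def)
    qed (use v in \<open>auto simp: coord_space_def w_def\<close>)
    ultimately show "v \<in> N" using add by metis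
  qed
qed

text \<open>The first \<open>d\<close> unit vectors form a basis. The dimension refers to the module
  structure on the subset, so their independence and span are transferred there from the ambient
  space.\<close>

lemma subspace_dim_coord_space:
  assumes "d \<le> n"
  shows "subspace_dim n (coord_space n d) = d"
proof -
  interpret vec_space "TYPE(complex)" n .
  let ?N = "coord_space n d" and ?S = "unit_vec n ` {..<d} :: complex vec set"
  have sub: "submodule class_ring ?N V"
    by unfold_locales (auto simp: coord_space_def)
  have SN: "?S \<subseteq> ?N" using assms by (auto simp: coord_space_def)
  have SU: "?S \<subseteq> set (unit_vecs n)" using assms by (auto simp: unit_vecs_def)
  then have Sc: "?S \<subseteq> carrier_vec n" using unit_vecs_carrier by blast
  have "lin_indpt ?S"
    using subset_li_is_li[of "set (unit_vecs n)" ?S] unit_vecs_basis SU by (auto simp: basis_def)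
  then have 1: "\<not> LinearCombinations.module.lin_dep class_ring (vs ?N) ?S"
    using span_li_not_depend(2)[OF SN sub] by simp
  have "span ?S = ?N"
  proof
    show "span ?S \<subseteq> ?N" by (rule span_is_subset[OF SN sub])
    interpret S: submodule class_ring "span ?S" V by (rule span_is_submodule[OF Sc])
    show "?N \<subseteq> span ?S"
    proof (rule coord_space_subset[OF assms])
      show "unit_vec n i \<in> span ?S" if "i < d" for i using in_own_span[OF Sc] that by auto
      show "0\<^sub>v n \<in> span ?S" using S.zero_closed by simp
      show "v + w \<in> span ?S" if "v \<in> span ?S" "w \<in> span ?S" for v w using S.m_closed that by simp
      show "c \<cdot>\<^sub>v v \<in> span ?S" if "v \<in> span ?S" for c v using S.smult_closed that by simp
    qed
  qed
  then have 2: "LinearCombinations.module.span class_ring (vs ?N) ?S = ?N"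
    using span_li_not_depend(1)[OF SN sub] by simp
  have vs: "vectorspace class_ring (vs ?N)" by (rule subspace_is_vs) (simp add: VectorSpace.subspace_def sub vec_vs)
  have "vectorspace.dim class_ring (vs ?N) = card ?S"
    by (rule vectorspace.dim_basis[OF vs]) (use 1 2 SN in \<open>auto simp: vectorspace.basis_def[OF vs]\<close>)
  also have "\<dots> = d"
  proof -
    have "inj_on (unit_vec n :: nat \<Rightarrow> complex vec) {..<d}"
    proof (rule inj_onI)
      fix i j assume ij: "i \<in> {..<d}" "j \<in> {..<d}" and eq: "(unit_vec n i :: complex vec) = unit_vec n j"
      have "(unit_vec n i :: complex vec) $ i = unit_vec n j $ i" using eq by simp
      then show "i = j" using ij assms by (simp split: if_splits)
    qed
    then show ?thesis by (simp add: card_image)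
  qed
  finally show ?thesis by (simp add: subspace_dim_def)
qed

section \<open>Standard parabolic subgroups\<close>

text \<open>\<open>symplectic_change\<close> asks for some element of \<open>N2 l\<close>; the zero
  matrix, belonging to the empty pattern, serves.\<close>

lemma symplectic_basis_SP:
  assumes "symplectic_basis l v"
  shows "basis_mat l v \<in> SP l"
proof -
  have "0\<^sub>m (2*l) (2*l) \<in> N2 l"
    using pattern_mat_N2[of "[]" l] by (simp add: positions_def)
  from symplectic_change[OF this assms, of "{}"] show ?thesis by (simp add: reduced_on_def)
qed

lemma basis_mat_carrier [simp]: "basis_mat l v \<in> carrier_mat (2*l) (2*l)"
  by (simp add: basis_mat_def)

lemma basis_mat_mult_vec_index:
  assumes "w \<in> carrier_vec (2*l)" "i < 2*l"
  shows "(basis_mat l v *\<^sub>v w) $ i = (\<Sum>a<2*l. v a i * w $ a)"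
  using assms by (simp add: basis_mat_def scalar_prod_def atLeast0LessThan)

text \<open>Inverse eigenvalues on dual vectors keep the form. The three values 2, 1/2 and 1 are
  distinct, so a polynomial in this matrix can isolate coordinate \<open>r\<close>.\<close>

lemma torus_Borel:
  assumes r: "r < 2*l"
  defines "t \<equiv> \<lambda>a. if a = r then 2 else if a = dual l r then 1/2 else (1 :: complex)"
  shows "basis_mat l (\<lambda>a. scl (t a) (ebas a)) \<in> Borel l"
proof (rule basis_mat_Borel[OF symplectic_basis_SP[OF symplectic_basisI]])
  fix a c assume ac: "a < 2*l" "c < 2*l"
  have "t a * t (dual l a) = 1" "t (dual l a) * t a = 1"
    using r ac(1) dual_eq_iff[OF ac(1) r] by (auto simp: t_def)
  then show "form l (scl (t a) (ebas a)) (scl (t c) (ebas c)) = (if c = dual l a then eps l a else 0)"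
    using ac by (simp flip: mult.assoc)
qed (auto simp: scl_def ebas_def)

lemma root_Borel:
  assumes ar: "a < r" "r < 2*l"
  obtains v where "basis_mat l v \<in> Borel l" "v r = ebas r + ebas a"
proof -
  have a2: "a < 2*l" using ar by simp
  \<comment> \<open>The new vector at \<open>r\<close> must stay orthogonal to the one at
    \<open>dual l a\<close>, which forces \<open>eps l a + z * eps l r = 0\<close>. If
    \<open>a\<close> is dual to \<open>r\<close> these two places coincide and 0 is a
    placeholder.\<close>
  define z where "z = (if a = dual l r then 0 else - eps l a * eps l r)"
  define v where "v c = (if c = r then ebas r + ebas a else if c = dual l a then ebas (dual l a) + scl z (ebas (dual l r)) else ebas c)" for c
  have "symplectic_basis l v"
  proof (rule symplectic_basisI)
    note [[linarith_neq_limit = 0]]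
    fix c d assume cd: "c < 2*l" "d < 2*l"
    have dd: "dual l c = r \<longleftrightarrow> c = dual l r" "dual l c = a \<longleftrightarrow> c = dual l a" 
      "dual l r = c \<longleftrightarrow> c = dual l r" "dual l a = c \<longleftrightarrow> c = dual l a"
      using dual_eq_iff[OF cd(1)] ar(2) a2 by auto
    show "form l (v c) (v d) = (if d = dual l c then eps l c else 0)"
    proof (cases "a = dual l r")
      case True
      then have "dual l a = r" using ar by simp
      then have v': "v c = (if c = r then ebas r + ebas a else ebas c)" for c by (simp add: v_def)
      show ?thesis using cd ar a2 True unfolding v' by auto
    next
      case False
      then have ne: "dual l a \<noteq> r" "r \<noteq> dual l a" "a \<noteq> r" "r \<noteq> a" "a \<noteq> dual l r" using ar a2 by auto
      have vr: "v r = ebas r + ebas a" "v (dual l a) = ebas (dual l a) + scl z (ebas (dual l r))"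
        using ne by (simp_all add: v_def)
      have vo: "v c = ebas c" if "c \<noteq> r" "c \<noteq> dual l a" for c using that by (simp add: v_def)
      have z: "z = - eps l a * eps l r" using False by (simp add: z_def)
      consider "c = r" | "c = dual l a" | "c \<noteq> r" "c \<noteq> dual l a" by blast
      then show ?thesis
      proof cases
        case 1
        consider "d = r" | "d = dual l a" | "d \<noteq> r" "d \<noteq> dual l a" by blast
        then show ?thesis
          by cases (use 1 cd ar a2 ne z in \<open>simp_all add: vr vo mult.assoc\<close>)
      next
        case 2
        consider "d = r" | "d = dual l a" | "d \<noteq> r" "d \<noteq> dual l a" by blast
        then show ?thesis
          by cases (use 2 cd ar a2 ne z in \<open>simp_all add: vr vo mult.assoc\<close>)
      next
        case 3
        consider "d = r" | "d = dual l a" | "d \<noteq> r" "d \<noteq> dual l a" by blast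
        then show ?thesis
          by cases (use 3 cd ar a2 ne z dd in \<open>simp_all add: vr vo mult.assoc\<close>)
      qed
    qed
  qed
  moreover have "v c i = 0" if "c < i" "i < 2*l" for c i
  proof -
    have "dual l r < dual l a" using ar a2 by simp
    then show ?thesis using that ar by (auto simp: v_def plus_apply scl_def ebas_def)
  qed
  ultimately have "basis_mat l v \<in> Borel l" by (intro basis_mat_Borel[OF symplectic_basis_SP])
  then show thesis using that by (simp add: v_def)
qed

text \<open>The torus element isolates coordinate \<open>r\<close> and thus puts the unit vector at
  \<open>r\<close> into \<open>V\<close>; a root element then adds the unit vector at any smaller
  index to it.\<close>

lemma Borel_stable_unit_vec:
  assumes V: "V \<subseteq> carrier_vec (2*l)"
    and add: "\<And>v w. v \<in> V \<Longrightarrow> w \<in> V \<Longrightarrow> v + w \<in> V"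
    and smult: "\<And>c v. v \<in> V \<Longrightarrow> c \<cdot>\<^sub>v v \<in> V"
    and stable: "\<And>A v. A \<in> Borel l \<Longrightarrow> v \<in> V \<Longrightarrow> A *\<^sub>v v \<in> V"
    and v: "v \<in> V" "v $ r \<noteq> 0" and ar: "a \<le> r" "r < 2*l"
  shows "unit_vec (2*l) a \<in> V"
proof -
  let ?n = "2*l"
  define t where "t a = (if a = r then 2 else if a = dual l r then 1/2 else (1 :: complex))" for a
  let ?T = "basis_mat l (\<lambda>a. scl (t a) (ebas a))"
  have T: "?T \<in> Borel l" unfolding t_def by (rule torus_Borel[OF ar(2)])
  have Ti: "(?T *\<^sub>v w) $ i = t i * w $ i" if "w \<in> carrier_vec ?n" "i < ?n" for w i
  proof -
    have "(?T *\<^sub>v w) $ i = (\<Sum>a<?n. if a = i then t i * w $ i else 0)"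
      unfolding basis_mat_mult_vec_index[OF that] by (intro sum.cong) (auto simp: scl_def ebas_def)
    then show ?thesis using that by simp
  qed
  have Tc: "?T *\<^sub>v w \<in> carrier_vec ?n" for w by (simp add: basis_mat_def carrier_dim_vec)
  have vc: "v \<in> carrier_vec ?n" using V v by auto
  define u where "u = ?T *\<^sub>v v + (-1) \<cdot>\<^sub>v v"
  have u: "u \<in> V" "u \<in> carrier_vec ?n" using add smult stable[OF T] v Tc vc by (auto simp: u_def)
  define w where "w = ?T *\<^sub>v u + (-1/2) \<cdot>\<^sub>v u"
  have w: "w \<in> V" using add smult stable[OF T] u by (auto simp: w_def)
  \<comment> \<open>\<open>w\<close> arises from \<open>v\<close> by (T - 1/2)(T - 1), which kills
    the eigenvalues 1 and 1/2 and multiplies coordinate \<open>r\<close> by (2 - 1/2)(2 - 1) =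
    3/2.\<close>
  have "unit_vec ?n r = (2 / (3 * v $ r)) \<cdot>\<^sub>v w"
  proof (rule eq_vecI)
    fix i assume "i < dim_vec ((2 / (3 * v $ r)) \<cdot>\<^sub>v w)"
    then have i: "i < ?n" using u(2) by (simp add: w_def)
    have ui: "u $ i = t i * v $ i - v $ i" using i vc Tc[of v] by (simp add: u_def Ti)
    have "w $ i = t i * u $ i - u $ i / 2" using i u(2) Tc[of u] by (simp add: w_def Ti)
    then have "w $ i = (t i - 1) * (t i - 1/2) * v $ i" by (simp add: ui field_simps)
    moreover have "((2 / (3 * v $ r)) \<cdot>\<^sub>v w) $ i = 2 / (3 * v $ r) * w $ i"
      using i u(2) by (simp add: w_def)
    ultimately show "unit_vec ?n r $ i = ((2 / (3 * v $ r)) \<cdot>\<^sub>v w) $ i"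
      using i v(2) ar(2) by (simp add: t_def)
  qed (use u(2) in \<open>simp add: w_def\<close>)
  then have er: "unit_vec ?n r \<in> V" using smult[OF w] by simp
  show ?thesis
  proof (cases "a = r")
    case False
    then have "a < r" using ar by simp
    then obtain f where f: "basis_mat l f \<in> Borel l" "f r = ebas r + ebas a" using root_Borel[OF _ ar(2)] by metis
    have "unit_vec ?n a = basis_mat l f *\<^sub>v unit_vec ?n r + (-1) \<cdot>\<^sub>v unit_vec ?n r"
    proof (rule eq_vecI)
      fix i assume "i < dim_vec (basis_mat l f *\<^sub>v unit_vec ?n r + (-1) \<cdot>\<^sub>v unit_vec ?n r)"
      then have i: "i < ?n" by simp
      have "(basis_mat l f *\<^sub>v unit_vec ?n r) $ i = (\<Sum>c<?n. if c = r then f r i else 0)"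
        unfolding basis_mat_mult_vec_index[OF unit_vec_carrier i] using ar(2) by (intro sum.cong) auto
      also have "\<dots> = ebas r i + ebas a i" using ar(2) by (simp add: f(2) plus_apply)
      finally show "unit_vec ?n a $ i = (basis_mat l f *\<^sub>v unit_vec ?n r + (-1) \<cdot>\<^sub>v unit_vec ?n r) $ i"
        using i ar \<open>a < r\<close> by (simp add: ebas_def)
    qed (simp add: basis_mat_def)
    then show ?thesis using add[OF stable[OF f(1) er] smult[OF er]] by simp
  qed (use er in simp)
qed

lemma Borel_stable_coord_space:
  assumes V: "V \<subseteq> carrier_vec (2*l)" and zero: "0\<^sub>v (2*l) \<in> V"
    and add: "\<And>v w. v \<in> V \<Longrightarrow> w \<in> V \<Longrightarrow> v + w \<in> V"
    and smult: "\<And>c v. v \<in> V \<Longrightarrow> c \<cdot>\<^sub>v v \<in> V"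
    and stable: "\<And>A v. A \<in> Borel l \<Longrightarrow> v \<in> V \<Longrightarrow> A *\<^sub>v v \<in> V"
  obtains d where "d \<le> 2*l" "V = coord_space (2*l) d"
proof -
  define R where "R = {r. r < 2*l \<and> (\<exists>v\<in>V. v $ r \<noteq> 0)}"
  have unit: "unit_vec (2*l) a \<in> V" if "r \<in> R" "a \<le> r" for a r
    using that Borel_stable_unit_vec[OF V add smult stable] unfolding R_def by blast
  have down: "a \<in> R" if "r \<in> R" "a \<le> r" for a r
    using unit[OF that] that unfolding R_def by (auto intro!: bexI[of _ "unit_vec (2*l) a"])
  have fin: "finite R" by (simp add: R_def)
  \<comment> \<open>The occurring indices are downward closed and start at 0, so \<open>d\<close> is
    one more than the largest of them.\<close>
  define d where "d = (if R = {} then 0 else Suc (Max R))"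
  have R: "r \<in> R \<longleftrightarrow> r < d" for r
  proof (cases "R = {}")
    case False
    then show ?thesis using Max_in[OF fin False] Max_ge[OF fin] down[of "Max R" r]
      by (auto simp: d_def less_Suc_eq_le)
  qed (simp add: d_def)
  have d: "d \<le> 2*l"
  proof (rule ccontr)
    assume "\<not> ?thesis"
    then have "2*l \<in> R" using R by simp
    then show False by (simp add: R_def)
  qed
  have "coord_space (2*l) d \<subseteq> V"
    by (rule coord_space_subset[OF d _ zero add smult]) (use R unit in auto)
  moreover have "V \<subseteq> coord_space (2*l) d"
  proof
    fix v assume "v \<in> V"
    then show "v \<in> coord_space (2*l) d" using V R unfolding coord_space_def R_def by (auto simp: not_less[symmetric])
  qed
  ultimately show thesis using that d by blast
qed

lemma subspace_closed:
  assumes "VectorSpace.subspace class_ring V (module_vec TYPE(complex) n)"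
  shows "V \<subseteq> carrier_vec n" "0\<^sub>v n \<in> V" "v \<in> V \<Longrightarrow> w \<in> V \<Longrightarrow> v + w \<in> V" "v \<in> V \<Longrightarrow> c \<cdot>\<^sub>v v \<in> V"
proof -
  interpret submodule class_ring V "module_vec TYPE(complex) n"
    using assms by (simp add: VectorSpace.subspace_def)
  show "V \<subseteq> carrier_vec n" "0\<^sub>v n \<in> V" "v \<in> V \<Longrightarrow> w \<in> V \<Longrightarrow> v + w \<in> V" "v \<in> V \<Longrightarrow> c \<cdot>\<^sub>v v \<in> V"
    using subset zero_closed m_closed[of v w] smult_closed[of c v] by (simp_all add: module_vec_simps)
qed

lemma coord_space_stable:
  assumes g: "g \<in> carrier_mat n n" and z: "\<And>r c. d \<le> r \<Longrightarrow> r < n \<Longrightarrow> c < d \<Longrightarrow> c < n \<Longrightarrow> g $$ (r, c) = 0"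
    and v: "v \<in> coord_space n d"
  shows "g *\<^sub>v v \<in> coord_space n d"
proof -
  have vc: "v \<in> carrier_vec n" and v0: "\<And>c. d \<le> c \<Longrightarrow> c < n \<Longrightarrow> v $ c = 0" using v by (auto simp: coord_space_def)
  have "(g *\<^sub>v v) $ r = 0" if r: "d \<le> r" "r < n" for r
  proof -
    have "(g *\<^sub>v v) $ r = (\<Sum>c<n. g $$ (r, c) * v $ c)"
      using g vc r by (simp add: scalar_prod_def atLeast0LessThan)
    also have "\<dots> = 0"
    proof (rule sum.neutral, safe)
      fix c assume "c < n"
      then show "g $$ (r, c) * v $ c = 0" using z[OF r, of c] v0[of c] by (cases "c < d") auto
    qed
    finally show ?thesis .
  qed
  then show ?thesis using g vc by (auto simp: coord_space_def)
qed

lemma stable_coord_space_entries: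
  assumes g: "g \<in> carrier_mat n n" and s: "\<And>v. v \<in> coord_space n d \<Longrightarrow> g *\<^sub>v v \<in> coord_space n d"
    and rc: "d \<le> r" "r < n" "c < d" "c < n"
  shows "g $$ (r, c) = 0"
proof -
  have "g *\<^sub>v unit_vec n c \<in> coord_space n d" using rc by (intro s) (auto simp: coord_space_def)
  moreover have "(g *\<^sub>v unit_vec n c) $ r = g $$ (r, c)" using g rc by simp
  ultimately show ?thesis using rc by (auto simp: coord_space_def)
qed

lemma label_dual_eq: "sum_list b = l \<Longrightarrow> a < 2*l \<Longrightarrow> label l b (dual l a) = 2 * length b + 1 - label l b a"
proof -
  assume b: "sum_list b = l" and a: "a < 2*l"
  show ?thesis
  proof (cases "a < l")
    case True
    then show ?thesis by (simp add: label_less label_dual)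
  next
    case False
    then have d: "dual l a < l" using a dual_less_iff by blast
    then show ?thesis using vtx_bounds[of "dual l a" b] b False by (simp add: label_def)
  qed
qed

lemma symp_adj_nonzero:
  assumes "g \<in> carrier_mat (2*l) (2*l)" "r < 2*l" "c < 2*l"
  shows "symp_adj l g $$ (r, c) \<noteq> 0 \<longleftrightarrow> g $$ (dual l c, dual l r) \<noteq> 0"
  unfolding symp_adj_index[OF assms] by simp

text \<open>\<open>P\<close> contains the Borel subgroup, so every member of the flag is Borel
  stable and hence a coordinate space. The block vector telescopes, which turns stability of the
  flag into conditions on labels.\<close>

lemma adapted_parabolic_flag:
  assumes P: "standard_parabolic l P" and flag: "isotropic_flag l Vs" and stab: "P = flag_stabilizer l Vs"
    and lagrangian: "subspace_dim (2 * l) (last Vs) = l"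
  shows "adapted_parabolic l (block_vector l Vs) P"
proof -
  let ?n = "2*l" and ?b = "block_vector l Vs" and ?k = "length Vs"
  define ds where "ds i = subspace_dim ?n (Vs ! i)" for i
  have sub: "subgroup P (SP_group l)" and Bor: "Borel l \<subseteq> P" using P by (auto simp: standard_parabolic_def)
  have PS: "P \<subseteq> SP l" using stab by (auto simp: flag_stabilizer_def)
  have ne: "Vs \<noteq> []" and sorted: "sorted_wrt (\<subset>) Vs" 
    and subsp: "\<And>V. V \<in> set Vs \<Longrightarrow> VectorSpace.subspace class_ring V (module_vec TYPE(complex) ?n)"
    using flag by (auto simp: isotropic_flag_def)
  have stable: "A *\<^sub>v v \<in> V" if "A \<in> P" "V \<in> set Vs" "v \<in> V" for A V v
    using that stab by (auto simp: flag_stabilizer_def)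
  have Vs: "ds i \<le> ?n \<and> Vs ! i = coord_space ?n (ds i)" if i: "i < ?k" for i
  proof -
    have m: "Vs ! i \<in> set Vs" using i by simp
    note cl = subspace_closed[OF subsp[OF m]]
    obtain d where d: "d \<le> ?n" "Vs ! i = coord_space ?n d"
      by (rule Borel_stable_coord_space[OF cl]) (use stable m Bor that in blast)+
    then have "ds i = d" by (simp add: ds_def subspace_dim_coord_space)
    then show ?thesis using d by simp
  qed
  have mono: "ds i < ds j" if "i < j" "j < ?k" for i j
  proof -
    have "Vs ! i \<subset> Vs ! j" using sorted that by (simp add: sorted_wrt_iff_nth_less)
    then have "coord_space ?n (ds i) \<subset> coord_space ?n (ds j)" using Vs that by simp
    then show ?thesis using coord_space_subset_iff[of "ds i" ?n "ds j"] coord_space_subset_iff[of "ds j" ?n "ds i"] Vs that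
      by (metis less_le_not_le less_trans not_le)
  qed
  have len: "length ?b = ?k" by (simp add: block_vector_def)
  have bi: "?b ! i = ds i - (if i = 0 then 0 else ds (i - 1))" if "i < ?k" for i
    using that by (simp add: block_vector_def ds_def)
  have sums: "sum_list (take (Suc i) ?b) = ds i" if "i < ?k" for i
    using that
  proof (induction i)
    case 0
    then show ?case using bi[of 0] len by (simp add: take_Suc_conv_app_nth)
  next
    case (Suc i)
    then have "sum_list (take (Suc (Suc i)) ?b) = ds i + ?b ! Suc i"
      using len by (simp add: take_Suc_conv_app_nth[of "Suc i"])
    then show ?case using bi[OF Suc.prems] mono[of i "Suc i"] Suc.prems by simp
  qed
  have last: "ds (?k - 1) = l" using lagrangian ne by (simp add: ds_def last_conv_nth)
  have sum_b: "sum_list ?b = l"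
    using sums[of "?k - 1"] ne last len by simp
  have dl: "ds i \<le> l" if "i < ?k" for i
  proof (cases "i = ?k - 1")
    case False
    then have "i < ?k - 1" "?k - 1 < ?k" using that by linarith+
    then show ?thesis using mono[of i "?k - 1"] last by simp
  qed (use last in simp)
  have vtx: "vtx ?b c \<le> Suc i \<longleftrightarrow> c < ds i" if "c < l" "i < ?k" for c i
    using vtx_le_iff[of c ?b "Suc i"] sums[OF that(2)] that(1) sum_b by simp
  have vb: "1 \<le> vtx ?b c \<and> vtx ?b c \<le> ?k" if "c < l" for c
    using vtx_bounds[of c ?b] that sum_b len by simp
  have low: "r < l \<and> vtx ?b r \<le> vtx ?b c"
    if g: "g \<in> P" and rc: "r < ?n" "c < l" "g $$ (r, c) \<noteq> 0" for g r c
  proof -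
    \<comment> \<open>Vertices count from 1, positions in \<open>Vs\<close> from 0.\<close>
    define i where "i = vtx ?b c - 1"
    have i: "i < ?k" "vtx ?b c = Suc i" using vb[OF rc(2)] by (auto simp: i_def)
    have gc: "g \<in> carrier_mat ?n ?n" using g PS SP_carrier by blast
    have c: "c < ds i" using vtx[OF rc(2) i(1)] i(2) by simp
    have "r < ds i"
    proof (rule ccontr)
      assume "\<not> r < ds i"
      moreover have "g *\<^sub>v v \<in> coord_space ?n (ds i)" if "v \<in> coord_space ?n (ds i)" for v
        using stable[OF g nth_mem[OF i(1)], of v] Vs[OF i(1)] that by simp
      ultimately show False
        using stable_coord_space_entries[OF gc, of "ds i" r c] rc c by auto
    qed
    then show ?thesis using vtx[of r i] dl[OF i(1)] i by auto
  qed
  have up: "label l ?b r \<le> label l ?b c"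
    if g: "g \<in> P" and rc: "r < ?n" "c < ?n" "g $$ (r, c) \<noteq> 0" for g r c
  proof (cases "c < l")
    case True
    then show ?thesis using low[OF g rc(1) True rc(3)] by (simp add: label_less)
  next
    case False
    then have dc: "dual l c < l" using rc dual_less_iff by blast
    show ?thesis
    proof (cases "r < l")
      case True
      then show ?thesis using False vb[OF True] vb[OF dc] len by (simp add: label_def, linarith)
    next
      case rl: False
      then have dr: "dual l r < l" using rc dual_less_iff by blast
      have gS: "g \<in> SP l" using g PS by blast
      \<comment> \<open>The remaining entries are read from the inverse: reflection in the
        antidiagonal moves them to columns of the first half.\<close>
      have h: "symp_adj l g \<in> P" using subgroup.m_inv_closed[OF sub g] inv_SP[OF gS] by simp
      have "symp_adj l g $$ (dual l c, dual l r) \<noteq> 0"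
        using symp_adj_nonzero[OF SP_carrier[OF gS], of "dual l c" "dual l r"] rc by simp
      from low[OF h _ dr this] have "vtx ?b (dual l c) \<le> vtx ?b (dual l r)" using rc by simp
      then show ?thesis using False rl by (simp add: label_def)
    qed
  qed
  have stab_levi: "g *\<^sub>v v \<in> coord_space ?n (ds i)"
    if gc: "g \<in> carrier_mat ?n ?n" and lab: "\<And>r c. r < ?n \<Longrightarrow> c < ?n \<Longrightarrow> g $$ (r, c) \<noteq> 0 \<Longrightarrow> label l ?b r = label l ?b c"
      and i: "i < ?k" and v: "v \<in> coord_space ?n (ds i)" for g i v
  proof (rule coord_space_stable[OF gc _ v], rule ccontr)
    fix r c assume rc: "ds i \<le> r" "r < ?n" "c < ds i" "c < ?n" "g $$ (r, c) \<noteq> 0"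
    have cl: "c < l" using rc dl[OF i] by simp
    have eq: "label l ?b r = vtx ?b c" using lab[OF rc(2,4,5)] cl by (simp add: label_less)
    have "r < l"
    proof (rule ccontr)
      assume "\<not> r < l"
      then have "dual l r < l" using rc dual_less_iff by blast
      then show False using eq vb[OF cl] vb[of "dual l r"] \<open>\<not> r < l\<close> len by (simp add: label_def, linarith)
    qed
    then show False using eq vtx[OF _ i, of r] vtx[OF cl i] rc by (simp add: label_less)
  qed
  have levi: "g \<in> P" if g: "g \<in> SP l"
    and lab: "\<And>r c. r < ?n \<Longrightarrow> c < ?n \<Longrightarrow> g $$ (r, c) \<noteq> 0 \<Longrightarrow> label l ?b r = label l ?b c" for g
  proof -
    let ?h = "symp_adj l g"
    have gc: "g \<in> carrier_mat ?n ?n" using SP_carrier[OF g] .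
    have hc: "?h \<in> carrier_mat ?n ?n" using gc by simp
    \<comment> \<open>The stabilizer asks for equality of \<open>V\<close> and its image, so the
      inverse has to preserve labels too.\<close>
    have lab': "label l ?b r = label l ?b c" if rc: "r < ?n" "c < ?n" "?h $$ (r, c) \<noteq> 0" for r c
    proof -
      have "label l ?b (dual l c) = label l ?b (dual l r)"
        using lab[of "dual l c" "dual l r"] symp_adj_nonzero[OF gc rc(1,2)] rc by simp
      then have "label l ?b (dual l (dual l c)) = label l ?b (dual l (dual l r))"
        using label_dual_eq[OF sum_b, of "dual l c"] label_dual_eq[OF sum_b, of "dual l r"] rc by simp
      then show ?thesis using rc by simp
    qed
    have "(\<lambda>v. g *\<^sub>v v) ` V = V" if Vm: "V \<in> set Vs" for V
    proof -
      obtain i where i: "i < ?k" "Vs ! i = V" using Vm by (auto simp: in_set_conv_nth)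
      have V: "V = coord_space ?n (ds i)" using conjunct2[OF Vs[OF i(1)]] unfolding i(2) .
      have "v \<in> (\<lambda>v. g *\<^sub>v v) ` V" if v: "v \<in> V" for v
      proof -
        have "v \<in> carrier_vec ?n" using v V by (simp add: coord_space_def)
        then have "g *\<^sub>v (?h *\<^sub>v v) = v"
          using SP_inverse(2)[OF g] assoc_mult_mat_vec[OF gc hc, of v] by simp
        moreover have "?h *\<^sub>v v \<in> V" unfolding V by (rule stab_levi[OF hc lab' i(1)]) (use v V in auto)
        ultimately show ?thesis by (metis image_eqI)
      qed
      moreover have "g *\<^sub>v v \<in> V" if "v \<in> V" for v
        unfolding V by (rule stab_levi[OF gc lab i(1)]) (use that V in auto)
      ultimately show ?thesis by blast
    qed
    then show ?thesis using g stab by (auto simp: flag_stabilizer_def)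
  qed
  show ?thesis using sum_b sub Bor up levi by (rule adapted_parabolic.intro)
qed

theorem theorem7p4:
  fixes l :: nat and P :: "complex mat set" and Vs :: "complex vec set list"
  assumes "standard_parabolic l P"
    and "isotropic_flag l Vs"
    and "P = flag_stabilizer l Vs"
    and lagrangian: "subspace_dim (2 * l) (last Vs) = l"
  shows "bij_betw (esolp_orbit l P (block_vector l Vs)) (esolps (block_vector l Vs))
           (orbits ((SP_group l)\<lparr>carrier := P\<rparr>) (N2 l) (conj_action l))"
  using adapted_parabolic.esolp_orbit_bij[OF adapted_parabolic_flag[OF assms]] .

end
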